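(* Let $X$ be a real Banach space and let $\partial$ be a subdifferential on $X$ (in the sense of the context). Any $g\in\mathrm{LACG}_*^{\natural a}(X)$ can be represented through its subdifferential via the integration formula $$g(\bar x+u)-g(\bar x)=\int_0^1 g^{\natural}(\bar x_t;u)\,dt,\qquad \forall\,[\bar x,\bar x+u]\subset\mathrm{dom}\, g,\quad \bar x_t=\bar x+tu,$$ (Henstock–Kurzweil integral), where $$g^{\natural}(\bar x_t;u)=\inf_{\alpha\ge0}\limsup_{x\to_u\bar x_t}g^{\partial}(x;u+\alpha(\bar x_t-x))\quad\text{for every }t\in[0,1].$$
   Context: Throughout, $X$ is a real Banach space with dual $X^*$. All functions $f:X\to\,]-\infty,+\infty]$ are lower semicontinuous (lsc) and proper, i.e. $\mathrm{dom} f:=\{x: f(x)<\infty\}\neq\emptyset$. $[x,y]:=\{x+t(y-x):t\in[0,1]\}$. **Convergence in a direction.** A net $(x_\nu)$ converges to $\bar x$ in the direction $v\in X$, written $x_\nu\to_v\bar x$, if there are nets $t_\nu\searrow0$ (i.e. $t_\nu\to 0$, $t_\nu>0$) and $v_\nu\to v$ with $x_\nu=\bar x+t_\nu v_\nu$. Thus $\limsup_{x\to_v\bar x}F(x)=\inf_{\varepsilon>0}\sup\{F(\bar x+tv'):0<t<\varepsilon,\|v'-v\|<\varepsilon\}$. **Subderivatives.** For $\bar x\in\mathrm{dom} f$, $u\in X$: $f^r(\bar x;u):=\liminf_{t\searrow0}\frac{f(\bar x+tu)-f(\bar x)}{t}$; $f^\uparrow(\bar x;u):=\sup_{\delta>0}\limsup_{t\searrow0,\,(x,f(x))\to(\bar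 x,f(\bar x))}\inf_{u'\in B_\delta(u)}\frac{f(x+tu')-f(x)}{t}$, with $B_\delta(u)$ the ball of radius $\delta$ around $u$. For $\bar x\notin\mathrm{dom} f$ these are defined to be $-\infty$. Moreover, for $\bar x\in\mathrm{dom} f$, $f^{\natural}(\bar x;u):=\inf_{\alpha\ge0}\limsup_{x\to_u\bar x}f^r(x;u+\alpha(\bar x-x))$. **Subdifferential.** For $\bar x\in\mathrm{dom} f$ put $\partial_{MR}f(\bar x):=\{x^*\in X^*:\langle x^*,y-\bar x\rangle+f(\bar x)\le f(y)\ \forall y\in X\}$ and $\partial_Cf(\bar x):=\{x^*\in X^*:\langle x^*,u\rangle\le f^\uparrow(\bar x;u)\ \forall u\in X\}$ (both empty for $\bar x\notin\mathrm{dom} f$). A subdifferential is an operator $\partial$ that associates a set-valued mapping $\partial f:X\rightrightarrows X^*$ (identified with its graph) to each function $f$ on $X$ so that $\partial_{MR}f\subset\partial f\subset\partial_Cf$ and the following Separation Principle holds: for any lsc $f,\varphi$ with $\varphi$ convex and Lipschitz near $\bar x\in\mathrm{dom} f$, if $f+\varphi$ admits a local minimum at $\bar x$, then $0\in\widehat\partial f(\bar x)+\partial\varphi(\bar x)$, where $\widehat\partial f(\bar x)$ is the set of $\bar x^*\in X^*$ for which there is a net $((x_\nu,x_\nu^* ))_\nu\subset\partial f$ with $(x_\nu,f(x_\nu))\to(\bar x,f(\bar x))$, $x_\nu^*\to\bar x^*$ weak$^*$, and $\limsup_\nu\langle x_\nu^*,x_\nu-\bar x\rangle\le0$. The associated subderivative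 is $f^\partial(x;u):=\sup\{\langle x^*,u\rangle:x^*\in\partial f(x)\}$, with $\sup\emptyset=-\infty$. **ACG$_*$.** For $\varphi:[a,b]\to\mathbb R$ let $\omega(\varphi,[c,d]):=\sup\{|\varphi(y)-\varphi(x)|:c\le x\le y\le d\}$. $\varphi$ is AC$_*$ on $S\subset[a,b]$ if for each $\varepsilon>0$ there is $\delta>0$ such that $\sum_{i=1}^n\omega(\varphi,[c_i,d_i])<\varepsilon$ whenever $\{[c_i,d_i]\}_{i=1}^n$ is a finite collection of non-overlapping intervals with endpoints in $S$ and $\sum(d_i-c_i)<\delta$. $\varphi$ is ACG$_*$ on $S$ if $\varphi|_S$ is continuous and $S$ is a countable union of sets on each of which $\varphi$ is AC$_*$. **Classes of functions.** $\mathrm{LACG}_*(X)$ is the class of (proper) lsc functions $f$ on $X$ whose restrictions to line segments $[a,b]\subset\mathrm{dom} f$ are ACG$_*$ (i.e. $t\mapsto f(a+t(b-a))$ is ACG$_*$ on $[0,1]$). $\mathrm{LACG}_*^{\natural a}(X)$ is the class of $g\in\mathrm{LACG}_*(X)$ with $\mathrm{dom}\, g$ convex such that for all $[\bar x,\bar x+u]\subset\mathrm{dom}\, g$, $g^{\natural}(\bar x+tu;u)=g^r(\bar x+tu;u)$ for (Lebesgue) almost all $t\in[0,1]$. **Integral.** $\varphi:[a,b]\to\mathbb R$ is Henstock–Kurzweil (HK) integrable with integral $\int_a^b\varphi(t)dt=\Phi\in\mathbb R$ if for each $\varepsilon>0$ there is $\delta:[a,b]\to\,]0,+\infty[$ such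 that $|\sum_{i=1}^n\varphi(t_i)(d_i-c_i)-\Phi|<\varepsilon$ for every finite collection of tagged non-overlapping intervals $(t_i,[c_i,d_i])$, $t_i\in[c_i,d_i]$, covering $[a,b]$, with $d_i-c_i<\delta(t_i)$. A function with values in $[-\infty,+\infty]$ defined and finite almost everywhere in $[a,b]$ is HK-integrable if it coincides almost everywhere with a finite-valued HK-integrable function $\psi$; its integral is then that of $\psi$. *)

theory Defs
  imports "HOL-Analysis.Analysis"
begin

text \<open>
  Functions with values in \<open>]-\<infinity>, +\<infinity>]\<close> are modelled as functions into \<^typ>\<open>ereal\<close>
  omitting the value \<open>-\<infinity>\<close>; the dual space of \<^typ>\<open>'a\<close> is \<^typ>\<open>'a \<Rightarrow>\<^sub>L real\<close>.
\<close>

definition effdom :: "('a \<Rightarrow> ereal) \<Rightarrow> 'a set" where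
  "effdom f = {x. f x < \<infinity>}"

definition lsc_proper :: "('a::topological_space \<Rightarrow> ereal) \<Rightarrow> bool" where
  "lsc_proper f \<longleftrightarrow>
     (\<forall>x. f x \<le> Liminf (nhds x) f) \<and> (\<forall>x. f x \<noteq> -\<infinity>) \<and> effdom f \<noteq> {}"


subsection \<open>Subderivatives\<close>

text \<open>
  The filter of convergence to \<open>xb\<close> in the direction \<open>v\<close>.  Upper limits along this
  filter are given by the usual formula, see \<open>Limsup_at_dir\<close> below.
\<close>

definition at_dir :: "'a::real_normed_vector \<Rightarrow> 'a \<Rightarrow> 'a filter" where
  "at_dir xb v = filtermap (\<lambda>(t, v'). xb + t *\<^sub>R v') (at_right (0::real) \<times>\<^sub>F nhds v)"

lemma eventually_at_dir:
  "eventually P (at_dir xb v) \<longleftrightarrow>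
     (\<exists>e>0. \<forall>t v'. 0 < t \<and> t < e \<and> norm (v' - v) < e \<longrightarrow> P (xb + t *\<^sub>R v'))"
  (is "?L \<longleftrightarrow> ?R")
proof
  assume ?L
  then obtain Q R where Q: "eventually Q (at_right (0::real))" and R: "eventually R (nhds v)"
    and P: "\<And>t v'. Q t \<Longrightarrow> R v' \<Longrightarrow> P (xb + t *\<^sub>R v')"
    unfolding at_dir_def eventually_filtermap eventually_prod_filter by auto
  from Q obtain b where b: "b > 0" "\<And>t. 0 < t \<Longrightarrow> t < b \<Longrightarrow> Q t"
    unfolding eventually_at_right_field by auto
  from R obtain d where d: "d > 0" "\<And>w. dist w v < d \<Longrightarrow> R w"
    unfolding eventually_nhds_metric by auto
  show ?R
    by (rule exI[of _ "min b d"]) (use b d P in \<open>auto simp: dist_norm\<close>)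
next
  assume ?R
  then obtain e where e: "e > 0"
    "\<And>t v'. 0 < t \<Longrightarrow> t < e \<Longrightarrow> norm (v' - v) < e \<Longrightarrow> P (xb + t *\<^sub>R v')"
    by auto
  have "eventually (\<lambda>t. 0 < t \<and> t < e) (at_right (0::real))"
    unfolding eventually_at_right_field using e(1) by auto
  moreover have "eventually (\<lambda>w. norm (w - v) < e) (nhds v)"
    unfolding eventually_nhds_metric using e(1) by (auto simp: dist_norm)
  ultimately show ?L
    unfolding at_dir_def eventually_filtermap eventually_prod_filter
    using e(2) by (intro exI conjI) (assumption, assumption, auto)
qed

lemma Limsup_at_dir:
  fixes F :: "'a::real_normed_vector \<Rightarrow> ereal"
  shows "Limsup (at_dir xb v) F =
    (INF e\<in>{0<..}. SUP p\<in>{(t, v'). 0 < t \<and> t < e \<and> norm (v' - v) < e}. F (xb + fst p *\<^sub>R snd p))"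
proof (rule antisym)
  show "Limsup (at_dir xb v) F \<le>
    (INF e\<in>{0<..}. SUP p\<in>{(t, v'). 0 < t \<and> t < e \<and> norm (v' - v) < e}. F (xb + fst p *\<^sub>R snd p))"
  proof (rule INF_greatest)
    fix e :: real assume e: "e \<in> {0<..}"
    let ?S = "SUP p\<in>{(t, v'). 0 < t \<and> t < e \<and> norm (v' - v) < e}. F (xb + fst p *\<^sub>R snd p)"
    have "F (xb + t *\<^sub>R v') \<le> ?S" if "0 < t" "t < e" "norm (v' - v) < e" for t v'
      using that by (intro SUP_upper2[of "(t, v')"]) auto
    then have "eventually (\<lambda>x. F x \<le> ?S) (at_dir xb v)"
      unfolding eventually_at_dir using e by auto
    then show "Limsup (at_dir xb v) F \<le> ?S" by (rule Limsup_bounded)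
  qed
next
  show "(INF e\<in>{0<..}. SUP p\<in>{(t, v'). 0 < t \<and> t < e \<and> norm (v' - v) < e}. F (xb + fst p *\<^sub>R snd p))
    \<le> Limsup (at_dir xb v) F"
    unfolding Limsup_def
  proof (rule INF_greatest)
    fix P assume "P \<in> {P. eventually P (at_dir xb v)}"
    then obtain e where e: "e > 0"
      "\<And>t v'. 0 < t \<Longrightarrow> t < e \<Longrightarrow> norm (v' - v) < e \<Longrightarrow> P (xb + t *\<^sub>R v')"
      unfolding eventually_at_dir by auto
    show "(INF e\<in>{0<..}. SUP p\<in>{(t, v'). 0 < t \<and> t < e \<and> norm (v' - v) < e}. F (xb + fst p *\<^sub>R snd p))
      \<le> Sup (F ` {x. P x})"
      by (rule INF_lower2[of e]) (use e in \<open>auto intro!: SUP_least SUP_upper\<close>)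
  qed
qed

definition radial_subderiv :: "('a::real_normed_vector \<Rightarrow> ereal) \<Rightarrow> 'a \<Rightarrow> 'a \<Rightarrow> ereal" where
  "radial_subderiv f xb u =
     (if xb \<in> effdom f
      then Liminf (at_right (0::real)) (\<lambda>t. (f (xb + t *\<^sub>R u) - f xb) / ereal t)
      else -\<infinity>)"

text \<open>
  The \<open>filtercomap\<close> expresses the convergence \<open>(x, f x) \<rightarrow> (xb, f xb)\<close>.
\<close>

definition clarke_subderiv :: "('a::real_normed_vector \<Rightarrow> ereal) \<Rightarrow> 'a \<Rightarrow> 'a \<Rightarrow> ereal" where
  "clarke_subderiv f xb u =
     (if xb \<in> effdom f
      then SUP \<delta>\<in>{0<..}.
             Limsup (at_right (0::real) \<times>\<^sub>F filtercomap (\<lambda>x. (x, f x)) (nhds (xb, f xb)))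
               (\<lambda>(t, x). INF u'\<in>ball u \<delta>. (f (x + t *\<^sub>R u') - f x) / ereal t)
      else -\<infinity>)"

text \<open>
  Only values at points \<open>xb \<in> effdom f\<close> are meaningful.
\<close>

definition natural_subderiv :: "('a::real_normed_vector \<Rightarrow> ereal) \<Rightarrow> 'a \<Rightarrow> 'a \<Rightarrow> ereal" where
  "natural_subderiv f xb u =
     (INF \<alpha>\<in>{0..}. Limsup (at_dir xb u) (\<lambda>x. radial_subderiv f x (u + \<alpha> *\<^sub>R (xb - x))))"


subsection \<open>Subdifferentials\<close>

definition MR_subdiff :: "('a::real_normed_vector \<Rightarrow> ereal) \<Rightarrow> 'a \<Rightarrow> ('a \<Rightarrow>\<^sub>L real) set" where
  "MR_subdiff f xb =
     {x'. xb \<in> effdom f \<and> (\<forall>y. ereal (blinfun_apply x' (y - xb)) + f xb \<le> f y)}"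

definition clarke_subdiff :: "('a::real_normed_vector \<Rightarrow> ereal) \<Rightarrow> 'a \<Rightarrow> ('a \<Rightarrow>\<^sub>L real) set" where
  "clarke_subdiff f xb =
     {x'. xb \<in> effdom f \<and> (\<forall>u. ereal (blinfun_apply x' u) \<le> clarke_subderiv f xb u)}"

type_synonym 'a subdiff_operator = "('a \<Rightarrow> ereal) \<Rightarrow> 'a \<Rightarrow> ('a \<Rightarrow>\<^sub>L real) set"

text \<open>
  \<open>subdiff_closure\<close> is the enlargement of a subdifferential used in the separation principle.
  Nets \<open>((x\<^sub>\<nu>, x\<^sub>\<nu>\<^sup>*))\<^sub>\<nu>\<close> in the graph of \<open>D f\<close> are replaced by proper filters on pairs
  containing that graph; a net and its image filter have the same limits and upper limits.
  Weak* convergence is pointwise convergence.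
\<close>

definition subdiff_closure ::
    "'a::real_normed_vector subdiff_operator \<Rightarrow> ('a \<Rightarrow> ereal) \<Rightarrow> 'a \<Rightarrow> ('a \<Rightarrow>\<^sub>L real) set" where
  "subdiff_closure D f xb =
     {xs. \<exists>F :: ('a \<times> ('a \<Rightarrow>\<^sub>L real)) filter. F \<noteq> bot \<and>
        (\<forall>\<^sub>F (y, ys) in F. ys \<in> D f y) \<and>
        ((\<lambda>(y, ys). (y, f y)) \<longlongrightarrow> (xb, f xb)) F \<and>
        (\<forall>v. ((\<lambda>(y, ys). blinfun_apply ys v) \<longlongrightarrow> blinfun_apply xs v) F) \<and>
        Limsup F (\<lambda>(y, ys). ereal (blinfun_apply ys (y - xb))) \<le> 0}"

definition convex_ext :: "('a::real_vector \<Rightarrow> ereal) \<Rightarrow> bool" where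
  "convex_ext f \<longleftrightarrow> convex_on (effdom f) (\<lambda>x. real_of_ereal (f x))"

definition lipschitz_near :: "('a::metric_space \<Rightarrow> ereal) \<Rightarrow> 'a \<Rightarrow> bool" where
  "lipschitz_near f xb \<longleftrightarrow>
     (\<exists>\<delta>>0. ball xb \<delta> \<subseteq> effdom f \<and> (\<exists>L. L-lipschitz_on (ball xb \<delta>) (\<lambda>x. real_of_ereal (f x))))"

definition separation_principle :: "'a::real_normed_vector subdiff_operator \<Rightarrow> bool" where
  "separation_principle D \<longleftrightarrow>
     (\<forall>f \<phi> xb. lsc_proper f \<and> lsc_proper \<phi> \<and> xb \<in> effdom f \<and>
        convex_ext \<phi> \<and> lipschitz_near \<phi> xb \<and>
        (\<forall>\<^sub>F y in nhds xb. f xb + \<phi> xb \<le> f y + \<phi> y) \<longrightarrow>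
        (\<exists>xs\<in>subdiff_closure D f xb. \<exists>ys\<in>D \<phi> xb. xs + ys = 0))"

definition is_subdifferential :: "'a::banach subdiff_operator \<Rightarrow> bool" where
  "is_subdifferential D \<longleftrightarrow>
     (\<forall>f x. lsc_proper f \<longrightarrow> MR_subdiff f x \<subseteq> D f x \<and> D f x \<subseteq> clarke_subdiff f x) \<and>
     separation_principle D"

definition subdiff_subderiv ::
    "'a::real_normed_vector subdiff_operator \<Rightarrow> ('a \<Rightarrow> ereal) \<Rightarrow> 'a \<Rightarrow> 'a \<Rightarrow> ereal" where
  "subdiff_subderiv D f x u = (SUP xs\<in>D f x. ereal (blinfun_apply xs u))"


subsection \<open>Generalised absolute continuity\<close>

definition oscillation :: "(real \<Rightarrow> real) \<Rightarrow> real \<Rightarrow> real \<Rightarrow> ereal" where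
  "oscillation \<phi> c d = Sup {ereal \<bar>\<phi> y - \<phi> x\<bar> | x y. c \<le> x \<and> x \<le> y \<and> y \<le> d}"

definition AC_star :: "(real \<Rightarrow> real) \<Rightarrow> real set \<Rightarrow> bool" where
  "AC_star \<phi> S \<longleftrightarrow>
     (\<forall>\<epsilon>>0. \<exists>\<delta>>0. \<forall>I :: (real \<times> real) set.
        finite I \<and> (\<forall>(c, d)\<in>I. c < d \<and> c \<in> S \<and> d \<in> S) \<and>
        pairwise (\<lambda>(c, d) (c', d'). {c<..<d} \<inter> {c'<..<d'} = {}) I \<and>
        (\<Sum>(c, d)\<in>I. d - c) < \<delta> \<longrightarrow>
        (\<Sum>(c, d)\<in>I. oscillation \<phi> c d) < ereal \<epsilon>)"

definition ACG_star :: "(real \<Rightarrow> real) \<Rightarrow> real set \<Rightarrow> bool" where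
  "ACG_star \<phi> S \<longleftrightarrow> continuous_on S \<phi> \<and>
     (\<exists>\<T>. countable \<T> \<and> \<Union>\<T> = S \<and> (\<forall>T\<in>\<T>. AC_star \<phi> T))"


subsection \<open>Classes of functions\<close>

definition LACG_star :: "('a::real_normed_vector \<Rightarrow> ereal) set" where
  "LACG_star = {f. lsc_proper f \<and>
     (\<forall>a b. closed_segment a b \<subseteq> effdom f \<longrightarrow>
        ACG_star (\<lambda>t. real_of_ereal (f (a + t *\<^sub>R (b - a)))) {0..1})}"

definition LACG_star_natural :: "('a::real_normed_vector \<Rightarrow> ereal) set" where
  "LACG_star_natural = {g \<in> LACG_star. convex (effdom g) \<and>
     (\<forall>xb u. closed_segment xb (xb + u) \<subseteq> effdom g \<longrightarrow>
        (AE t\<in>{0..1} in lebesgue.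
           natural_subderiv g (xb + t *\<^sub>R u) u = radial_subderiv g (xb + t *\<^sub>R u) u))}"


subsection \<open>Integral\<close>

text \<open>
  The library's \<open>has_integral\<close> on a compact real interval is the Henstock--Kurzweil integral.
\<close>

definition has_HK_integral :: "(real \<Rightarrow> ereal) \<Rightarrow> real \<Rightarrow> real set \<Rightarrow> bool" where
  "has_HK_integral \<phi> I S \<longleftrightarrow>
     (\<exists>\<psi> :: real \<Rightarrow> real. (AE t\<in>S in lebesgue. \<phi> t = ereal (\<psi> t)) \<and> (\<psi> has_integral I) S)"

end

theory Submission
  imports Defs
begin

text \<open>
  Let \<open>F t = g (xb + t *\<^sub>R u)\<close> on a segment in the domain of \<open>g\<close>.  The integral and the
  pointwise formula rest on unrelated ideas.

  The integral.  On a small piece \<open>T\<close> of its domain on which \<open>F\<close> is AC\<open>\<^sub>*\<close>, the oscillation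
  accumulated along \<open>T\<close> is an increasing function \<open>V\<close> that controls \<open>F\<close> on all intervals with end
  points in \<open>T\<close> (\<open>oscillation_majorant\<close>), so that \<open>F\<close> is on \<open>T\<close> the difference of two increasing
  functions.  Near almost every point \<open>x\<close> of \<open>T\<close> the gaps of \<open>T\<close> are small in comparison with their
  distance from \<open>x\<close> (\<open>almost_every_point_accumulates\<close>), and across a gap \<open>F\<close> varies by at most the
  increment of \<open>V\<close>.  Hence Lebesgue's theorem on monotone functions
  (\<open>negligible_not_differentiable_mono\<close>) makes \<open>F\<close> differentiable almost everywhere.  On the
  remaining null set the increments of \<open>F\<close> over fine tagged intervals have an arbitrarily small sum
  (\<open>ACG_star_null_variation\<close>), and this is precisely what is needed for the derivative, put to zero
  there, to have Henstock--Kurzweil integral \<open>F 1 - F 0\<close>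
  (\<open>fundamental_theorem_of_calculus_null_variation\<close>).  Where \<open>F\<close> is differentiable its derivative is
  the radial subderivative of \<open>g\<close>, which is almost everywhere the natural subderivative.

  The pointwise formula.  For every \<open>\<alpha>\<close> the upper limits of the radial subderivative and of the
  subderivative associated with \<open>D\<close>, taken along the vector field \<open>x \<mapsto> u + \<alpha> *\<^sub>R (xb - x)\<close>, coincide
  (\<open>Limsup_subdiff_subderiv_eq_radial_subderiv\<close>).  For a comparison of two such upper limits it
  suffices to find, arbitrarily close to a point where one function is large, a point where the
  other one is almost as large.  In one direction, a subgradient is a Clarke subgradient, which forces
  steep increments of \<open>g\<close> from nearby points along the field; for \<open>\<alpha> > 0\<close> the field points everywhere
  to \<open>xb + u /\<^sub>R \<alpha>\<close>, hence it stays parallel to a segment that starts along it, and a mean value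
  inequality on this segment gives a large radial subderivative in the direction of the field
  (\<open>radial_subderiv_near_clarke_subderiv\<close>).  In the other direction, a large radial subderivative
  means that \<open>g\<close> rises along a short segment; penalising the distance to the segment and applying
  Ekeland's variational principle produces a local minimum to which the separation principle applies
  (\<open>subdiff_near_radial_subderiv\<close>).
\<close>

section \<open>Monotone functions are differentiable almost everywhere\<close>

lemma negligible_countable:
  fixes S :: "'a::euclidean_space set"
  assumes "countable S"
  shows "negligible S"
proof -
  have "negligible (\<Union>x\<in>S. {x})"
    using assms by (intro negligible_countable_Union) auto
  then show ?thesis by simp
qed

text \<open>
  The points in question are followed by pairwise disjoint gaps of \<open>T\<close>, and each gap contains a
  rational number.
\<close>

lemma countable_right_isolated:
  fixes T :: "real set"
  shows "countable {x\<in>T. \<exists>y>x. T \<inter> {x<..<y} = {}}"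
proof -
  define S where "S = {x\<in>T. \<exists>y>x. T \<inter> {x<..<y} = {}}"
  have "\<forall>x\<in>S. \<exists>q\<in>\<rat>. x < q \<and> T \<inter> {x<..q} = {}"
  proof
    fix x assume "x \<in> S"
    then obtain y where y: "y > x" "T \<inter> {x<..<y} = {}" by (auto simp: S_def)
    then obtain q where "q \<in> \<rat>" "x < q" "q < y" using Rats_dense_in_real by blast
    then show "\<exists>q\<in>\<rat>. x < q \<and> T \<inter> {x<..q} = {}" using y by (intro bexI[of _ q]) auto
  qed
  then obtain q where q: "\<And>x. x \<in> S \<Longrightarrow> q x \<in> \<rat> \<and> x < q x \<and> T \<inter> {x<..q x} = {}" by metis
  have "inj_on q S"
  proof (rule linorder_inj_onI')
    fix x y assume xy: "x \<in> S" "y \<in> S" "x < y"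
    then have "y \<in> T" by (simp add: S_def)
    then have "q x < y" using q[OF xy(1)] xy(3) by (auto simp: not_le)
    then show "q x \<noteq> q y" using q[OF xy(2)] by auto
  qed
  moreover have "countable (q ` S)"
    using countable_rat by (rule countable_subset[rotated]) (use q in auto)
  ultimately show ?thesis unfolding S_def by (rule countable_image_inj_on[rotated])
qed

text \<open>
  An interval with the largest right end point lies to the right of all others and can be split off.
\<close>

lemma sum_increments_le:
  fixes f :: "real \<Rightarrow> real"
  assumes "finite I" and mono: "mono f" and ab: "a \<le> b"
    and I: "\<And>c d. (c, d) \<in> I \<Longrightarrow> a \<le> c \<and> c < d \<and> d \<le> b"
    and disj: "pairwise (\<lambda>(c, d) (c', d'). {c<..<d} \<inter> {c'<..<d'} = {}) I"
  shows "(\<Sum>(c, d)\<in>I. f d - f c) \<le> f b - f a"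
  using assms(1) ab I disj
proof (induction arbitrary: b rule: finite_ranking_induct[where f = snd])
  case empty
  then show ?case using monoD[OF mono] by simp
next
  case (insert p I)
  obtain c d where p: "p = (c, d)" by (cases p)
  have cd: "a \<le> c" "c < d" "d \<le> b" using insert.prems(2)[of c d] p by auto
  show ?case
  proof (cases "p \<in> I")
    case True
    then show ?thesis using insert.IH[OF insert.prems(1)] insert.prems by (simp add: insert_absorb)
  next
    case False
    have "d' \<le> c" if "(c', d') \<in> I" for c' d'
    proof (rule ccontr)
      assume n: "\<not> d' \<le> c"
      have "c' < d'" using insert.prems(2)[of c' d'] that by auto
      moreover have "d' \<le> d" using insert.hyps(2)[OF that] p by simp
      moreover have "{c<..<d} \<inter> {c'<..<d'} = {}"
        using insert.prems(3) that False p by (auto simp: pairwise_insert)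
      moreover have "(max c c' + d') / 2 \<in> {c<..<d} \<inter> {c'<..<d'}"
        using n \<open>c' < d'\<close> \<open>d' \<le> d\<close> cd by (auto simp: max_def)
      ultimately show False by blast
    qed
    then have "(\<Sum>(c, d)\<in>I. f d - f c) \<le> f c - f a"
      using insert.prems cd(1) by (intro insert.IH) (auto simp: pairwise_insert)
    moreover have "f d \<le> f b" using monoD[OF mono cd(3)] .
    ultimately show ?thesis using insert.hyps(1) False p by simp
  qed
qed

text \<open>
  In dimension one the balls of the Vitali covering theorem are the compact intervals.  A point may
  lie anywhere in the intervals that cover it, which below allows to treat all Dini derivatives at
  once.
\<close>

lemma Vitali_covering_intervals:
  fixes K :: "(real \<times> real) set"
  assumes K: "\<And>c d. (c, d) \<in> K \<Longrightarrow> c < d"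
    and fine: "\<And>x e. x \<in> A \<Longrightarrow> e > 0 \<Longrightarrow> \<exists>(c, d)\<in>K. c \<le> x \<and> x \<le> d \<and> d - c < e"
  obtains C where "countable C" "C \<subseteq> K"
    "pairwise (\<lambda>(c, d) (c', d'). {c..d} \<inter> {c'..d'} = {}) C"
    "negligible (A - (\<Union>(c, d)\<in>C. {c..d}))"
proof -
  define m where "m i = (fst i + snd i) / 2" for i :: "real \<times> real"
  define r where "r i = (snd i - fst i) / 2" for i :: "real \<times> real"
  have cb: "cball (m i) (r i) = {fst i..snd i}" for i
    by (auto simp: cball_eq_atLeastAtMost m_def r_def field_simps)
  obtain C where C: "countable C" "C \<subseteq> K"
      "pairwise (\<lambda>i j. disjnt (cball (m i) (r i)) (cball (m j) (r j))) C"
      "negligible (A - (\<Union>i \<in> C. cball (m i) (r i)))"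
  proof (rule Vitali_covering_theorem_cballs[of K r A m])
    show "0 < r i" if "i \<in> K" for i using K[of "fst i" "snd i"] that by (simp add: r_def)
    show "\<exists>i. i \<in> K \<and> x \<in> cball (m i) (r i) \<and> r i < e" if "x \<in> A" "0 < e" for x e
    proof -
      obtain c d where cd: "(c, d) \<in> K" "c \<le> x" "x \<le> d" "d - c < e" using fine[OF \<open>x \<in> A\<close> \<open>0 < e\<close>] by blast
      then show ?thesis using K[OF cd(1)] unfolding cb by (intro exI[of _ "(c, d)"]) (auto simp: r_def)
    qed
  qed
  show ?thesis
  proof (rule that[OF C(1,2)])
    show "pairwise (\<lambda>(c, d) (c', d'). {c..d} \<inter> {c'..d'} = {}) C"
      by (rule pairwise_mono[OF C(3)]) (auto simp: cb disjnt_def)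
    show "negligible (A - (\<Union>(c, d)\<in>C. {c..d}))"
      using C(4) by (simp add: cb case_prod_beta)
  qed
qed

text \<open>
  Bounds for the outer measure dispense with proofs that the sets of points with given slopes are
  measurable.
\<close>

definition outer_measure_le :: "real set \<Rightarrow> real \<Rightarrow> bool" where
  "outer_measure_le A c \<longleftrightarrow> (\<exists>B\<in>lmeasurable. A \<subseteq> B \<and> measure lebesgue B \<le> c)"

lemma outer_measure_le_mono: "outer_measure_le A c \<Longrightarrow> c \<le> c' \<Longrightarrow> outer_measure_le A c'"
  unfolding outer_measure_le_def by (meson order_trans)

text \<open>
  Countable subadditivity, up to a null set.  The hypothesis on finite partial sums replaces the
  convergence of a series.
\<close>

lemma outer_measure_le_UN:
  assumes "countable I" and "0 \<le> c" and A: "\<And>i. i \<in> I \<Longrightarrow> outer_measure_le (A i) (m i)"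
    and m: "\<And>J. finite J \<Longrightarrow> J \<subseteq> I \<Longrightarrow> sum m J \<le> c"
    and neg: "negligible (S - (\<Union>i\<in>I. A i))"
  shows "outer_measure_le S c"
proof -
  from A obtain B where B: "\<And>i. i \<in> I \<Longrightarrow> B i \<in> lmeasurable" "\<And>i. i \<in> I \<Longrightarrow> A i \<subseteq> B i"
      "\<And>i. i \<in> I \<Longrightarrow> measure lebesgue (B i) \<le> m i"
    unfolding outer_measure_le_def by metis
  have fin: "measure lebesgue (\<Union>i\<in>J. B i) \<le> c" if "J \<subseteq> I" "finite J" for J
  proof -
    have "measure lebesgue (\<Union>i\<in>J. B i) \<le> (\<Sum>i\<in>J. measure lebesgue (B i))"
      using that B(1) by (intro measure_UNION_le) (auto simp: fmeasurable_def)
    also have "\<dots> \<le> sum m J" using B(3) that by (intro sum_mono) auto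
    also have "\<dots> \<le> c" using m that by blast
    finally show ?thesis .
  qed
  let ?U = "\<Union>i\<in>I. B i" and ?N = "S - (\<Union>i\<in>I. A i)"
  have U: "?U \<in> lmeasurable" "measure lebesgue ?U \<le> c"
    using fmeasurable_UN_bound[OF assms(1) B(1) fin] measure_UN_bound[OF assms(1) B(1) fin] assms(2) by auto
  have N: "?N \<in> lmeasurable" "measure lebesgue ?N = 0"
    using neg by (auto simp: negligible_iff_measure)
  have "measure lebesgue (?U \<union> ?N) \<le> c"
    using measure_Un_le[of ?U lebesgue ?N] U N by (auto simp: fmeasurable_def)
  moreover have "S \<subseteq> ?U \<union> ?N" using B(2) by blast
  ultimately show ?thesis
    unfolding outer_measure_le_def using U N by (intro bexI[of _ "?U \<union> ?N"]) auto
qed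

lemma lmeasurable_outer_open:
  fixes S :: "'a::euclidean_space set"
  assumes S: "S \<in> lmeasurable" and e: "e > 0"
  obtains T where "open T" "S \<subseteq> T" "T \<in> lmeasurable"
    "measure lebesgue T < measure lebesgue S + e"
proof -
  obtain T where T: "open T" "S \<subseteq> T" "T - S \<in> lmeasurable" "emeasure lebesgue (T - S) < ennreal e"
    using sets_lebesgue_outer_open[of S e] S e by (auto simp: fmeasurable_def)
  have eq: "T = S \<union> (T - S)" using T(2) by blast
  have "measure lebesgue (T - S) < e"
    using T(3,4) e by (simp add: emeasure_eq_measure2 ennreal_less_iff)
  moreover have "measure lebesgue T \<le> measure lebesgue S + measure lebesgue (T - S)"
    by (subst eq, rule measure_Un_le) (use S T(3) in \<open>auto simp: fmeasurable_def\<close>)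
  moreover have "T \<in> lmeasurable"
    by (subst eq, rule fmeasurable.Un) fact+
  ultimately show ?thesis using that T by auto
qed

context
  fixes f :: "real \<Rightarrow> real"
  assumes mono: "mono f"
begin

text \<open>
  The difference quotients are taken over intervals that contain \<open>x\<close>, not only over those that have
  \<open>x\<close> as an end point: a single pair of conditions then replaces the four Dini derivatives.
\<close>

definition slopes_above :: "real \<Rightarrow> real \<Rightarrow> bool" where
  "slopes_above s x \<longleftrightarrow> (\<forall>e>0. \<exists>c d. c \<le> x \<and> x \<le> d \<and> c < d \<and> d - c < e \<and> s * (d - c) \<le> f d - f c)"

definition slopes_below :: "real \<Rightarrow> real \<Rightarrow> bool" where
  "slopes_below r x \<longleftrightarrow> (\<forall>e>0. \<exists>c d. c \<le> x \<and> x \<le> d \<and> c < d \<and> d - c < e \<and> f d - f c \<le> r * (d - c))"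

text \<open>
  Vitali's theorem yields disjoint intervals of slope at least \<open>s\<close> that cover almost all of \<open>A\<close>.  The
  increments of a monotone function over disjoint subintervals of \<open>{a..b}\<close> add up to at most
  \<open>f b - f a\<close>.
\<close>

lemma outer_measure_slopes_above:
  assumes s: "s > 0" and ab: "a \<le> b" and A: "A \<subseteq> {a<..<b}" and up: "\<And>x. x \<in> A \<Longrightarrow> slopes_above s x"
  shows "outer_measure_le A ((f b - f a) / s)"
proof -
  define K where "K = {(c, d). a \<le> c \<and> c < d \<and> d \<le> b \<and> s * (d - c) \<le> f d - f c}"
  obtain C where C: "countable C" "C \<subseteq> K" "pairwise (\<lambda>(c, d) (c', d'). {c..d} \<inter> {c'..d'} = {}) C"
      "negligible (A - (\<Union>(c, d)\<in>C. {c..d}))"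
  proof (rule Vitali_covering_intervals[of K A])
    fix x e :: real assume x: "x \<in> A" and e: "e > 0"
    define e' where "e' = min e (min (x - a) (b - x))"
    have "e' > 0" using x A e by (auto simp: e'_def)
    then obtain c d where cd: "c \<le> x" "x \<le> d" "c < d" "d - c < e'" "s * (d - c) \<le> f d - f c"
      using up[OF x] unfolding slopes_above_def by blast
    then have "a \<le> c" "d \<le> b" "d - c < e" by (auto simp: e'_def)
    then show "\<exists>(c, d)\<in>K. c \<le> x \<and> x \<le> d \<and> d - c < e"
      using cd by (intro bexI[of _ "(c, d)"]) (auto simp: K_def)
  qed (auto simp: K_def)
  show ?thesis
  proof (rule outer_measure_le_UN[OF C(1), of _ "\<lambda>(c, d). {c..d}" "\<lambda>(c, d). d - c"])
    show "0 \<le> (f b - f a) / s" using s monoD[OF mono ab] by simp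
    show "outer_measure_le (case i of (c, d) \<Rightarrow> {c..d}) (case i of (c, d) \<Rightarrow> d - c)" if "i \<in> C" for i
      using that C(2) by (auto simp: outer_measure_le_def K_def intro!: bexI[of _ "{fst i..snd i}"])
    show "negligible (A - (\<Union>i\<in>C. case i of (c, d) \<Rightarrow> {c..d}))" by (rule C(4))
    fix J assume J: "finite J" "J \<subseteq> C"
    have "s * (\<Sum>(c, d)\<in>J. d - c) = (\<Sum>(c, d)\<in>J. s * (d - c))"
      by (simp add: sum_distrib_left case_prod_beta)
    also have "\<dots> \<le> (\<Sum>(c, d)\<in>J. f d - f c)"
      using J C(2) by (intro sum_mono) (auto simp: K_def)
    also have "\<dots> \<le> f b - f a"
    proof (rule sum_increments_le[OF J(1) mono ab])
      show "a \<le> c \<and> c < d \<and> d \<le> b" if "(c, d) \<in> J" for c d using that J C(2) by (auto simp: K_def)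
      show "pairwise (\<lambda>(c, d) (c', d'). {c<..<d} \<inter> {c'<..<d'} = {}) J"
        by (rule pairwise_mono[OF C(3) _ J(2)]) fastforce
    qed
    finally show "(\<Sum>(c, d)\<in>J. d - c) \<le> (f b - f a) / s" using s by (simp add: field_simps)
  qed
qed

text \<open>
  Almost all of \<open>A\<close> is covered by disjoint intervals in \<open>U\<close> of slope at most \<open>r\<close>.  By the previous
  lemma, the part of \<open>A\<close> inside such an interval has outer measure at most \<open>r / s\<close> times its length.
\<close>

lemma outer_measure_slopes_contraction:
  assumes r: "0 < r" and s: "0 < s" and U: "open U" "U \<in> lmeasurable" "A \<subseteq> U"
    and up: "\<And>x. x \<in> A \<Longrightarrow> slopes_above s x" and down: "\<And>x. x \<in> A \<Longrightarrow> slopes_below r x"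
  shows "outer_measure_le A (r / s * measure lebesgue U)"
proof -
  define K where "K = {(c, d). c < d \<and> {c..d} \<subseteq> U \<and> f d - f c \<le> r * (d - c)}"
  obtain C where C: "countable C" "C \<subseteq> K" "pairwise (\<lambda>(c, d) (c', d'). {c..d} \<inter> {c'..d'} = {}) C"
      "negligible (A - (\<Union>(c, d)\<in>C. {c..d}))"
  proof (rule Vitali_covering_intervals[of K A])
    fix x e :: real assume x: "x \<in> A" and e: "e > 0"
    then obtain e' where e': "e' > 0" "ball x e' \<subseteq> U" using U openE by blast
    then obtain c d where cd: "c \<le> x" "x \<le> d" "c < d" "d - c < min e e'" "f d - f c \<le> r * (d - c)"
      using down[OF x] e unfolding slopes_below_def by (metis min_less_iff_conj)
    then have "{c..d} \<subseteq> ball x e'" by (auto simp: dist_real_def)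
    then show "\<exists>(c, d)\<in>K. c \<le> x \<and> x \<le> d \<and> d - c < e"
      using cd e' by (intro bexI[of _ "(c, d)"]) (auto simp: K_def)
  qed (auto simp: K_def)
  show ?thesis
  proof (rule outer_measure_le_UN[OF C(1), of _ "\<lambda>(c, d). A \<inter> {c<..<d}" "\<lambda>(c, d). r / s * (d - c)"])
    show "0 \<le> r / s * measure lebesgue U" using r s by simp
    show "outer_measure_le (case i of (c, d) \<Rightarrow> A \<inter> {c<..<d}) (case i of (c, d) \<Rightarrow> r / s * (d - c))"
      if i: "i \<in> C" for i
    proof -
      obtain c d where cd: "i = (c, d)" by (cases i)
      then have K: "c < d" "f d - f c \<le> r * (d - c)" using i C(2) by (auto simp: K_def)
      have "outer_measure_le (A \<inter> {c<..<d}) ((f d - f c) / s)"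
        using s K up by (intro outer_measure_slopes_above) auto
      moreover have "(f d - f c) / s \<le> r * (d - c) / s" using K s by (intro divide_right_mono) auto
      ultimately show ?thesis unfolding cd using outer_measure_le_mono by simp
    qed
    have "countable (fst ` C \<union> snd ` C)" using C(1) by simp
    then have "negligible (fst ` C \<union> snd ` C)" by (rule negligible_countable)
    with C(4) have "negligible ((A - (\<Union>(c, d)\<in>C. {c..d})) \<union> (fst ` C \<union> snd ` C))"
      by (rule negligible_Un)
    then show "negligible (A - (\<Union>i\<in>C. case i of (c, d) \<Rightarrow> A \<inter> {c<..<d}))"
    proof (rule negligible_subset)
      show "A - (\<Union>i\<in>C. case i of (c, d) \<Rightarrow> A \<inter> {c<..<d})
          \<subseteq> (A - (\<Union>(c, d)\<in>C. {c..d})) \<union> (fst ` C \<union> snd ` C)"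
      proof
        fix x assume x: "x \<in> A - (\<Union>i\<in>C. case i of (c, d) \<Rightarrow> A \<inter> {c<..<d})"
        show "x \<in> (A - (\<Union>(c, d)\<in>C. {c..d})) \<union> (fst ` C \<union> snd ` C)"
        proof (cases "\<exists>(c, d)\<in>C. x \<in> {c..d}")
          case True
          then obtain c d where cd: "(c, d) \<in> C" "x \<in> {c..d}" by blast
          then have "x = c \<or> x = d" using x by fastforce
          then show ?thesis using cd(1) by force
        qed (use x in auto)
      qed
    qed
    fix J assume J: "finite J" "J \<subseteq> C"
    have "(\<Sum>(c, d)\<in>J. d - c) = (\<Sum>i\<in>J. measure lebesgue (case i of (c, d) \<Rightarrow> {c..d}))"
      using J C(2) by (intro sum.cong) (auto simp: K_def)
    also have "\<dots> = measure lebesgue (\<Union>i\<in>J. case i of (c, d) \<Rightarrow> {c..d})"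
    proof (rule measure_UNION'[symmetric])
      show "pairwise (\<lambda>i j. disjnt (case i of (c, d) \<Rightarrow> {c..d}) (case j of (c, d) \<Rightarrow> {c..d})) J"
        by (rule pairwise_mono[OF C(3) _ J(2)]) (auto simp: disjnt_def)
    qed (use J in \<open>auto simp: case_prod_beta\<close>)
    also have "\<dots> \<le> measure lebesgue U"
    proof (rule measure_mono_fmeasurable)
      show "(\<Union>i\<in>J. case i of (c, d) \<Rightarrow> {c..d}) \<subseteq> U" using J(2) C(2) unfolding K_def by blast
      show "(\<Union>i\<in>J. case i of (c, d) \<Rightarrow> {c..d}) \<in> sets lebesgue"
        using J(1) by (intro sets.finite_UN) (auto simp: case_prod_beta)
    qed (rule U(2))
    finally have "r / s * (\<Sum>(c, d)\<in>J. d - c) \<le> r / s * measure lebesgue U"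
      using r s by (intro mult_left_mono) auto
    then show "(\<Sum>(c, d)\<in>J. r / s * (d - c)) \<le> r / s * measure lebesgue U"
      by (simp add: sum_distrib_left case_prod_beta)
  qed
qed

text \<open>
  Applied to an open set that hardly exceeds a measurable cover of \<open>A\<close>, the contraction lemma reduces
  every bound for the outer measure of \<open>A\<close> by a fixed factor \<open>p < 1\<close>.
\<close>

lemma negligible_slopes_below_above:
  assumes r: "0 < r" and rs: "r < s" and A: "A \<subseteq> {a<..<b}"
    and up: "\<And>x. x \<in> A \<Longrightarrow> slopes_above s x" and down: "\<And>x. x \<in> A \<Longrightarrow> slopes_below r x"
  shows "negligible A"
proof -
  \<comment> \<open>\<open>p\<close> exceeds the contraction factor \<open>r / s\<close>, which leaves room for the open cover.\<close>
  define p where "p = (1 + r / s) / 2"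
  have p: "r / s < p" "0 < p" "p < 1" using r rs by (auto simp: p_def field_simps)
  have step: "outer_measure_le A (p * c)" if c: "outer_measure_le A c" "c > 0" for c
  proof -
    obtain B where B: "B \<in> lmeasurable" "A \<subseteq> B" "measure lebesgue B \<le> c"
      using c(1) unfolding outer_measure_le_def by blast
    have "c * (p * s / r - 1) > 0" using p(1) r rs c(2) by (simp add: field_simps)
    then obtain U where U: "open U" "B \<subseteq> U" "U \<in> lmeasurable"
        "measure lebesgue U < measure lebesgue B + c * (p * s / r - 1)"
      using lmeasurable_outer_open[OF B(1)] by blast
    have "outer_measure_le A (r / s * measure lebesgue U)"
      by (rule outer_measure_slopes_contraction) (use r rs U B up down in auto)
    moreover have "measure lebesgue U \<le> c * (p * s / r)" using U(4) B(3) by (simp add: algebra_simps)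
    then have "r / s * measure lebesgue U \<le> r / s * (c * (p * s / r))"
      using r rs by (intro mult_left_mono) auto
    then have "r / s * measure lebesgue U \<le> p * c" using r rs by (simp add: field_simps)
    ultimately show ?thesis by (rule outer_measure_le_mono)
  qed
  define c0 where "c0 = measure lebesgue {a<..<b} + 1"
  have c0: "c0 > 0" by (simp add: c0_def add_nonneg_pos)
  have it: "outer_measure_le A (p ^ n * c0)" for n
  proof (induction n)
    case 0
    show ?case unfolding outer_measure_le_def
      using A by (intro bexI[of _ "{a<..<b}"]) (auto simp: c0_def)
  next
    case (Suc n)
    then show ?case using step[of "p ^ n * c0"] c0 p by (simp add: mult_ac)
  qed
  show ?thesis
    unfolding negligible_outer_le
  proof (intro allI impI)
    fix e :: real assume e: "e > 0"
    have "(\<lambda>n. p ^ n * c0) \<longlonglongrightarrow> 0 * c0"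
      using p by (intro tendsto_intros LIMSEQ_power_zero) auto
    then have "eventually (\<lambda>n. p ^ n * c0 < e) sequentially" using e by (intro order_tendstoD) auto
    then obtain n where n: "p ^ n * c0 < e" by (auto simp: eventually_sequentially)
    then show "\<exists>T. A \<subseteq> T \<and> T \<in> lmeasurable \<and> measure lebesgue T \<le> e"
      using outer_measure_le_mono[OF it[of n], of e] unfolding outer_measure_le_def by auto
  qed
qed

lemma negligible_slopes_unbounded:
  assumes A: "A \<subseteq> {a<..<b}" and up: "\<And>x s. x \<in> A \<Longrightarrow> slopes_above s x"
  shows "negligible A"
proof (cases "a < b")
  case True
  show ?thesis
    unfolding negligible_outer_le
  proof (intro allI impI)
    fix e :: real assume e: "e > 0"
    define s where "s = (f b - f a + 1) / e"
    have fab: "f b - f a \<ge> 0" using monoD[OF mono, of a b] True by simp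
    then have s: "s > 0" using e by (simp add: s_def)
    have "outer_measure_le A ((f b - f a) / s)"
      using s True A up by (intro outer_measure_slopes_above) auto
    moreover have "(f b - f a) / s \<le> e" using fab e s by (simp add: s_def field_simps)
    ultimately have "outer_measure_le A e" by (rule outer_measure_le_mono)
    then show "\<exists>T. A \<subseteq> T \<and> T \<in> lmeasurable \<and> measure lebesgue T \<le> e"
      unfolding outer_measure_le_def by auto
  qed
next
  case False
  then show ?thesis using A by simp
qed

text \<open>
  Let \<open>L\<close> be the supremum of all \<open>s\<close> with \<open>slopes_above s x\<close>.  If no two rational numbers separate
  slopes below from slopes above, then all difference quotients over small intervals around \<open>x\<close> are
  close to \<open>L\<close>.  Positive rational numbers suffice, since the slopes of a monotone function are not
  negative.
\<close>

lemma not_differentiable_slopes: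
  assumes "\<not> f differentiable at x" and "\<exists>s. \<not> slopes_above s x"
  shows "\<exists>r\<in>\<rat>. \<exists>s\<in>\<rat>. 0 < r \<and> r < s \<and> slopes_below r x \<and> slopes_above s x"
proof (rule ccontr)
  assume none: "\<not> ?thesis"
  define S where "S = {s. slopes_above s x}"
  have above_mono: "slopes_above s' x" if "slopes_above s x" "s' \<le> s" for s s'
    unfolding slopes_above_def
  proof (intro allI impI)
    fix e :: real assume "e > 0"
    then obtain c d where cd: "c \<le> x" "x \<le> d" "c < d" "d - c < e" "s * (d - c) \<le> f d - f c"
      using \<open>slopes_above s x\<close> unfolding slopes_above_def by blast
    moreover have "s' * (d - c) \<le> s * (d - c)" using that(2) cd(3) by (intro mult_right_mono) auto
    ultimately show "\<exists>c d. c \<le> x \<and> x \<le> d \<and> c < d \<and> d - c < e \<and> s' * (d - c) \<le> f d - f c"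
      using order_trans by blast
  qed
  have below_mono: "slopes_below r' x" if "slopes_below r x" "r \<le> r'" for r r'
    unfolding slopes_below_def
  proof (intro allI impI)
    fix e :: real assume "e > 0"
    then obtain c d where cd: "c \<le> x" "x \<le> d" "c < d" "d - c < e" "f d - f c \<le> r * (d - c)"
      using \<open>slopes_below r x\<close> unfolding slopes_below_def by blast
    moreover have "r * (d - c) \<le> r' * (d - c)" using that(2) cd(3) by (intro mult_right_mono) auto
    ultimately show "\<exists>c d. c \<le> x \<and> x \<le> d \<and> c < d \<and> d - c < e \<and> f d - f c \<le> r' * (d - c)"
      using order_trans by blast
  qed
  have "slopes_above 0 x"
    unfolding slopes_above_def
  proof (intro allI impI)
    fix e :: real assume "e > 0"
    then show "\<exists>c d. c \<le> x \<and> x \<le> d \<and> c < d \<and> d - c < e \<and> 0 * (d - c) \<le> f d - f c"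
      using monoD[OF mono, of x "x + e / 2"] by (intro exI[of _ x] exI[of _ "x + e / 2"]) auto
  qed
  then have ne: "0 \<in> S" by (simp add: S_def)
  obtain s0 where s0: "\<not> slopes_above s0 x" using assms(2) by blast
  have bdd: "bdd_above S"
  proof (rule bdd_aboveI[of _ s0])
    fix s assume "s \<in> S"
    then show "s \<le> s0" using s0 above_mono[of s s0] by (cases "s \<le> s0") (auto simp: S_def)
  qed
  define L where "L = Sup S"
  have L0: "0 \<le> L" unfolding L_def using ne bdd by (rule cSup_upper)
  have upper: "\<not> slopes_above s x" if "s > L" for s
    using cSup_upper[OF _ bdd, of s] that by (auto simp: S_def L_def)
  have lower: "\<not> slopes_below r x" if "r < L" for r
  proof
    assume b: "slopes_below r x"
    show False
    proof (cases "L = 0")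
      case True
      obtain c d where "c \<le> x" "x \<le> d" "c < d" "f d - f c \<le> r * (d - c)"
        using b zero_less_one unfolding slopes_below_def by blast
      moreover from this have "r * (d - c) < 0" using that True by (simp add: mult_neg_pos)
      ultimately show False using monoD[OF mono, of c d] by simp
    next
      case False
      then have "max r 0 < L" using that L0 by auto
      then obtain r' where r': "r' \<in> \<rat>" "max r 0 < r'" "r' < L" using Rats_dense_in_real by blast
      then obtain s' where s': "s' \<in> \<rat>" "r' < s'" "s' < L" using Rats_dense_in_real by blast
      then obtain s where "s \<in> S" "s' < s" using ne bdd less_cSup_iff[of S s'] by (auto simp: L_def)
      then have "slopes_above s' x" using above_mono[of s s'] by (auto simp: S_def)
      moreover have "slopes_below r' x" using below_mono[OF b] r' by auto
      ultimately show False using none r' s' by auto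
    qed
  qed
  have "(f has_real_derivative L) (at x)"
    unfolding has_field_derivative_iff
  proof (rule LIM_I)
    fix e :: real assume e: "e > 0"
    have "\<not> slopes_above (L + e / 2) x" "\<not> slopes_below (L - e / 2) x"
      using upper[of "L + e / 2"] lower[of "L - e / 2"] e by auto
    then have "\<exists>e1>0. \<forall>c d. c \<le> x \<longrightarrow> x \<le> d \<longrightarrow> c < d \<longrightarrow> d - c < e1 \<longrightarrow> f d - f c < (L + e / 2) * (d - c)"
      "\<exists>e2>0. \<forall>c d. c \<le> x \<longrightarrow> x \<le> d \<longrightarrow> c < d \<longrightarrow> d - c < e2 \<longrightarrow> (L - e / 2) * (d - c) < f d - f c"
      by (simp_all only: slopes_above_def slopes_below_def not_le[symmetric]) blast+
    then obtain e1 e2 where e1: "e1 > 0"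
        "\<And>c d. c \<le> x \<Longrightarrow> x \<le> d \<Longrightarrow> c < d \<Longrightarrow> d - c < e1 \<Longrightarrow> f d - f c < (L + e / 2) * (d - c)"
      and e2: "e2 > 0"
        "\<And>c d. c \<le> x \<Longrightarrow> x \<le> d \<Longrightarrow> c < d \<Longrightarrow> d - c < e2 \<Longrightarrow> (L - e / 2) * (d - c) < f d - f c"
      by blast
    have "norm ((f y - f x) / (y - x) - L) < e" if y: "y \<noteq> x" "norm (y - x) < min e1 e2" for y
    proof -
      have "\<bar>(f d - f c) / (d - c) - L\<bar> < e" if "c \<le> x" "x \<le> d" "c < d" "d - c < e1" "d - c < e2" for c d
      proof -
        have "(f d - f c) / (d - c) < L + e / 2" "L - e / 2 < (f d - f c) / (d - c)"
          using e1(2)[of c d] e2(2)[of c d] that by (auto simp: field_simps)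
        then show ?thesis using e by (simp only: abs_less_iff) linarith
      qed
      note slope = this
      show ?thesis
      proof (cases "x < y")
        case True
        then show ?thesis using slope[of x y] y by simp
      next
        case False
        have "(f y - f x) / (y - x) = (f x - f y) / (x - y)"
          by (metis minus_diff_eq minus_divide_divide)
        then show ?thesis using slope[of y x] y False by simp
      qed
    qed
    then show "\<exists>\<delta>>0. \<forall>y. y \<noteq> x \<and> norm (y - x) < \<delta> \<longrightarrow> norm ((f y - f x) / (y - x) - L) < e"
      using e1(1) e2(1) by (intro exI[of _ "min e1 e2"]) auto
  qed
  then show False using assms(1) by (auto simp: real_differentiable_def)
qed

text \<open>
  Lebesgue's theorem: the points where \<open>f\<close> is not differentiable lie in countably many sets that are
  negligible by the preceding lemmas.
\<close>

theorem negligible_not_differentiable_mono: "negligible {x. \<not> f differentiable at x}"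
proof -
  define E where "E n r s = {x\<in>{- real n<..<real n}. 0 < r \<and> r < s \<and> slopes_below r x \<and> slopes_above s x}" for n r s
  define E' where "E' n = {x\<in>{- real n<..<real n}. \<forall>s. slopes_above s x}" for n
  have "negligible (E n r s)" for n r s
  proof (cases "0 < r \<and> r < s")
    case True
    then show ?thesis
      by (intro negligible_slopes_below_above[of r s _ "- real n" "real n"]) (auto simp: E_def)
  qed (auto simp: E_def)
  then have "negligible (\<Union>i\<in>UNIV \<times> \<rat> \<times> \<rat>. case i of (n, r, s) \<Rightarrow> E n r s)"
    by (intro negligible_countable_Union countable_image countable_SIGMA countable_rat) auto
  moreover have "negligible (E' n)" for n
    by (rule negligible_slopes_unbounded[of _ "- real n" "real n"]) (auto simp: E'_def)
  then have "negligible (\<Union>n. E' n)"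
    by (intro negligible_countable_Union) auto
  ultimately have "negligible ((\<Union>i\<in>UNIV \<times> \<rat> \<times> \<rat>. case i of (n, r, s) \<Rightarrow> E n r s) \<union> (\<Union>n. E' n))"
    by (rule negligible_Un)
  then show ?thesis
  proof (rule negligible_subset, intro subsetI)
    fix x assume "x \<in> {x. \<not> f differentiable at x}"
    then have nd: "\<not> f differentiable at x" by simp
    obtain n :: nat where "\<bar>x\<bar> < real n" using reals_Archimedean2 by blast
    then have n: "x \<in> {- real n<..<real n}" by auto
    show "x \<in> (\<Union>i\<in>UNIV \<times> \<rat> \<times> \<rat>. case i of (n, r, s) \<Rightarrow> E n r s) \<union> (\<Union>n. E' n)"
    proof (cases "\<exists>s. \<not> slopes_above s x")
      case True
      then obtain r s where rs: "r \<in> \<rat>" "s \<in> \<rat>" "0 < r" "r < s" "slopes_below r x" "slopes_above s x"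
        using not_differentiable_slopes[OF nd] by blast
      then have "x \<in> E n r s" using n by (simp only: E_def mem_Collect_eq)
      then show ?thesis using rs(1,2) by (intro UnI1 UN_I[of "(n, r, s)"]) simp_all
    next
      case False
      then have "x \<in> E' n" using n by (simp add: E'_def)
      then show ?thesis by blast
    qed
  qed
qed

end

section \<open>Differentiability of ACG\<open>\<^sub>*\<close> functions almost everywhere\<close>

definition nonoverlapping_on :: "real set \<Rightarrow> (real \<times> real) set \<Rightarrow> bool" where
  "nonoverlapping_on T I \<longleftrightarrow> finite I \<and> (\<forall>(c, d)\<in>I. c < d \<and> c \<in> T \<and> d \<in> T) \<and>
     pairwise (\<lambda>(c, d) (c', d'). {c<..<d} \<inter> {c'<..<d'} = {}) I"

lemma AC_star_alt:
  "AC_star F T \<longleftrightarrow> (\<forall>\<epsilon>>0. \<exists>\<delta>>0. \<forall>I. nonoverlapping_on T I \<and> (\<Sum>(c, d)\<in>I. d - c) < \<delta> \<longrightarrow>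
     (\<Sum>(c, d)\<in>I. oscillation F c d) < ereal \<epsilon>)"
  unfolding AC_star_def nonoverlapping_on_def by (simp add: conj_assoc)

lemma nonoverlapping_on_mono: "nonoverlapping_on S I \<Longrightarrow> S \<subseteq> T \<Longrightarrow> nonoverlapping_on T I"
  unfolding nonoverlapping_on_def by blast

lemma AC_star_subset: "AC_star F T \<Longrightarrow> S \<subseteq> T \<Longrightarrow> AC_star F S"
  unfolding AC_star_alt by (meson nonoverlapping_on_mono)

lemma oscillation_ge:
  assumes "c \<le> x" "x \<le> d" "c \<le> y" "y \<le> d"
  shows "ereal \<bar>F y - F x\<bar> \<le> oscillation F c d"
proof (cases "x \<le> y")
  case True
  then show ?thesis unfolding oscillation_def using assms by (intro Sup_upper) auto
next
  case False
  then have "ereal \<bar>F x - F y\<bar> \<le> oscillation F c d"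
    unfolding oscillation_def using assms
    by (intro Sup_upper CollectI exI[of _ y] exI[of _ x]) auto
  then show ?thesis by (simp add: abs_minus_commute)
qed

lemma sum_lengths_le:
  assumes I: "nonoverlapping_on T I" and T: "T \<subseteq> {a..b}" and ab: "a \<le> b"
  shows "(\<Sum>(c, d)\<in>I. d - c) \<le> b - a"
  using I T ab unfolding nonoverlapping_on_def
  by (intro sum_increments_le) (auto simp: mono_def)

text \<open>
  Let \<open>e\<close> be the length that belongs to the bound \<open>1\<close> in the definition of AC\<open>\<^sub>*\<close>.  On a piece of \<open>T\<close>
  of length less than \<open>e\<close> every non-overlapping family is shorter than \<open>e\<close>.
\<close>

lemma AC_star_bounded_pieces:
  assumes AC: "AC_star F T"
  obtains \<P> where "countable \<P>" "\<Union>\<P> = T"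
    "\<And>P. P \<in> \<P> \<Longrightarrow> AC_star F P"  "\<And>P. P \<in> \<P> \<Longrightarrow> bounded P"
    "\<And>P I. P \<in> \<P> \<Longrightarrow> nonoverlapping_on P I \<Longrightarrow> (\<Sum>(c, d)\<in>I. oscillation F c d) < 1"
proof -
  obtain e where e: "e > 0" "\<And>I. nonoverlapping_on T I \<Longrightarrow> (\<Sum>(c, d)\<in>I. d - c) < e \<Longrightarrow>
     (\<Sum>(c, d)\<in>I. oscillation F c d) < ereal 1"
    using AC unfolding AC_star_alt by (meson zero_less_one)
  define h where "h = e / 2"
  have h: "h > 0" "h < e" using e by (auto simp: h_def)
  define P where "P k = T \<inter> {of_int k * h..(of_int k + 1) * h}" for k :: int
  show ?thesis
  proof (rule that[of "range P"])
    have "x \<in> P \<lfloor>x / h\<rfloor>" if "x \<in> T" for x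
    proof -
      show ?thesis
        using that floor_divide_lower[OF h(1), of x] floor_divide_upper[OF h(1), of x]
        by (simp add: P_def)
    qed
    moreover have "P k \<subseteq> T" for k by (simp add: P_def)
    ultimately show "\<Union>(range P) = T" by blast
    show "AC_star F Q" if "Q \<in> range P" for Q
      using that by (auto simp: P_def intro: AC_star_subset[OF AC])
    show "bounded Q" if "Q \<in> range P" for Q
      using that by (auto simp: P_def intro: bounded_subset[OF bounded_closed_interval])
    show "(\<Sum>(c, d)\<in>I. oscillation F c d) < 1" if Q: "Q \<in> range P" and I: "nonoverlapping_on Q I" for Q I
    proof -
      obtain k where k: "Q = P k" using Q by blast
      have "(\<Sum>(c, d)\<in>I. d - c) \<le> (of_int k + 1) * h - of_int k * h"
        using I h by (intro sum_lengths_le) (auto simp: k P_def)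
      also have "\<dots> < e" using h by (simp add: algebra_simps)
      finally show ?thesis
        using e(2)[OF nonoverlapping_on_mono[OF I]] by (simp add: k P_def one_ereal_def)
    qed
  qed simp
qed

text \<open>
  \<open>V x\<close> is the supremum of the total oscillation over families of intervals with end points in \<open>T\<close> and
  to the left of \<open>x\<close>.  Adding the interval from \<open>c\<close> to \<open>d\<close> to a family that ends before \<open>c\<close> shows that
  \<open>V d - V c\<close> is at least the oscillation between \<open>c\<close> and \<open>d\<close>.
\<close>

lemma oscillation_majorant:
  assumes bound: "\<And>I. nonoverlapping_on T I \<Longrightarrow> (\<Sum>(c, d)\<in>I. oscillation F c d) < 1"
  obtains V :: "real \<Rightarrow> real" where "mono V"
    "\<And>c d x y. c \<in> T \<Longrightarrow> d \<in> T \<Longrightarrow> c \<le> x \<Longrightarrow> x \<le> d \<Longrightarrow> c \<le> y \<Longrightarrow> y \<le> d \<Longrightarrow> \<bar>F y - F x\<bar> \<le> V d - V c"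
proof -
  define w where "w = (\<lambda>(c, d). real_of_ereal (oscillation F c d))"
  have osc: "oscillation F c d = ereal (w (c, d))" if "c \<in> T" "d \<in> T" "c < d" for c d
  proof -
    have "nonoverlapping_on T {(c, d)}" using that by (simp add: nonoverlapping_on_def)
    then have "oscillation F c d < 1" using bound[of "{(c, d)}"] by simp
    moreover have "0 \<le> oscillation F c d"
      using oscillation_ge[of c c d c F] that unfolding zero_ereal_def by simp
    ultimately show ?thesis by (cases "oscillation F c d") (auto simp: w_def)
  qed
  have W: "sum w I < 1" if "nonoverlapping_on T I" for I
  proof -
    have "(\<Sum>(c, d)\<in>I. oscillation F c d) = (\<Sum>i\<in>I. ereal (w i))"
      using that osc by (intro sum.cong) (auto simp: nonoverlapping_on_def)
    then have "ereal (sum w I) < 1" using bound[OF that] by (simp add: sum_ereal)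
    then show ?thesis by (simp add: one_ereal_def)
  qed
  define A where "A x = sum w ` {I. nonoverlapping_on (T \<inter> {..x}) I}" for x
  define V where "V x = Sup (A x)" for x
  have ne: "A x \<noteq> {}" for x
    unfolding A_def by (auto simp: nonoverlapping_on_def intro!: exI[of _ "{}"])
  have bdd: "bdd_above (A x)" for x
    using W nonoverlapping_on_mono by (intro bdd_aboveI[of _ 1]) (fastforce simp: A_def)
  have "mono V"
  proof (rule monoI)
    fix x y :: real assume "x \<le> y"
    then have "A x \<subseteq> A y" unfolding A_def by (auto intro!: imageI elim: nonoverlapping_on_mono)
    then show "V x \<le> V y" unfolding V_def by (rule cSup_subset_mono[OF ne bdd])
  qed
  moreover have "\<bar>F y - F x\<bar> \<le> V d - V c"
    if cd: "c \<in> T" "d \<in> T" and xy: "c \<le> x" "x \<le> d" "c \<le> y" "y \<le> d" for c d x y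
  proof (cases "c = d")
    case True
    then show ?thesis using xy by simp
  next
    case False
    then have lt: "c < d" using xy by simp
    have "V c \<le> V d - w (c, d)"
      unfolding V_def[of c]
    proof (rule cSup_least[OF ne])
      fix s assume "s \<in> A c"
      then obtain I where I: "s = sum w I" "nonoverlapping_on (T \<inter> {..c}) I" by (auto simp: A_def)
      have new: "(c, d) \<notin> I" using I(2) lt by (auto simp: nonoverlapping_on_def)
      have "nonoverlapping_on (T \<inter> {..d}) (insert (c, d) I)"
        using I(2) cd lt unfolding nonoverlapping_on_def by (fastforce simp: pairwise_insert)
      then have "sum w (insert (c, d) I) \<le> V d"
        unfolding V_def by (intro cSup_upper bdd) (auto simp: A_def)
      then show "s \<le> V d - w (c, d)"
        using I new by (simp add: nonoverlapping_on_def)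
    qed
    moreover have "\<bar>F y - F x\<bar> \<le> w (c, d)"
      using oscillation_ge[OF xy, of F] osc[OF cd lt] by simp
    ultimately show ?thesis by simp
  qed
  ultimately show ?thesis by (rule that)
qed

text \<open>
  At \<open>x\<close> the extension is the supremum of \<open>\<phi>\<close> over the points of \<open>T\<close> up to \<open>x\<close>, and the lower bound
  \<open>m\<close> if there are none; the last conclusion states that the supremum is approximated on \<open>T\<close>.
\<close>

lemma mono_extension:
  fixes \<phi> :: "real \<Rightarrow> real"
  assumes mono: "\<And>x y. x \<in> T \<Longrightarrow> y \<in> T \<Longrightarrow> x \<le> y \<Longrightarrow> \<phi> x \<le> \<phi> y" and bound: "\<And>x. x \<in> T \<Longrightarrow> m \<le> \<phi> x \<and> \<phi> x \<le> M"
  obtains U where "mono U" "\<And>x. x \<in> T \<Longrightarrow> U x = \<phi> x"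
    "\<And>x c. m \<le> c \<Longrightarrow> c < U x \<Longrightarrow> \<exists>t\<in>T. t \<le> x \<and> c < \<phi> t"
proof -
  define A where "A x = insert m (\<phi> ` (T \<inter> {..x}))" for x
  have bdd: "bdd_above (A x)" for x
    using bound by (intro bdd_aboveI[of _ "max m M"]) (fastforce simp: A_def max_def)
  have ne: "A x \<noteq> {}" for x by (simp add: A_def)
  show ?thesis
  proof (rule that[of "\<lambda>x. Sup (A x)"])
    show "mono (\<lambda>x. Sup (A x))"
      by (intro monoI cSup_subset_mono ne bdd) (auto simp: A_def)
    show "Sup (A x) = \<phi> x" if "x \<in> T" for x
      using that mono bound by (intro cSup_eq_maximum) (auto simp: A_def)
    show "\<exists>t\<in>T. t \<le> x \<and> c < \<phi> t" if "m \<le> c" "c < Sup (A x)" for x c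
      using that unfolding less_cSup_iff[OF ne bdd] by (auto simp: A_def)
  qed
qed

lemma has_real_derivative_alt:
  "(f has_real_derivative D) (at x within S) \<longleftrightarrow>
     (\<forall>e>0. \<exists>d>0. \<forall>y\<in>S. \<bar>y - x\<bar> < d \<longrightarrow> \<bar>f y - f x - D * (y - x)\<bar> \<le> e * \<bar>y - x\<bar>)"
  unfolding has_field_derivative_def has_derivative_within_alt
  by (simp add: bounded_linear_mult_right)

text \<open>
  Let \<open>p y\<close> be the last point of the closure of \<open>T\<close> before \<open>y\<close>.  The function \<open>p\<close> is increasing, hence
  differentiable almost everywhere, and it is the identity on \<open>T\<close>.  At a point \<open>x\<close> of \<open>T\<close> to which
  points of \<open>T\<close> converge from the right, its derivative can therefore only be \<open>1\<close>.  This says that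
  \<open>y - p y\<close> is small in comparison with \<open>y - x\<close>, and \<open>T\<close> has points close to \<open>p y\<close>.
\<close>

lemma almost_every_point_accumulates:
  fixes T :: "real set"
  assumes "bounded T"
  obtains N where "negligible N"
    "\<And>x e. x \<in> T - N \<Longrightarrow> e > 0 \<Longrightarrow> \<exists>d>0. \<forall>y. \<bar>y - x\<bar> < d \<longrightarrow> (\<exists>w\<in>T. w \<le> y \<and> y - w \<le> e * \<bar>y - x\<bar>)"
proof -
  obtain B where B: "\<And>x. x \<in> T \<Longrightarrow> \<bar>x\<bar> \<le> B" using assms unfolding bounded_iff real_norm_def by blast
  obtain p where p: "mono p" "\<And>x. x \<in> T \<Longrightarrow> p x = x"
      "\<And>x c. - B - 1 \<le> c \<Longrightarrow> c < p x \<Longrightarrow> \<exists>t\<in>T. t \<le> x \<and> c < t"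
  proof (rule mono_extension[of T "\<lambda>x. x" "- B - 1" B])
    show "- B - 1 \<le> x \<and> x \<le> B" if "x \<in> T" for x using B[OF that] by auto
  qed auto
  define N where "N = {x. \<not> p differentiable at x} \<union> {x\<in>T. \<exists>y>x. T \<inter> {x<..<y} = {}}"
  show ?thesis
  proof (rule that[of N])
    show "negligible N" unfolding N_def
      by (intro negligible_Un negligible_not_differentiable_mono p negligible_countable countable_right_isolated)
    fix x e :: real assume x: "x \<in> T - N" and e: "e > 0"
    then have xT: "x \<in> T" and acc: "\<And>y. y > x \<Longrightarrow> T \<inter> {x<..<y} \<noteq> {}" and "p differentiable at x"
      by (auto simp: N_def)
    then obtain D where D: "(p has_real_derivative D) (at x)" by (auto simp: real_differentiable_def)
    have px: "p x = x" using p(2) xT .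
    have "D = 1"
    proof (rule ccontr)
      assume "D \<noteq> 1"
      then obtain d where d: "d > 0" "\<And>y. \<bar>y - x\<bar> < d \<Longrightarrow> \<bar>p y - p x - D * (y - x)\<bar> \<le> \<bar>1 - D\<bar> / 2 * \<bar>y - x\<bar>"
        using D unfolding has_real_derivative_alt by (metis UNIV_I half_gt_zero right_minus_eq zero_less_abs_iff)
      obtain t where t: "t \<in> T" "x < t" "t < x + d" using acc[of "x + d"] d(1) by auto
      have "p t - p x - D * (t - x) = (1 - D) * (t - x)"
        using p(2)[OF t(1)] px by (simp add: algebra_simps)
      then have "\<bar>1 - D\<bar> * (t - x) \<le> \<bar>1 - D\<bar> / 2 * (t - x)"
        using d(2)[of t] t by (simp add: abs_mult)
      then show False using \<open>D \<noteq> 1\<close> t(2) by simp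
    qed
    define e' where "e' = min (e / 2) (1 / 2)"
    have e': "e' > 0" "2 * e' \<le> e" "e' \<le> 1 / 2" using e by (auto simp: e'_def)
    obtain d where d: "d > 0" "\<And>y. \<bar>y - x\<bar> < d \<Longrightarrow> \<bar>p y - p x - 1 * (y - x)\<bar> \<le> e' * \<bar>y - x\<bar>"
      using D e'(1) unfolding has_real_derivative_alt \<open>D = 1\<close> by blast
    show "\<exists>d>0. \<forall>y. \<bar>y - x\<bar> < d \<longrightarrow> (\<exists>w\<in>T. w \<le> y \<and> y - w \<le> e * \<bar>y - x\<bar>)"
    proof (intro exI conjI allI impI)
      show "min d (1 / 2) > 0" using d by simp
      fix y assume y: "\<bar>y - x\<bar> < min d (1 / 2)"
      show "\<exists>w\<in>T. w \<le> y \<and> y - w \<le> e * \<bar>y - x\<bar>"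
      proof (cases "y = x")
        case True
        then show ?thesis using xT by auto
      next
        case False
        define h where "h = \<bar>y - x\<bar>"
        have h: "h > 0" "h < 1 / 2" "h < d" using False y by (auto simp: h_def)
        have "\<bar>p y - y\<bar> \<le> e' * h" using d(2)[of y] h px by (simp add: h_def)
        then have "y - e' * h \<le> p y" by (simp add: abs_le_iff)
        moreover have "e' * h \<le> 1 / 2 * h" "0 < e' * h" "2 * e' * h \<le> e * h"
          using e' h(1) by (auto intro: mult_right_mono)
        moreover have "- B \<le> x" using B[OF xT] by simp
        moreover have "x - h \<le> y" unfolding h_def by linarith
        ultimately have "- B - 1 \<le> y - 2 * e' * h" "y - 2 * e' * h < p y"
          using h by linarith+
        then obtain w where "w \<in> T" "w \<le> y" "y - 2 * e' * h < w" using p(3) by blast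
        then show ?thesis using \<open>2 * e' * h \<le> e * h\<close> by (intro bexI[of _ w]) (auto simp: h_def)
      qed
    qed
  qed
qed

text \<open>
  Every \<open>y\<close> near \<open>x\<close> lies between points \<open>w\<close> and \<open>z\<close> of \<open>T\<close> whose distance is small in comparison with
  \<open>y - x\<close>.  The increment of \<open>F\<close> from \<open>x\<close> to \<open>w\<close> is read off from \<open>U\<close> and \<open>V\<close>, and the increment from
  \<open>w\<close> to \<open>y\<close> is at most \<open>V z - V w\<close>, which is small because \<open>V\<close> is differentiable at \<open>x\<close>.
\<close>

lemma differentiable_of_majorant:
  assumes xT: "x \<in> T"
    and acc: "\<And>e. e > 0 \<Longrightarrow> \<exists>d>0. \<forall>y. \<bar>y - x\<bar> < d \<longrightarrow> (\<exists>w\<in>T. w \<le> y \<and> y - w \<le> e * \<bar>y - x\<bar>)"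
    and V: "(V has_real_derivative b) (at x)"
    and maj: "\<And>c d x y. c \<in> T \<Longrightarrow> d \<in> T \<Longrightarrow> c \<le> x \<Longrightarrow> x \<le> d \<Longrightarrow> c \<le> y \<Longrightarrow> y \<le> d \<Longrightarrow> \<bar>F y - F x\<bar> \<le> V d - V c"
    and U: "(U has_real_derivative a) (at x)" and F: "\<And>t. t \<in> T \<Longrightarrow> F t = U t - V t"
  shows "(F has_real_derivative a - b) (at x)"
  unfolding has_real_derivative_alt
proof (intro allI impI)
  fix e :: real assume e: "e > 0"
  define L where "L = a - b"
  define \<eta> where "\<eta> = e / 16"
  define k where "k = 3 * \<bar>b\<bar> + \<bar>L\<bar> + 1"
  define \<epsilon> where "\<epsilon> = min (1 / 2) (e / (2 * k))"
  have \<eta>: "\<eta> > 0" using e by (simp add: \<eta>_def)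
  have den: "k > 0" unfolding k_def by linarith
  have "e / (2 * k) > 0" using e den by (intro divide_pos_pos) auto
  then have \<epsilon>: "\<epsilon> > 0" "\<epsilon> \<le> 1 / 2" unfolding \<epsilon>_def by (simp_all only: min.cobounded1 min_less_iff_conj) simp
  have "\<epsilon> * k \<le> e / 2"
  proof -
    have "\<epsilon> \<le> e / (2 * k)" unfolding \<epsilon>_def by (rule min.cobounded2)
    then have "\<epsilon> * k \<le> e / (2 * k) * k"
      using den by (intro mult_right_mono) auto
    then show ?thesis using den by simp
  qed
  then have small: "3 * \<bar>b\<bar> * \<epsilon> + \<bar>L\<bar> * \<epsilon> \<le> e / 2" using \<epsilon>(1) by (simp add: k_def algebra_simps)
  obtain d1 where d1: "d1 > 0" "\<And>y. \<bar>y - x\<bar> < d1 \<Longrightarrow> \<exists>w\<in>T. w \<le> y \<and> y - w \<le> \<epsilon> * \<bar>y - x\<bar>"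
    using acc[OF \<epsilon>(1)] by blast
  obtain d2 where d2: "d2 > 0" "\<And>y. \<bar>y - x\<bar> < d2 \<Longrightarrow> \<bar>U y - U x - a * (y - x)\<bar> \<le> \<eta> * \<bar>y - x\<bar>"
    using U \<eta> unfolding has_real_derivative_alt by blast
  obtain d3 where d3: "d3 > 0" "\<And>y. \<bar>y - x\<bar> < d3 \<Longrightarrow> \<bar>V y - V x - b * (y - x)\<bar> \<le> \<eta> * \<bar>y - x\<bar>"
    using V \<eta> unfolding has_real_derivative_alt by blast
  show "\<exists>d>0. \<forall>y\<in>UNIV. \<bar>y - x\<bar> < d \<longrightarrow> \<bar>F y - F x - (a - b) * (y - x)\<bar> \<le> e * \<bar>y - x\<bar>"
  proof (intro exI conjI ballI impI)
    show "min d1 (min d2 d3) / 2 > 0" using d1 d2 d3 by simp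
    fix y assume y: "\<bar>y - x\<bar> < min d1 (min d2 d3) / 2"
    define h where "h = \<bar>y - x\<bar>"
    have h: "h \<ge> 0" "2 * h < d1" "2 * h < d2" "2 * h < d3" using y by (auto simp: h_def)
    have \<epsilon>h: "0 \<le> \<epsilon> * h" "2 * (\<epsilon> * h) \<le> h" "\<epsilon> * (2 * h) = 2 * (\<epsilon> * h)"
      using \<epsilon> h mult_right_mono[of \<epsilon> "1/2" h] by auto
    have "h < d1" using h(1,2) by linarith
    then obtain w where w: "w \<in> T" "w \<le> y" "y - w \<le> \<epsilon> * h" using d1(2) unfolding h_def by blast
    have yx: "x - h \<le> y" "y \<le> x + h" unfolding h_def by linarith+
    \<comment> \<open>A point of \<open>T\<close> to the right of \<open>y\<close> is a point to the left of \<open>y + 2 * \<epsilon> * h\<close> that is close to it.\<close>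
    have y2: "\<bar>y + 2 * (\<epsilon> * h) - x\<bar> \<le> 2 * h" using \<epsilon>h yx by linarith
    then obtain z where z: "z \<in> T" "z \<le> y + 2 * (\<epsilon> * h)" "y + 2 * (\<epsilon> * h) - z \<le> \<epsilon> * \<bar>y + 2 * (\<epsilon> * h) - x\<bar>"
      using d1(2)[of "y + 2 * (\<epsilon> * h)"] h by auto
    moreover have "\<epsilon> * \<bar>y + 2 * (\<epsilon> * h) - x\<bar> \<le> \<epsilon> * (2 * h)"
      using y2 \<epsilon> by (intro mult_left_mono) auto
    ultimately have yz: "y \<le> z" using \<epsilon>h by linarith
    have wx: "\<bar>w - x\<bar> \<le> 2 * h" using w \<epsilon>h yx by linarith
    have zx: "\<bar>z - x\<bar> \<le> 2 * h" using z(2) yz \<epsilon>h yx by linarith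
    have \<eta>2: "\<eta> * \<bar>w - x\<bar> \<le> \<eta> * (2 * h)" "\<eta> * \<bar>z - x\<bar> \<le> \<eta> * (2 * h)"
      using wx zx \<eta> by (intro mult_left_mono; simp)+
    have Uw: "\<bar>U w - U x - a * (w - x)\<bar> \<le> \<eta> * (2 * h)"
      using order_trans[OF d2(2)[of w] \<eta>2(1)] wx h by simp
    have Vw: "\<bar>V w - V x - b * (w - x)\<bar> \<le> \<eta> * (2 * h)"
      using order_trans[OF d3(2)[of w] \<eta>2(1)] wx h by simp
    have Vz: "\<bar>V z - V x - b * (z - x)\<bar> \<le> \<eta> * (2 * h)"
      using order_trans[OF d3(2)[of z] \<eta>2(2)] zx h by simp
    have "\<bar>b * (z - w)\<bar> \<le> \<bar>b\<bar> * (3 * (\<epsilon> * h))"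
      unfolding abs_mult using w z(2) yz by (intro mult_left_mono) auto
    then have bzw: "b * (z - x) - b * (w - x) \<le> 3 * \<bar>b\<bar> * \<epsilon> * h"
      by (simp add: algebra_simps)
    have "\<bar>L * (y - w)\<bar> \<le> \<bar>L\<bar> * (\<epsilon> * h)"
      unfolding abs_mult using w by (intro mult_left_mono) auto
    then have Lyw: "\<bar>L * (y - w)\<bar> \<le> \<bar>L\<bar> * \<epsilon> * h" by (simp add: mult.assoc)
    have Fyw: "\<bar>F y - F w\<bar> \<le> V z - V w" using maj[of w z w y] w z(1) yz by simp
    have eq: "F y - F x - L * (y - x) =
        (F y - F w) + (U w - U x - a * (w - x)) - (V w - V x - b * (w - x)) - L * (y - w)"
      using F[OF w(1)] F[OF xT] by (simp add: L_def algebra_simps)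
    have "\<bar>F y - F x - L * (y - x)\<bar> \<le> 3 * \<bar>b\<bar> * \<epsilon> * h + \<bar>L\<bar> * \<epsilon> * h + 4 * (\<eta> * (2 * h))"
      unfolding eq using Fyw Uw Vw Vz bzw Lyw by linarith
    also have "\<dots> = (3 * \<bar>b\<bar> * \<epsilon> + \<bar>L\<bar> * \<epsilon>) * h + e / 2 * h" by (simp add: \<eta>_def algebra_simps)
    also have "\<dots> \<le> e / 2 * h + e / 2 * h"
      using small h(1) by (intro add_right_mono mult_right_mono)
    finally show "\<bar>F y - F x - (a - b) * (y - x)\<bar> \<le> e * \<bar>y - x\<bar>" by (simp add: L_def h_def)
  qed
qed

text \<open>
  On \<open>T\<close> the sum \<open>F + V\<close> of \<open>F\<close> and its majorant is increasing.  So \<open>F\<close> agrees on \<open>T\<close> with the difference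
  of two increasing functions on the line, \<open>V\<close> and an extension of \<open>F + V\<close>.
\<close>

lemma negligible_not_differentiable_piece:
  assumes T: "bounded T" and bound: "\<And>I. nonoverlapping_on T I \<Longrightarrow> (\<Sum>(c, d)\<in>I. oscillation F c d) < 1"
  shows "negligible {x\<in>T. \<not> F differentiable at x}"
proof -
  obtain B where B: "\<And>x. x \<in> T \<Longrightarrow> \<bar>x\<bar> \<le> B" using T unfolding bounded_iff real_norm_def by blast
  obtain V where V: "mono V"
      "\<And>c d x y. c \<in> T \<Longrightarrow> d \<in> T \<Longrightarrow> c \<le> x \<Longrightarrow> x \<le> d \<Longrightarrow> c \<le> y \<Longrightarrow> y \<le> d \<Longrightarrow> \<bar>F y - F x\<bar> \<le> V d - V c"
    using oscillation_majorant[OF bound] by metis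
  have FV: "\<bar>F d - F c\<bar> \<le> V d - V c" if "c \<in> T" "d \<in> T" "c \<le> d" for c d
    using V(2)[of c d c d] that by simp
  obtain m M where mM: "\<And>t. t \<in> T \<Longrightarrow> m \<le> F t + V t \<and> F t + V t \<le> M"
  proof (cases "T = {}")
    case False
    then obtain t0 where t0: "t0 \<in> T" by blast
    have "\<bar>F t + V t - F t0\<bar> \<le> 3 * (\<bar>V B\<bar> + \<bar>V (- B)\<bar>)" if "t \<in> T" for t
    proof -
      have "V (- B) \<le> V s" "V s \<le> V B" if "s \<in> T" for s
        using B[OF that] V(1) by (auto intro!: monoD[OF V(1)])
      from this[OF t0] this[OF that] show ?thesis
        using FV[OF t0 that] FV[OF that t0] by (cases "t0 \<le> t") (auto simp: abs_if split: if_splits)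
    qed
    then show ?thesis
      by (intro that[of "F t0 - 3 * (\<bar>V B\<bar> + \<bar>V (- B)\<bar>)" "F t0 + 3 * (\<bar>V B\<bar> + \<bar>V (- B)\<bar>)"])
        (simp only: abs_le_iff, fastforce)
  qed (use that in auto)
  obtain U where U: "mono U" "\<And>t. t \<in> T \<Longrightarrow> U t = F t + V t"
  proof (rule mono_extension[of T "\<lambda>t. F t + V t" m M])
    show "F x + V x \<le> F y + V y" if "x \<in> T" "y \<in> T" "x \<le> y" for x y
      using FV[OF that] by linarith
  qed (use mM in auto)
  obtain N where N: "negligible N"
    "\<And>x e. x \<in> T - N \<Longrightarrow> e > 0 \<Longrightarrow> \<exists>d>0. \<forall>y. \<bar>y - x\<bar> < d \<longrightarrow> (\<exists>w\<in>T. w \<le> y \<and> y - w \<le> e * \<bar>y - x\<bar>)"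
    using almost_every_point_accumulates[OF T] by metis
  have neg: "negligible (N \<union> {x. \<not> V differentiable at x} \<union> {x. \<not> U differentiable at x})"
    by (intro negligible_Un N negligible_not_differentiable_mono V U)
  show ?thesis
  proof (rule negligible_subset[OF neg], intro subsetI, rule ccontr)
    fix x assume x: "x \<in> {x\<in>T. \<not> F differentiable at x}"
      "x \<notin> N \<union> {x. \<not> V differentiable at x} \<union> {x. \<not> U differentiable at x}"
    then obtain a b where "(U has_real_derivative a) (at x)" "(V has_real_derivative b) (at x)"
      by (auto simp: real_differentiable_def)
    then have "(F has_real_derivative a - b) (at x)"
      using x N(2) V(2) U(2) by (intro differentiable_of_majorant[of x T V b F U a]) auto
    then show False using x by (auto simp: real_differentiable_def)
  qed
qed

theorem ACG_star_differentiable_AE: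
  assumes "ACG_star F S"
  shows "negligible {x\<in>S. \<not> F differentiable at x}"
proof -
  obtain \<T> where \<T>: "countable \<T>" "\<Union>\<T> = S" "\<And>T. T \<in> \<T> \<Longrightarrow> AC_star F T"
    using assms unfolding ACG_star_def by blast
  have "negligible {x\<in>T. \<not> F differentiable at x}" if T: "T \<in> \<T>" for T
  proof -
    obtain \<P> where \<P>: "countable \<P>" "\<Union>\<P> = T" "\<And>P. P \<in> \<P> \<Longrightarrow> bounded P"
        "\<And>P I. P \<in> \<P> \<Longrightarrow> nonoverlapping_on P I \<Longrightarrow> (\<Sum>(c, d)\<in>I. oscillation F c d) < 1"
      using AC_star_bounded_pieces[OF \<T>(3)[OF T]] by metis
    have "negligible (\<Union>P\<in>\<P>. {x\<in>P. \<not> F differentiable at x})"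
      using \<P>(1) by (intro negligible_countable_Union)
        (auto intro: negligible_not_differentiable_piece \<P>)
    moreover have "(\<Union>P\<in>\<P>. {x\<in>P. \<not> F differentiable at x}) = {x\<in>T. \<not> F differentiable at x}"
      using \<P>(2) by blast
    ultimately show ?thesis by simp
  qed
  then have "negligible (\<Union>T\<in>\<T>. {x\<in>T. \<not> F differentiable at x})"
    using \<T>(1) by (intro negligible_countable_Union) auto
  moreover have "(\<Union>T\<in>\<T>. {x\<in>T. \<not> F differentiable at x}) = {x\<in>S. \<not> F differentiable at x}"
    using \<T>(2) by blast
  ultimately show ?thesis by simp
qed

section \<open>Henstock--Kurzweil integral of the derivative\<close>

text \<open>
  The variational measure of \<open>F\<close> vanishes on \<open>S\<close>.
\<close>

definition null_variation :: "(real \<Rightarrow> real) \<Rightarrow> real \<Rightarrow> real \<Rightarrow> real set \<Rightarrow> bool" where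
  "null_variation F a b S \<longleftrightarrow> (\<forall>\<epsilon>>0. \<exists>\<gamma>. gauge \<gamma> \<and>
     (\<forall>p. p tagged_partial_division_of {a..b} \<and> \<gamma> fine p \<and> fst ` p \<subseteq> S \<longrightarrow>
        (\<Sum>(x, K)\<in>p. \<bar>F (Sup K) - F (Inf K)\<bar>) \<le> \<epsilon>))"

lemma null_variationE:
  assumes "null_variation F a b S" "\<epsilon> > 0"
  obtains \<gamma> where "gauge \<gamma>"
    "\<And>p. p tagged_partial_division_of {a..b} \<Longrightarrow> \<gamma> fine p \<Longrightarrow> fst ` p \<subseteq> S \<Longrightarrow>
      (\<Sum>(x, K)\<in>p. \<bar>F (Sup K) - F (Inf K)\<bar>) \<le> \<epsilon>"
proof -
  have "\<exists>\<gamma>. gauge \<gamma> \<and> (\<forall>p. p tagged_partial_division_of {a..b} \<and> \<gamma> fine p \<and> fst ` p \<subseteq> S \<longrightarrow>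
        (\<Sum>(x, K)\<in>p. \<bar>F (Sup K) - F (Inf K)\<bar>) \<le> \<epsilon>)"
    using assms(1)[unfolded null_variation_def, rule_format, OF assms(2)] .
  then show ?thesis using that by (elim exE conjE) simp
qed

lemma null_variation_subset: "null_variation F a b S \<Longrightarrow> R \<subseteq> S \<Longrightarrow> null_variation F a b R"
  unfolding null_variation_def by (meson order_trans)

lemma tagged_partial_division_interval:
  assumes "p tagged_partial_division_of {a..b::real}" "(x, K) \<in> p"
  shows "K = {Inf K..Sup K}" "Inf K \<le> x" "x \<le> Sup K" "a \<le> Inf K" "Sup K \<le> b"
    "Inf K \<in> K" "Sup K \<in> K" "measure lborel K = Sup K - Inf K"
proof -
  obtain c d where K: "K = {c..d}" "x \<in> K" "K \<subseteq> {a..b}"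
    using assms unfolding tagged_partial_division_of_def by (metis box_real(2))
  then have "c \<le> d" by auto
  then show "K = {Inf K..Sup K}" "Inf K \<le> x" "x \<le> Sup K" "a \<le> Inf K" "Sup K \<le> b"
    "Inf K \<in> K" "Sup K \<in> K" "measure lborel K = Sup K - Inf K"
    using K by auto
qed

lemma tagged_partial_division_disjoint:
  assumes p: "p tagged_partial_division_of {a..b::real}" and q: "q \<in> p" "r \<in> p" "q \<noteq> r"
  shows "{Inf (snd q)<..<Sup (snd q)} \<inter> {Inf (snd r)<..<Sup (snd r)} = {}"
proof -
  have "interior (snd q) \<inter> interior (snd r) = {}"
    using p q unfolding tagged_partial_division_of_def by (metis prod.collapse)
  moreover have "interior (snd s) = {Inf (snd s)<..<Sup (snd s)}" if "s \<in> p" for s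
    using tagged_partial_division_interval(1)[OF p, of "fst s" "snd s"] that
    by (metis interior_atLeastAtMost_real prod.collapse)
  ultimately show ?thesis using q by simp
qed

text \<open>
  Tags divide their intervals into a right and a left part.  Right parts of length zero are left out,
  so that no two of the remaining ones share their tag, and likewise for the left parts.
\<close>

lemma variation_split:
  fixes F :: "real \<Rightarrow> real"
  assumes p: "p tagged_partial_division_of {a..b::real}"
  shows "(\<Sum>(x, K)\<in>p. \<bar>F (Sup K) - F (Inf K)\<bar>) \<le>
     (\<Sum>q\<in>{q\<in>p. fst q < Sup (snd q)}. \<bar>F (Sup (snd q)) - F (fst q)\<bar>) +
     (\<Sum>q\<in>{q\<in>p. Inf (snd q) < fst q}. \<bar>F (Inf (snd q)) - F (fst q)\<bar>)"
proof -
  have fin: "finite p" using p by (simp add: tagged_partial_division_of_def)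
  have "(\<Sum>(x, K)\<in>p. \<bar>F (Sup K) - F (Inf K)\<bar>) \<le>
      (\<Sum>q\<in>p. \<bar>F (Sup (snd q)) - F (fst q)\<bar>) + (\<Sum>q\<in>p. \<bar>F (Inf (snd q)) - F (fst q)\<bar>)"
    unfolding sum.distrib[symmetric] by (rule sum_mono) auto
  also have "(\<Sum>q\<in>p. \<bar>F (Sup (snd q)) - F (fst q)\<bar>) =
      (\<Sum>q\<in>{q\<in>p. fst q < Sup (snd q)}. \<bar>F (Sup (snd q)) - F (fst q)\<bar>)"
  proof (intro sum.mono_neutral_right fin ballI)
    fix q assume "q \<in> p - {q\<in>p. fst q < Sup (snd q)}"
    then have "Sup (snd q) = fst q"
      using tagged_partial_division_interval(3)[OF p, of "fst q" "snd q"] by auto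
    then show "\<bar>F (Sup (snd q)) - F (fst q)\<bar> = 0" by simp
  qed auto
  also have "(\<Sum>q\<in>p. \<bar>F (Inf (snd q)) - F (fst q)\<bar>) =
      (\<Sum>q\<in>{q\<in>p. Inf (snd q) < fst q}. \<bar>F (Inf (snd q)) - F (fst q)\<bar>)"
  proof (intro sum.mono_neutral_right fin ballI)
    fix q assume "q \<in> p - {q\<in>p. Inf (snd q) < fst q}"
    then have "Inf (snd q) = fst q"
      using tagged_partial_division_interval(2)[OF p, of "fst q" "snd q"] by auto
    then show "\<bar>F (Inf (snd q)) - F (fst q)\<bar> = 0" by simp
  qed auto
  finally show ?thesis .
qed

text \<open>
  Each tag uses the gauge of the first set that contains it, where the \<open>n\<close>-th gauge is chosen for
  \<open>\<epsilon> / 2 ^ (n + 1)\<close>.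
\<close>

lemma null_variation_Union:
  assumes "countable \<S>" and null: "\<And>S. S \<in> \<S> \<Longrightarrow> null_variation F a b S"
  shows "null_variation F a b (\<Union>\<S>)"
proof (cases "\<S> = {}")
  case True
  have "null_variation F a b {}"
    unfolding null_variation_def by (auto intro!: exI[of _ "\<lambda>x. UNIV"] simp: gauge_def)
  then show ?thesis using True by simp
next
  case False
  define S where "S = from_nat_into \<S>"
  have S: "range S = \<S>" using False assms(1) by (simp add: S_def)
  show ?thesis
    unfolding null_variation_def
  proof (intro allI impI)
    fix \<epsilon> :: real assume \<epsilon>: "\<epsilon> > 0"
    have "\<exists>\<gamma>. gauge \<gamma> \<and> (\<forall>p. p tagged_partial_division_of {a..b} \<and> \<gamma> fine p \<and> fst ` p \<subseteq> S n \<longrightarrow>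
        (\<Sum>(x, K)\<in>p. \<bar>F (Sup K) - F (Inf K)\<bar>) \<le> \<epsilon> * (1 / 2) ^ Suc n)" for n
    proof (rule null[unfolded null_variation_def, rule_format])
      show "S n \<in> \<S>" using S by blast
      show "0 < \<epsilon> * (1 / 2) ^ Suc n" using \<epsilon> by simp
    qed
    then obtain \<gamma> where \<gamma>: "\<And>n. gauge (\<gamma> n)"
      "\<And>n p. p tagged_partial_division_of {a..b} \<Longrightarrow> \<gamma> n fine p \<Longrightarrow> fst ` p \<subseteq> S n \<Longrightarrow>
        (\<Sum>(x, K)\<in>p. \<bar>F (Sup K) - F (Inf K)\<bar>) \<le> \<epsilon> * (1 / 2) ^ Suc n"
      by metis
    define m where "m x = (LEAST n. x \<in> S n)" for x
    have m: "x \<in> S (m x)" if "x \<in> \<Union>\<S>" for x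
      using that S unfolding m_def by (metis LeastI UN_E)
    show "\<exists>\<gamma>. gauge \<gamma> \<and> (\<forall>p. p tagged_partial_division_of {a..b} \<and> \<gamma> fine p \<and> fst ` p \<subseteq> \<Union>\<S> \<longrightarrow>
        (\<Sum>(x, K)\<in>p. \<bar>F (Sup K) - F (Inf K)\<bar>) \<le> \<epsilon>)"
    proof (intro exI conjI allI impI; (elim conjE)?)
      show "gauge (\<lambda>x. \<gamma> (m x) x)" using \<gamma>(1) by (auto simp: gauge_def)
      fix p assume p: "p tagged_partial_division_of {a..b}" "(\<lambda>x. \<gamma> (m x) x) fine p" "fst ` p \<subseteq> \<Union>\<S>"
      have fin: "finite p" using p(1) by (simp add: tagged_partial_division_of_def)
      define M where "M = m ` fst ` p"
      have "(\<Sum>(x, K)\<in>p. \<bar>F (Sup K) - F (Inf K)\<bar>)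
          = (\<Sum>n\<in>M. \<Sum>(x, K)\<in>{q\<in>p. m (fst q) = n}. \<bar>F (Sup K) - F (Inf K)\<bar>)"
        using fin by (intro sum.group[symmetric]) (auto simp: M_def)
      also have "\<dots> \<le> (\<Sum>n\<in>M. \<epsilon> * (1 / 2) ^ Suc n)"
      proof (rule sum_mono)
        fix n
        show "(\<Sum>(x, K)\<in>{q\<in>p. m (fst q) = n}. \<bar>F (Sup K) - F (Inf K)\<bar>) \<le> \<epsilon> * (1 / 2) ^ Suc n"
        proof (rule \<gamma>(2))
          show "{q\<in>p. m (fst q) = n} tagged_partial_division_of {a..b}"
            using p(1) by (rule tagged_partial_division_subset) auto
          show "\<gamma> n fine {q\<in>p. m (fst q) = n}" using p(2) by (auto simp: fine_def)
          show "fst ` {q\<in>p. m (fst q) = n} \<subseteq> S n" using p(3) m by blast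
        qed
      qed
      also have "\<dots> = \<epsilon> * (\<Sum>n\<in>M. (1 / 2) ^ Suc n)" by (simp add: sum_distrib_left)
      also have "\<dots> \<le> \<epsilon> * 1"
      proof (intro mult_left_mono)
        have "(\<Sum>n\<in>M. (1 / 2) ^ Suc n) \<le> (\<Sum>n. (1 / 2 :: real) ^ Suc n)"
          using fin power_half_series by (intro sum_le_suminf) (auto simp: M_def sums_iff)
        then show "(\<Sum>n\<in>M. (1 / 2) ^ Suc n) \<le> (1 :: real)"
          using power_half_series by (simp add: sums_iff)
      qed (use \<epsilon> in simp)
      finally show "(\<Sum>(x, K)\<in>p. \<bar>F (Sup K) - F (Inf K)\<bar>) \<le> \<epsilon>" by simp
    qed
  qed
qed

lemma sum_le_of_unique:
  fixes f :: "'b \<Rightarrow> real"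
  assumes "\<And>i j. i \<in> P \<Longrightarrow> j \<in> P \<Longrightarrow> i = j" "\<And>i. i \<in> P \<Longrightarrow> f i \<le> e" "0 \<le> e"
  shows "sum f P \<le> e"
proof (cases "P = {}")
  case False
  then obtain i where "i \<in> P" by blast
  then have "P = {i}" using assms(1) by blast
  then show ?thesis using assms(2) by simp
qed (use assms in simp)

text \<open>
  Only one interval of a division continues to the right of \<open>x\<close>, and only one to the left.
\<close>

lemma null_variation_singleton:
  assumes F: "continuous_on {a..b} F" and x: "x \<in> {a..b}"
  shows "null_variation F a b {x}"
  unfolding null_variation_def
proof (intro allI impI)
  fix \<epsilon> :: real assume "\<epsilon> > 0"
  then obtain d where d: "d > 0" "\<And>y. y \<in> {a..b} \<Longrightarrow> dist y x < d \<Longrightarrow> dist (F y) (F x) < \<epsilon> / 2"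
    using F x unfolding continuous_on_iff by (metis half_gt_zero)
  show "\<exists>\<gamma>. gauge \<gamma> \<and> (\<forall>p. p tagged_partial_division_of {a..b} \<and> \<gamma> fine p \<and> fst ` p \<subseteq> {x} \<longrightarrow>
      (\<Sum>(x, K)\<in>p. \<bar>F (Sup K) - F (Inf K)\<bar>) \<le> \<epsilon>)"
  proof (intro exI conjI allI impI; (elim conjE)?)
    show "gauge (\<lambda>x. ball x d)" using d(1) by (rule gauge_ball)
    fix p assume p: "p tagged_partial_division_of {a..b}" "(\<lambda>x. ball x d) fine p" "fst ` p \<subseteq> {x}"
    have tag: "fst q = x" if "q \<in> p" for q using p(3) that by auto
    note int = tagged_partial_division_interval[OF p(1)]
    have near: "\<bar>F y - F x\<bar> \<le> \<epsilon> / 2" if "(x, K) \<in> p" "y \<in> {Inf K, Sup K}" for K y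
    proof -
      have "y \<in> K" using that int[OF that(1)] by auto
      then have "dist y x < d" using fineD[OF p(2) that(1)] by (auto simp: dist_commute)
      moreover have "y \<in> {a..b}" using int[OF that(1)] that(2) by auto
      ultimately show ?thesis using d(2)[of y] by (simp add: dist_real_def)
    qed
    have uniq: "q = r" if "q \<in> p" "r \<in> p" "y \<in> {Inf (snd q)<..<Sup (snd q)}" "y \<in> {Inf (snd r)<..<Sup (snd r)}" for q r y
      using tagged_partial_division_disjoint[OF p(1) that(1,2)] that(3,4) by blast
    have ends: "Inf (snd q) \<le> x" "x \<le> Sup (snd q)" if "q \<in> p" for q
      using int(2,3)[of x "snd q"] tag[OF that] that by (cases q; auto)+
    have "(\<Sum>q\<in>{q\<in>p. fst q < Sup (snd q)}. \<bar>F (Sup (snd q)) - F (fst q)\<bar>) \<le> \<epsilon> / 2"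
    proof (rule sum_le_of_unique)
      fix q r assume qr: "q \<in> {q\<in>p. fst q < Sup (snd q)}" "r \<in> {q\<in>p. fst q < Sup (snd q)}"
      define y where "y = (x + min (Sup (snd q)) (Sup (snd r))) / 2"
      show "q = r"
        by (rule uniq[of q r y]) (use qr ends[of q] ends[of r] tag[of q] tag[of r] in
            \<open>auto simp: y_def min_def\<close>)
    next
      fix q assume "q \<in> {q\<in>p. fst q < Sup (snd q)}"
      then show "\<bar>F (Sup (snd q)) - F (fst q)\<bar> \<le> \<epsilon> / 2"
        using near[of "snd q" "Sup (snd q)"] tag[of q] by (cases q) auto
    qed (use \<open>\<epsilon> > 0\<close> in simp)
    moreover have "(\<Sum>q\<in>{q\<in>p. Inf (snd q) < fst q}. \<bar>F (Inf (snd q)) - F (fst q)\<bar>) \<le> \<epsilon> / 2"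
    proof (rule sum_le_of_unique)
      fix q r assume qr: "q \<in> {q\<in>p. Inf (snd q) < fst q}" "r \<in> {q\<in>p. Inf (snd q) < fst q}"
      define y where "y = (x + max (Inf (snd q)) (Inf (snd r))) / 2"
      show "q = r"
        by (rule uniq[of q r y]) (use qr ends[of q] ends[of r] tag[of q] tag[of r] in
            \<open>auto simp: y_def max_def\<close>)
    next
      fix q assume "q \<in> {q\<in>p. Inf (snd q) < fst q}"
      then show "\<bar>F (Inf (snd q)) - F (fst q)\<bar> \<le> \<epsilon> / 2"
        using near[of "snd q" "Inf (snd q)"] tag[of q] by (cases q) auto
    qed (use \<open>\<epsilon> > 0\<close> in simp)
    ultimately show "(\<Sum>(x, K)\<in>p. \<bar>F (Sup K) - F (Inf K)\<bar>) \<le> \<epsilon>"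
      using variation_split[OF p(1), of F] by linarith
  qed
qed

text \<open>
  A null set has open neighbourhoods of arbitrarily small measure, and the measure bounds the total
  length of a non-overlapping family in the neighbourhood.
\<close>

lemma AC_star_open_cover:
  assumes AC: "AC_star F T" and N: "negligible N" and \<epsilon>: "\<epsilon> > 0"
  obtains G where "open G" "N \<subseteq> G"
    "\<And>I. nonoverlapping_on T I \<Longrightarrow> (\<And>c d. (c, d) \<in> I \<Longrightarrow> {c<..<d} \<subseteq> G) \<Longrightarrow>
      (\<Sum>(c, d)\<in>I. oscillation F c d) < ereal \<epsilon>"
proof -
  obtain e where e: "e > 0" "\<And>I. nonoverlapping_on T I \<Longrightarrow> (\<Sum>(c, d)\<in>I. d - c) < e \<Longrightarrow>
      (\<Sum>(c, d)\<in>I. oscillation F c d) < ereal \<epsilon>"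
    using AC \<epsilon> unfolding AC_star_alt by meson
  have "N \<in> lmeasurable" "measure lebesgue N = 0" using N by (auto simp: negligible_iff_measure)
  then obtain G where G: "open G" "N \<subseteq> G" "G \<in> lmeasurable" "measure lebesgue G < e"
    using lmeasurable_outer_open[of N e] e(1) by auto
  have len: "(\<Sum>(c, d)\<in>I. d - c) < e"
    if I: "nonoverlapping_on T I" and sub: "\<And>c d. (c, d) \<in> I \<Longrightarrow> {c<..<d} \<subseteq> G" for I
  proof -
    have fin: "finite I" and disj: "pairwise (\<lambda>(c, d) (c', d'). {c<..<d} \<inter> {c'<..<d'} = {}) I"
      using I by (auto simp: nonoverlapping_on_def)
    have "(\<Sum>(c, d)\<in>I. d - c) = (\<Sum>i\<in>I. measure lebesgue (case i of (c, d) \<Rightarrow> {c<..<d}))"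
      using I by (intro sum.cong) (auto simp: nonoverlapping_on_def)
    also have "\<dots> = measure lebesgue (\<Union>i\<in>I. case i of (c, d) \<Rightarrow> {c<..<d})"
    proof (rule measure_UNION'[symmetric, OF fin])
      show "pairwise (\<lambda>i j. disjnt (case i of (c, d) \<Rightarrow> {c<..<d}) (case j of (c, d) \<Rightarrow> {c<..<d})) I"
        by (rule pairwise_mono[OF disj]) (auto simp: disjnt_def)
    qed (auto simp: case_prod_beta)
    also have "\<dots> \<le> measure lebesgue G"
    proof (rule measure_mono_fmeasurable)
      show "(\<Union>i\<in>I. case i of (c, d) \<Rightarrow> {c<..<d}) \<subseteq> G" using sub by blast
      show "(\<Union>i\<in>I. case i of (c, d) \<Rightarrow> {c<..<d}) \<in> sets lebesgue"
        using fin by (intro sets.finite_UN) (auto simp: case_prod_beta)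
    qed (rule G(3))
    finally show ?thesis using G(4) by simp
  qed
  show ?thesis
  proof (rule that[OF G(1,2)])
    fix I assume I: "nonoverlapping_on T I" and sub: "\<And>c d. (c, d) \<in> I \<Longrightarrow> {c<..<d} \<subseteq> G"
    show "(\<Sum>(c, d)\<in>I. oscillation F c d) < ereal \<epsilon>" by (rule e(2)[OF I len[OF I sub]])
  qed
qed

text \<open>
  The points \<open>d i\<close> need not belong to \<open>T\<close>, so the hypothesis on oscillations does not apply to the
  intervals from \<open>t i\<close> to \<open>d i\<close>.  It does apply if \<open>d i\<close> is moved to the right until the next tag or
  \<open>s i\<close> is reached, whichever comes first: the enlarged intervals have end points in \<open>T\<close>, do not
  overlap, and stay in \<open>G\<close>.
\<close>

lemma variation_right_of_tags:
  fixes t d s :: "'b \<Rightarrow> real"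
  assumes fin: "finite P"
    and osc: "\<And>I. nonoverlapping_on T I \<Longrightarrow> (\<And>c d. (c, d) \<in> I \<Longrightarrow> {c<..<d} \<subseteq> G) \<Longrightarrow>
      (\<Sum>(c, d)\<in>I. oscillation F c d) < ereal \<epsilon>"
    and P: "\<And>i. i \<in> P \<Longrightarrow> t i \<in> T \<and> s i \<in> T \<and> t i < d i \<and> d i < s i \<and> {t i<..<s i} \<subseteq> G"
    and disj: "\<And>i j. i \<in> P \<Longrightarrow> j \<in> P \<Longrightarrow> i \<noteq> j \<Longrightarrow> {t i<..<d i} \<inter> {t j<..<d j} = {}"
  shows "(\<Sum>i\<in>P. \<bar>F (d i) - F (t i)\<bar>) < \<epsilon>"
proof -
  have next_tag: "d i \<le> t j" if "i \<in> P" "j \<in> P" "t i \<le> t j" "i \<noteq> j" for i j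
  proof (rule ccontr)
    assume "\<not> d i \<le> t j"
    moreover have "t j < d j" using P that by blast
    ultimately have "(t j + min (d i) (d j)) / 2 \<in> {t i<..<d i} \<inter> {t j<..<d j}"
      using that(3) by (auto simp: min_def)
    then show False using disj[OF that(1,2,4)] by blast
  qed
  define z where "z i = Min (insert (s i) {t j | j. j \<in> P \<and> t i < t j})" for i
  have finz: "finite {t j | j. j \<in> P \<and> t i < t j}" for i using fin by simp
  have z: "d i \<le> z i" "z i \<le> s i" "z i \<in> T" if i: "i \<in> P" for i
  proof -
    have "d i < s i" using P[OF i] by blast
    moreover have "d i \<le> t j" if "j \<in> P" "t i < t j" for j using next_tag[OF i that(1)] that by auto
    ultimately show "d i \<le> z i" unfolding z_def using finz by (subst Min_ge_iff) auto
    show "z i \<le> s i" unfolding z_def using finz by (intro Min_le) auto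
    have "z i \<in> insert (s i) {t j | j. j \<in> P \<and> t i < t j}" unfolding z_def using finz by (intro Min_in) auto
    then show "z i \<in> T" using P i by auto
  qed
  have z_next: "z i \<le> t j" if "i \<in> P" "j \<in> P" "t i < t j" for i j
    unfolding z_def using finz that by (intro Min_le) auto
  have tz: "t i < z i" if "i \<in> P" for i using z(1)[OF that] P[OF that] by linarith
  have inj: "inj_on t P"
  proof (rule inj_onI, rule ccontr)
    fix i j assume "i \<in> P" "j \<in> P" "t i = t j" "i \<noteq> j"
    then have "d i \<le> t j" by (intro next_tag) auto
    then show False using P[OF \<open>i \<in> P\<close>] \<open>t i = t j\<close> by auto
  qed
  define I where "I = (\<lambda>i. (t i, z i)) ` P"
  have injI: "inj_on (\<lambda>i. (t i, z i)) P" using inj by (auto simp: inj_on_def)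
  have "nonoverlapping_on T I"
    unfolding nonoverlapping_on_def
  proof (intro conjI)
    show "finite I" using fin by (simp add: I_def)
    show "\<forall>(c, d)\<in>I. c < d \<and> c \<in> T \<and> d \<in> T" using P z tz by (auto simp: I_def)
    show "pairwise (\<lambda>(c, d) (c', d'). {c<..<d} \<inter> {c'<..<d'} = {}) I"
      unfolding I_def pairwise_image
    proof (rule pairwiseI, intro impI)
      fix i j assume ij: "i \<in> P" "j \<in> P" "i \<noteq> j"
      then have "t i \<noteq> t j" using inj by (auto simp: inj_on_def)
      then have "z i \<le> t j \<or> z j \<le> t i" using z_next ij by (metis linorder_neqE_linordered_idom)
      then show "(\<lambda>(c, d) (c', d'). {c<..<d} \<inter> {c'<..<d'} = {}) (t i, z i) (t j, z j)" by auto
    qed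
  qed
  moreover have "{c<..<d} \<subseteq> G" if "(c, d) \<in> I" for c d
  proof -
    obtain i where i: "i \<in> P" "c = t i" "d = z i" using \<open>(c, d) \<in> I\<close> by (auto simp: I_def)
    have "{c<..<d} \<subseteq> {t i<..<s i}" using z(2)[OF i(1)] unfolding i(2,3) by auto
    then show ?thesis using P[OF i(1)] by blast
  qed
  ultimately have "(\<Sum>(c, d)\<in>I. oscillation F c d) < ereal \<epsilon>" by (rule osc)
  moreover have "(\<Sum>(c, d)\<in>I. oscillation F c d) = (\<Sum>i\<in>P. oscillation F (t i) (z i))"
    unfolding I_def by (simp add: sum.reindex[OF injI])
  moreover have "(\<Sum>i\<in>P. ereal \<bar>F (d i) - F (t i)\<bar>) \<le> (\<Sum>i\<in>P. oscillation F (t i) (z i))"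
  proof (rule sum_mono)
    fix i assume "i \<in> P"
    then show "ereal \<bar>F (d i) - F (t i)\<bar> \<le> oscillation F (t i) (z i)"
      using P[of i] z(1)[of i] tz[of i] by (intro oscillation_ge) auto
  qed
  ultimately have "(\<Sum>i\<in>P. ereal \<bar>F (d i) - F (t i)\<bar>) < ereal \<epsilon>" by (metis le_less_trans)
  then show ?thesis by (simp add: sum_ereal)
qed

lemma oscillation_uminus: "oscillation (\<lambda>x. F (- x)) c d = oscillation F (- d) (- c)"
proof -
  have le: "oscillation (\<lambda>x. F (- x)) c d \<le> oscillation F (- d) (- c)" for F c d
    unfolding oscillation_def[of "\<lambda>x. F (- x)"]
    by (rule Sup_least) (auto intro!: oscillation_ge)
  show ?thesis using le[of F c d] le[of "\<lambda>x. F (- x)" "- d" "- c"] by simp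
qed

lemma nonoverlapping_on_uminus:
  assumes "nonoverlapping_on (uminus ` T) I"
  shows "nonoverlapping_on T ((\<lambda>(c, d). (- d, - c)) ` I)"
  unfolding nonoverlapping_on_def
proof (intro conjI)
  show "finite ((\<lambda>(c, d). (- d, - c)) ` I)" using assms by (simp add: nonoverlapping_on_def)
  show "\<forall>(c, d)\<in>(\<lambda>(c, d). (- d, - c)) ` I. c < d \<and> c \<in> T \<and> d \<in> T"
    using assms by (fastforce simp: nonoverlapping_on_def)
  show "pairwise (\<lambda>(c, d) (c', d'). {c<..<d} \<inter> {c'<..<d'} = {}) ((\<lambda>(c, d). (- d, - c)) ` I)"
  proof (rule pairwiseI)
    fix i j assume ij: "i \<in> (\<lambda>(c, d). (- d, - c)) ` I" "j \<in> (\<lambda>(c, d). (- d, - c)) ` I" "i \<noteq> j"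
    then obtain c d c' d' where cd: "i = (- d, - c)" "j = (- d', - c')" "(c, d) \<in> I" "(c', d') \<in> I" "(c, d) \<noteq> (c', d')"
      by auto
    then have disj: "{c<..<d} \<inter> {c'<..<d'} = {}"
      using assms by (auto simp: nonoverlapping_on_def pairwise_def)
    have "y \<notin> {- d<..<- c} \<inter> {- d'<..<- c'}" for y
    proof
      assume "y \<in> {- d<..<- c} \<inter> {- d'<..<- c'}"
      then have "- y \<in> {c<..<d} \<inter> {c'<..<d'}" by auto
      then show False using disj by blast
    qed
    then show "(\<lambda>(c, d) (c', d'). {c<..<d} \<inter> {c'<..<d'} = {}) i j" unfolding cd prod.case by blast
  qed
qed

text \<open>
  This is the mirror image of the preceding lemma, obtained by reflecting \<open>F\<close> at the origin.
\<close>

lemma variation_left_of_tags: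
  fixes t d s :: "'b \<Rightarrow> real"
  assumes fin: "finite P"
    and osc: "\<And>I. nonoverlapping_on T I \<Longrightarrow> (\<And>c d. (c, d) \<in> I \<Longrightarrow> {c<..<d} \<subseteq> G) \<Longrightarrow>
      (\<Sum>(c, d)\<in>I. oscillation F c d) < ereal \<epsilon>"
    and P: "\<And>i. i \<in> P \<Longrightarrow> t i \<in> T \<and> s i \<in> T \<and> d i < t i \<and> s i < d i \<and> {s i<..<t i} \<subseteq> G"
    and disj: "\<And>i j. i \<in> P \<Longrightarrow> j \<in> P \<Longrightarrow> i \<noteq> j \<Longrightarrow> {d i<..<t i} \<inter> {d j<..<t j} = {}"
  shows "(\<Sum>i\<in>P. \<bar>F (d i) - F (t i)\<bar>) < \<epsilon>"
proof -
  have "(\<Sum>i\<in>P. \<bar>(\<lambda>x. F (- x)) (- d i) - (\<lambda>x. F (- x)) (- t i)\<bar>) < \<epsilon>"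
  proof (rule variation_right_of_tags[of P "uminus ` T" "uminus ` G" "\<lambda>x. F (- x)" \<epsilon> "\<lambda>i. - t i" "\<lambda>i. - s i" "\<lambda>i. - d i"])
    fix I assume I: "nonoverlapping_on (uminus ` T) I" and sub: "\<And>c d. (c, d) \<in> I \<Longrightarrow> {c<..<d} \<subseteq> uminus ` G"
    have "(\<Sum>(c, d)\<in>(\<lambda>(c, d). (- d, - c)) ` I. oscillation F c d) < ereal \<epsilon>"
    proof (rule osc[OF nonoverlapping_on_uminus[OF I]])
      fix c d assume "(c, d) \<in> (\<lambda>(c, d). (- d, - c)) ` I"
      then have "(- d, - c) \<in> I" by force
      then have s: "{- d<..<- c} \<subseteq> uminus ` G" by (rule sub)
      show "{c<..<d} \<subseteq> G"
      proof
        fix y assume "y \<in> {c<..<d}"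
        then have "- y \<in> uminus ` G" using s by (intro subsetD[OF s]) auto
        then show "y \<in> G" by auto
      qed
    qed
    moreover have inj: "inj_on (\<lambda>(c, d). (- d, - c :: real)) I" by (auto simp: inj_on_def)
    have "(\<Sum>(c, d)\<in>(\<lambda>(c, d). (- d, - c)) ` I. oscillation F c d) = (\<Sum>(c, d)\<in>I. oscillation F (- d) (- c))"
      by (subst sum.reindex[OF inj], rule sum.cong) auto
    ultimately show "(\<Sum>(c, d)\<in>I. oscillation (\<lambda>x. F (- x)) c d) < ereal \<epsilon>"
      by (simp add: oscillation_uminus)
  next
    fix i assume "i \<in> P"
    note Pi = P[OF this]
    have "{- t i<..<- s i} \<subseteq> uminus ` G"
    proof
      fix y assume "y \<in> {- t i<..<- s i}"
      then have "- y \<in> G" using Pi by auto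
      then show "y \<in> uminus ` G" by force
    qed
    then show "- t i \<in> uminus ` T \<and> - s i \<in> uminus ` T \<and> - t i < - d i \<and> - d i < - s i \<and> {- t i<..<- s i} \<subseteq> uminus ` G"
      using Pi by simp
  next
    fix i j assume ij: "i \<in> P" "j \<in> P" "i \<noteq> j"
    have "y \<notin> {- t i<..<- d i} \<inter> {- t j<..<- d j}" for y
    proof
      assume "y \<in> {- t i<..<- d i} \<inter> {- t j<..<- d j}"
      then have "- y \<in> {d i<..<t i} \<inter> {d j<..<t j}" by auto
      then show False using disj[OF ij] by blast
    qed
    then show "{- t i<..<- d i} \<inter> {- t j<..<- d j} = {}" by blast
  qed (rule fin)
  then show ?thesis by simp
qed

lemma countable_left_isolated:
  fixes T :: "real set"
  shows "countable {x\<in>T. \<exists>y<x. T \<inter> {y<..<x} = {}}"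
proof -
  have "{x\<in>T. \<exists>y<x. T \<inter> {y<..<x} = {}} \<subseteq> uminus ` {x\<in>uminus ` T. \<exists>y>x. uminus ` T \<inter> {x<..<y} = {}}"
  proof
    fix x assume "x \<in> {x\<in>T. \<exists>y<x. T \<inter> {y<..<x} = {}}"
    then obtain y where y: "x \<in> T" "y < x" "T \<inter> {y<..<x} = {}" by blast
    have "uminus ` T \<inter> {- x<..<- y} = {}" using y(3) by auto
    moreover have "- x \<in> uminus ` T" "- x < - y" using y(1,2) by auto
    ultimately have "- x \<in> {x\<in>uminus ` T. \<exists>y>x. uminus ` T \<inter> {x<..<y} = {}}" by blast
    then show "x \<in> uminus ` {x\<in>uminus ` T. \<exists>y>x. uminus ` T \<inter> {x<..<y} = {}}" by force
  qed
  then show ?thesis by (rule countable_subset) (intro countable_image countable_right_isolated)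
qed

text \<open>
  A tag \<open>x\<close> has points \<open>l x < x < r x\<close> of \<open>T\<close> so close to it that the interval between them lies in a
  small open neighbourhood of \<open>N\<close>.  A gauge that confines the intervals with tag \<open>x\<close> to the range from
  \<open>l x\<close> to \<open>r x\<close> provides what is needed to enlarge them to intervals with end points in \<open>T\<close>.
\<close>

lemma AC_star_null_variation:
  assumes AC: "AC_star F T" and N: "negligible N"
    and right: "\<And>x y. x \<in> T \<inter> N \<Longrightarrow> x < y \<Longrightarrow> T \<inter> {x<..<y} \<noteq> {}"
    and left: "\<And>x y. x \<in> T \<inter> N \<Longrightarrow> y < x \<Longrightarrow> T \<inter> {y<..<x} \<noteq> {}"
  shows "null_variation F a b (T \<inter> N)"
  unfolding null_variation_def
proof (intro allI impI)
  fix \<epsilon> :: real assume \<epsilon>: "\<epsilon> > 0"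
  then have "\<epsilon> / 2 > 0" by simp
  then obtain G where G: "open G" "N \<subseteq> G"
    "\<And>I. nonoverlapping_on T I \<Longrightarrow> (\<And>c d. (c, d) \<in> I \<Longrightarrow> {c<..<d} \<subseteq> G) \<Longrightarrow>
      (\<Sum>(c, d)\<in>I. oscillation F c d) < ereal (\<epsilon> / 2)"
    using AC_star_open_cover[OF AC N] by metis
  have "\<exists>l r. l \<in> T \<and> r \<in> T \<and> l < x \<and> x < r \<and> {l<..<r} \<subseteq> G" if x: "x \<in> T \<inter> N" for x
  proof -
    obtain e where e: "e > 0" "ball x e \<subseteq> G" using G x by (meson IntE openE subsetD)
    obtain l r where "l \<in> T" "x - e < l" "l < x" "r \<in> T" "x < r" "r < x + e"
      using right[OF x, of "x + e"] left[OF x, of "x - e"] e(1) by auto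
    moreover from this have "{l<..<r} \<subseteq> ball x e" by (auto simp: dist_real_def)
    ultimately show ?thesis using e(2) by blast
  qed
  then obtain l r where lr: "\<And>x. x \<in> T \<inter> N \<Longrightarrow> l x \<in> T \<and> r x \<in> T \<and> l x < x \<and> x < r x \<and> {l x<..<r x} \<subseteq> G"
    by metis
  define \<gamma> where "\<gamma> x = (if x \<in> T \<inter> N then {l x<..<r x} else UNIV)" for x
  show "\<exists>\<gamma>. gauge \<gamma> \<and> (\<forall>p. p tagged_partial_division_of {a..b} \<and> \<gamma> fine p \<and> fst ` p \<subseteq> T \<inter> N \<longrightarrow>
      (\<Sum>(x, K)\<in>p. \<bar>F (Sup K) - F (Inf K)\<bar>) \<le> \<epsilon>)"
  proof (intro exI conjI allI impI; (elim conjE)?)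
    show "gauge \<gamma>" using lr by (auto simp: gauge_def \<gamma>_def)
    fix p assume p: "p tagged_partial_division_of {a..b}" "\<gamma> fine p" "fst ` p \<subseteq> T \<inter> N"
    have fin: "finite p" using p(1) by (simp add: tagged_partial_division_of_def)
    have q: "fst q \<in> T \<inter> N" "l (fst q) < Inf (snd q)" "Sup (snd q) < r (fst q)"
        "Inf (snd q) \<le> fst q" "fst q \<le> Sup (snd q)" if "q \<in> p" for q
    proof -
      show tag: "fst q \<in> T \<inter> N" using p(3) that by blast
      show "Inf (snd q) \<le> fst q" "fst q \<le> Sup (snd q)"
        using tagged_partial_division_interval(2,3)[OF p(1), of "fst q" "snd q"] that by auto
      have "Inf (snd q) \<in> snd q" "Sup (snd q) \<in> snd q"
        using tagged_partial_division_interval(6,7)[OF p(1), of "fst q" "snd q"] that by auto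
      moreover have "snd q \<subseteq> \<gamma> (fst q)"
        using fineD[OF p(2), of "fst q" "snd q"] that by simp
      then have "snd q \<subseteq> {l (fst q)<..<r (fst q)}" using tag by (simp add: \<gamma>_def)
      ultimately show "l (fst q) < Inf (snd q)" "Sup (snd q) < r (fst q)" by auto
    qed
    note disj = tagged_partial_division_disjoint[OF p(1)]
    have "(\<Sum>q\<in>{q\<in>p. fst q < Sup (snd q)}. \<bar>F (Sup (snd q)) - F (fst q)\<bar>) < \<epsilon> / 2"
    proof (rule variation_right_of_tags[OF _ G(3), where s = "\<lambda>q. r (fst q)"])
      fix i assume i: "i \<in> {q\<in>p. fst q < Sup (snd q)}"
      then have "{fst i<..<r (fst i)} \<subseteq> {l (fst i)<..<r (fst i)}" using lr[OF q(1)[of i]] by auto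
      then show "fst i \<in> T \<and> r (fst i) \<in> T \<and> fst i < Sup (snd i) \<and> Sup (snd i) < r (fst i) \<and> {fst i<..<r (fst i)} \<subseteq> G"
        using i q[of i] lr[OF q(1)[of i]] by blast
    next
      fix i j assume ij: "i \<in> {q\<in>p. fst q < Sup (snd q)}" "j \<in> {q\<in>p. fst q < Sup (snd q)}" "i \<noteq> j"
      have "{fst i<..<Sup (snd i)} \<subseteq> {Inf (snd i)<..<Sup (snd i)}"
           "{fst j<..<Sup (snd j)} \<subseteq> {Inf (snd j)<..<Sup (snd j)}" using q(4)[of i] q(4)[of j] ij by auto
      then show "{fst i<..<Sup (snd i)} \<inter> {fst j<..<Sup (snd j)} = {}" using disj[of i j] ij by blast
    qed (use fin in auto)
    moreover have "(\<Sum>q\<in>{q\<in>p. Inf (snd q) < fst q}. \<bar>F (Inf (snd q)) - F (fst q)\<bar>) < \<epsilon> / 2"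
    proof (rule variation_left_of_tags[OF _ G(3), where s = "\<lambda>q. l (fst q)"])
      fix i assume i: "i \<in> {q\<in>p. Inf (snd q) < fst q}"
      then have "{l (fst i)<..<fst i} \<subseteq> {l (fst i)<..<r (fst i)}" using lr[OF q(1)[of i]] by auto
      then show "fst i \<in> T \<and> l (fst i) \<in> T \<and> Inf (snd i) < fst i \<and> l (fst i) < Inf (snd i) \<and> {l (fst i)<..<fst i} \<subseteq> G"
        using i q[of i] lr[OF q(1)[of i]] by blast
    next
      fix i j assume ij: "i \<in> {q\<in>p. Inf (snd q) < fst q}" "j \<in> {q\<in>p. Inf (snd q) < fst q}" "i \<noteq> j"
      have "{Inf (snd i)<..<fst i} \<subseteq> {Inf (snd i)<..<Sup (snd i)}"
           "{Inf (snd j)<..<fst j} \<subseteq> {Inf (snd j)<..<Sup (snd j)}" using q(5)[of i] q(5)[of j] ij by auto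
      then show "{Inf (snd i)<..<fst i} \<inter> {Inf (snd j)<..<fst j} = {}" using disj[of i j] ij by blast
    qed (use fin in auto)
    ultimately show "(\<Sum>(x, K)\<in>p. \<bar>F (Sup K) - F (Inf K)\<bar>) \<le> \<epsilon>"
      using variation_split[OF p(1), of F] by linarith
  qed
qed

text \<open>
  The points of a piece \<open>T\<close> that are isolated in \<open>T\<close> from one side are countably many, and they are
  treated as singletons.
\<close>

theorem ACG_star_null_variation:
  assumes F: "ACG_star F {a..b}" and N: "negligible N" "N \<subseteq> {a..b}"
  shows "null_variation F a b N"
proof -
  obtain \<T> where cont: "continuous_on {a..b} F" and \<T>: "countable \<T>" "\<Union>\<T> = {a..b}" "\<And>T. T \<in> \<T> \<Longrightarrow> AC_star F T"
    using F unfolding ACG_star_def by blast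
  have "null_variation F a b (T \<inter> N)" if T: "T \<in> \<T>" for T
  proof -
    define Z where "Z = {x\<in>T. \<exists>y>x. T \<inter> {x<..<y} = {}} \<union> {x\<in>T. \<exists>y<x. T \<inter> {y<..<x} = {}}"
    have Z: "countable Z" unfolding Z_def by (intro countable_Un countable_right_isolated countable_left_isolated)
    have "Z \<subseteq> {a..b}" using T \<T>(2) by (auto simp: Z_def)
    then have "null_variation F a b (\<Union>x\<in>Z. {x})"
      using Z cont by (intro null_variation_Union) (auto intro: null_variation_singleton)
    moreover have "null_variation F a b (T \<inter> (N - Z))"
    proof (rule AC_star_null_variation[OF \<T>(3)[OF T]])
      show "negligible (N - Z)" using N(1) by (rule negligible_subset) auto
    qed (auto simp: Z_def)
    ultimately have "null_variation F a b (\<Union>{\<Union>x\<in>Z. {x}, T \<inter> (N - Z)})"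
      by (intro null_variation_Union) auto
    then show ?thesis by (rule null_variation_subset) auto
  qed
  then have "null_variation F a b (\<Union>T\<in>\<T>. T \<inter> N)"
    using \<T>(1) by (intro null_variation_Union) auto
  then show ?thesis by (rule null_variation_subset) (use N(2) \<T>(2) in blast)
qed

text \<open>
  Tags outside \<open>N\<close> contribute an error proportional to the length of their intervals by the
  straddle argument.  For tags in \<open>N\<close> the Riemann sum vanishes, and the increments of \<open>F\<close> have a small
  sum.
\<close>

theorem fundamental_theorem_of_calculus_null_variation:
  fixes F f :: "real \<Rightarrow> real"
  assumes ab: "a \<le> b" and null: "null_variation F a b N"
    and der: "\<And>x. x \<in> {a..b} - N \<Longrightarrow> (F has_real_derivative f x) (at x within {a..b})"
    and zero: "\<And>x. x \<in> N \<Longrightarrow> f x = 0"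
  shows "(f has_integral (F b - F a)) {a..b}"
proof (cases "a = b")
  case True
  then show ?thesis by (auto intro: has_integral_refl)
next
  case False
  then have lt: "a < b" using ab by simp
  show ?thesis
    unfolding has_integral_factor_content_real
  proof (intro allI impI)
    fix e :: real assume e: "e > 0"
    define \<epsilon> where "\<epsilon> = e / 2"
    have \<epsilon>: "\<epsilon> > 0" using e by (simp add: \<epsilon>_def)
    have "\<epsilon> * (b - a) > 0" using \<epsilon> lt by simp
    then obtain \<gamma> where \<gamma>: "gauge \<gamma>"
      "\<And>p. p tagged_partial_division_of {a..b} \<Longrightarrow> \<gamma> fine p \<Longrightarrow> fst ` p \<subseteq> N \<Longrightarrow>
        (\<Sum>(x, K)\<in>p. \<bar>F (Sup K) - F (Inf K)\<bar>) \<le> \<epsilon> * (b - a)"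
      by (rule null_variationE[OF null]) (rule that)
    have "\<exists>d>0. x \<in> {a..b} - N \<longrightarrow> (\<forall>y\<in>{a..b}. \<bar>y - x\<bar> < d \<longrightarrow> \<bar>F y - F x - f x * (y - x)\<bar> \<le> \<epsilon> * \<bar>y - x\<bar>)" for x
    proof (cases "x \<in> {a..b} - N")
      case True
      then show ?thesis using der[OF True, unfolded has_real_derivative_alt, rule_format, OF \<epsilon>] by blast
    next
      case False
      then show ?thesis by (intro exI[of _ 1] conjI impI) (simp, blast)
    qed
    then obtain d where d: "\<And>x. d x > 0"
      "\<And>x y. x \<in> {a..b} - N \<Longrightarrow> y \<in> {a..b} \<Longrightarrow> \<bar>y - x\<bar> < d x \<Longrightarrow> \<bar>F y - F x - f x * (y - x)\<bar> \<le> \<epsilon> * \<bar>y - x\<bar>"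
      by metis
    show "\<exists>\<gamma>. gauge \<gamma> \<and> (\<forall>p. p tagged_division_of {a..b} \<and> \<gamma> fine p \<longrightarrow>
        norm ((\<Sum>(x, K)\<in>p. measure lborel K *\<^sub>R f x) - (F b - F a)) \<le> e * measure lborel {a..b})"
    proof (intro exI conjI allI impI; (elim conjE)?)
      show "gauge (\<lambda>x. \<gamma> x \<inter> ball x (d x))" using \<gamma>(1) d(1) by (intro gauge_Int gauge_ball_dependent) auto
      fix p assume p: "p tagged_division_of {a..b}" "(\<lambda>x. \<gamma> x \<inter> ball x (d x)) fine p"
      have pp: "p tagged_partial_division_of {a..b}" using p(1) by (simp add: tagged_division_of_def)
      have fin: "finite p" using pp by (simp add: tagged_partial_division_of_def)
      note int = tagged_partial_division_interval[OF pp]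
      define g where "g = (\<lambda>(x, K). measure lborel K *\<^sub>R f x - (F (Sup K) - F (Inf K)))"
      define p1 where "p1 = {q\<in>p. fst q \<in> N}"
      define p2 where "p2 = {q\<in>p. fst q \<notin> N}"
      have split: "sum h p = sum h p1 + sum h p2" for h :: "real \<times> real set \<Rightarrow> real"
      proof -
        have "p = p1 \<union> p2" "p1 \<inter> p2 = {}" "finite p1" "finite p2"
          using fin by (auto simp: p1_def p2_def)
        then show ?thesis by (metis sum.union_disjoint)
      qed
      have "norm (sum g p1) \<le> (\<Sum>(x, K)\<in>p1. \<bar>F (Sup K) - F (Inf K)\<bar>)"
        by (rule sum_norm_le) (auto simp: g_def p1_def zero)
      also have "\<dots> \<le> \<epsilon> * (b - a)"
      proof (rule \<gamma>(2))
        show "p1 tagged_partial_division_of {a..b}"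
          using pp by (rule tagged_partial_division_subset) (auto simp: p1_def)
        show "\<gamma> fine p1" using p(2) by (auto simp: fine_def p1_def)
      qed (auto simp: p1_def)
      finally have 1: "norm (sum g p1) \<le> \<epsilon> * (b - a)" .
      have "norm (sum g p2) \<le> (\<Sum>(x, K)\<in>p2. \<epsilon> * (Sup K - Inf K))"
      proof (rule sum_norm_le)
        fix q assume q: "q \<in> p2"
        obtain x K where xK: "q = (x, K)" by (cases q)
        have "(x, K) \<in> p" "x \<notin> N" using q xK by (auto simp: p2_def)
        note K = int(2-8)[OF this(1)]
        have xN: "x \<in> {a..b} - N" using \<open>x \<notin> N\<close> K(1-4) by auto
        have ends: "Inf K \<in> {a..b}" "Sup K \<in> {a..b}" using K(1-4) by auto
        have sub: "K \<subseteq> ball x (d x)" using fineD[OF p(2) \<open>(x, K) \<in> p\<close>] by simp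
        from K(5,6) have near: "\<bar>Inf K - x\<bar> < d x" "\<bar>Sup K - x\<bar> < d x"
          using sub by (auto simp: dist_real_def abs_minus_commute)
        have "\<bar>F (Inf K) - F x - f x * (Inf K - x)\<bar> \<le> \<epsilon> * (x - Inf K)"
          using d(2)[OF xN ends(1) near(1)] K(1) by simp
        moreover have "\<bar>F (Sup K) - F x - f x * (Sup K - x)\<bar> \<le> \<epsilon> * (Sup K - x)"
          using d(2)[OF xN ends(2) near(2)] K(2) by simp
        moreover have "measure lborel K *\<^sub>R f x - (F (Sup K) - F (Inf K)) =
            (F (Inf K) - F x - f x * (Inf K - x)) - (F (Sup K) - F x - f x * (Sup K - x))"
          unfolding K(7) by (simp add: algebra_simps)
        moreover have "\<epsilon> * (Sup K - Inf K) = \<epsilon> * (x - Inf K) + \<epsilon> * (Sup K - x)"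
          by (simp add: algebra_simps)
        ultimately show "norm (g q) \<le> (case q of (x, K) \<Rightarrow> \<epsilon> * (Sup K - Inf K))"
          unfolding xK g_def prod.case real_norm_def by linarith
      qed
      also have "\<dots> \<le> (\<Sum>(x, K)\<in>p. \<epsilon> * (Sup K - Inf K))"
      proof (rule sum_mono2[OF fin])
        fix q assume "q \<in> p - p2"
        then have "Inf (snd q) \<le> Sup (snd q)"
          using int(2)[of "fst q" "snd q"] int(3)[of "fst q" "snd q"] by auto
        then show "0 \<le> (case q of (x, K) \<Rightarrow> \<epsilon> * (Sup K - Inf K))"
          using \<epsilon> by (simp add: case_prod_beta)
      qed (auto simp: p2_def)
      also have "\<dots> = \<epsilon> * (\<Sum>(x, K)\<in>p. Sup K - Inf K)"
        by (simp add: sum_distrib_left case_prod_beta)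
      also have "(\<Sum>(x, K)\<in>p. Sup K - Inf K) = b - a"
        using additive_tagged_division_1[OF ab p(1), of "\<lambda>x. x"] by simp
      finally have 2: "norm (sum g p2) \<le> \<epsilon> * (b - a)" .
      have "(\<Sum>(x, K)\<in>p. measure lborel K *\<^sub>R f x) - (F b - F a) = sum g p"
        using additive_tagged_division_1[OF ab p(1), of F]
        by (simp add: g_def case_prod_beta sum_subtractf)
      also have "norm (sum g p) \<le> \<epsilon> * (b - a) + \<epsilon> * (b - a)"
        unfolding split[of g] using 1 2 by (rule norm_triangle_mono)
      finally show "norm ((\<Sum>(x, K)\<in>p. measure lborel K *\<^sub>R f x) - (F b - F a)) \<le> e * measure lborel {a..b}"
        using ab by (simp add: \<epsilon>_def)
    qed
  qed
qed

corollary ACG_star_has_integral_deriv: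
  assumes "a \<le> b" and F: "ACG_star F {a..b}"
  shows "((\<lambda>x. if F differentiable at x then deriv F x else 0) has_integral (F b - F a)) {a..b}"
proof (rule fundamental_theorem_of_calculus_null_variation[OF assms(1)])
  show "null_variation F a b {x\<in>{a..b}. \<not> F differentiable at x}"
    using F by (intro ACG_star_null_variation ACG_star_differentiable_AE) auto
  fix x assume "x \<in> {a..b} - {x\<in>{a..b}. \<not> F differentiable at x}"
  then have "F differentiable at x" by blast
  then have "(F has_real_derivative deriv F x) (at x)"
    by (auto simp: real_differentiable_def DERIV_imp_deriv)
  then show "(F has_real_derivative (if F differentiable at x then deriv F x else 0)) (at x within {a..b})"
    using \<open>F differentiable at x\<close> by (simp add: has_field_derivative_at_within)
qed auto

section \<open>Ekeland's variational principle\<close>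

lemma lsc_limit_le:
  fixes f :: "'a::topological_space \<Rightarrow> ereal"
  assumes lsc: "f z \<le> Liminf (nhds z) f" and x: "x \<longlonglongrightarrow> z"
    and le: "\<And>n. f (x n) \<le> ereal (c n)" and c: "c \<longlonglongrightarrow> L"
  shows "f z \<le> ereal L"
proof (rule ccontr)
  assume "\<not> f z \<le> ereal L"
  then obtain r where r: "ereal L < ereal r" "ereal r < f z"
    using ereal_dense2[of "ereal L" "f z"] by (auto simp: not_le)
  have "eventually (\<lambda>y. ereal r < f y) (nhds z)"
    using less_LiminfD[of "ereal r" "nhds z" f] r lsc by auto
  then have "eventually (\<lambda>n. ereal r < f (x n)) sequentially"
    using x by (rule eventually_compose_filterlim)
  moreover have "eventually (\<lambda>n. c n < r) sequentially"
    using c r(1) by (auto intro: order_tendstoD)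
  ultimately have "eventually (\<lambda>n. False) sequentially"
  proof eventually_elim
    case (elim n)
    have "ereal r < ereal (c n)" using elim(1) le[of n] by (rule less_le_trans)
    then show False using elim(2) by simp
  qed
  then show False by simp
qed

text \<open>
  Let \<open>T x\<close> be the set of points to which \<open>f\<close> descends from \<open>x\<close> with slope at least \<open>e\<close>.  These sets
  decrease along a sequence of almost minimal choices \<open>x (Suc n) \<in> T (x n)\<close>, and their diameters tend
  to zero because \<open>f\<close> is bounded from below.  The limit \<open>z\<close> is then the only point of \<open>T z\<close>.
\<close>

theorem ekeland:
  fixes f :: "'a::complete_space \<Rightarrow> ereal"
  assumes C: "closed C" and lsc: "\<And>x. x \<in> C \<Longrightarrow> f x \<le> Liminf (nhds x) f"
    and lb: "\<And>x. x \<in> C \<Longrightarrow> ereal m \<le> f x"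
    and x0: "x0 \<in> C" "f x0 < \<infinity>" and e: "e > 0"
  obtains z where "z \<in> C" "f z + ereal (e * dist z x0) \<le> f x0"
    "\<And>y. y \<in> C \<Longrightarrow> f z \<le> f y + ereal (e * dist y z)"
proof -
  define h where "h x = real_of_ereal (f x)" for x
  define S where "S = {x \<in> C. f x < \<infinity>}"
  have fh: "f x = ereal (h x)" if "x \<in> S" for x
    using that lb[of x] unfolding h_def S_def by (cases "f x") auto
  have hm: "m \<le> h x" if "x \<in> S" for x
    using that lb[of x] fh[of x] unfolding S_def by auto
  define T where "T x = {y \<in> S. h y + e * dist y x \<le> h x}" for x
  have T_refl: "x \<in> T x" if "x \<in> S" for x using that unfolding T_def by auto
  have T_trans: "z \<in> T x" if "y \<in> T x" "z \<in> T y" for x y z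
  proof -
    have "e * dist z x \<le> e * (dist z y + dist y x)"
      using e by (intro mult_left_mono dist_triangle) auto
    then show ?thesis using that unfolding T_def by (auto simp: algebra_simps)
  qed
  have "\<exists>y. (y \<in> S \<and> y \<in> T x) \<and> (\<forall>z\<in>T x. h y \<le> h z + (1/2)^n)" if "x \<in> S" for x n
  proof -
    have ne: "h ` T x \<noteq> {}" using T_refl[OF that] by auto
    have bd: "bdd_below (h ` T x)" by (rule bdd_belowI2[of _ m]) (auto simp: T_def hm)
    have "Inf (h ` T x) < Inf (h ` T x) + (1/2)^n" by simp
    then obtain y where y: "y \<in> T x" "h y < Inf (h ` T x) + (1/2)^n"
      using cInf_less_iff[OF ne bd] by blast
    have "h y \<le> h z + (1/2)^n" if "z \<in> T x" for z
      using cInf_lower[OF imageI[OF that] bd] y(2) by linarith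
    then show ?thesis using y by (auto simp: T_def)
  qed
  then have ex: "\<exists>y. y \<in> S \<and> (y \<in> T x \<and> (\<forall>z\<in>T x. h y \<le> h z + (1/2)^n))" if "x \<in> S" for x n
    using that by blast
  have x0S: "x0 \<in> S" using x0 by (simp add: S_def)
  obtain x where x: "\<And>n. x n \<in> S" "x 0 = x0" "\<And>n. x (Suc n) \<in> T (x n)"
      "\<And>n z. z \<in> T (x n) \<Longrightarrow> h (x (Suc n)) \<le> h z + (1/2)^n"
  proof -
    have "\<exists>x. \<forall>n. (x n \<in> S \<and> (n = 0 \<longrightarrow> x n = x0)) \<and>
        (x (Suc n) \<in> T (x n) \<and> (\<forall>z\<in>T (x n). h (x (Suc n)) \<le> h z + (1/2)^n))"
      by (rule dependent_nat_choice[where P = "\<lambda>n y. y \<in> S \<and> (n = 0 \<longrightarrow> y = x0)"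
            and Q = "\<lambda>n y y'. y' \<in> T y \<and> (\<forall>z\<in>T y. h y' \<le> h z + (1/2)^n)"])
        (use ex x0S in auto)
    then obtain x where "\<forall>n. (x n \<in> S \<and> (n = 0 \<longrightarrow> x n = x0)) \<and>
        (x (Suc n) \<in> T (x n) \<and> (\<forall>z\<in>T (x n). h (x (Suc n)) \<le> h z + (1/2)^n))" ..
    then show ?thesis using that[of x] by blast
  qed
  have chain: "x (n + k) \<in> T (x n)" for n k
    by (induction k) (use x T_refl T_trans in \<open>auto\<close>)
  have far: "e * dist y (x (Suc n)) \<le> (1/2)^n" if "y \<in> T (x (Suc n))" for y n
  proof -
    have "y \<in> T (x n)" using that x(3) T_trans by blast
    then have "h (x (Suc n)) \<le> h y + (1/2)^n" by (rule x(4))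
    then show ?thesis using that unfolding T_def by auto
  qed
  have null: "(\<lambda>n. (1/2)^n / e) \<longlonglongrightarrow> (0::real)"
    using tendsto_divide_zero[OF LIMSEQ_power_zero[of "1/2::real"], of e] by simp
  have "Cauchy x"
  proof (rule metric_CauchyI)
    fix d :: real assume d: "d > 0"
    obtain n where n: "(1/2)^n / e < d/2"
      using order_tendstoD(2)[OF null, of "d/2"] d by (auto simp: eventually_sequentially)
    have "dist (x k) (x (Suc n)) < d/2" if "k \<ge> Suc n" for k
    proof -
      have "e * dist (x k) (x (Suc n)) \<le> (1/2)^n"
        using chain[of "Suc n" "k - Suc n"] that by (intro far) auto
      then have "dist (x k) (x (Suc n)) \<le> (1/2)^n / e" using e by (simp add: field_simps)
      then show ?thesis using n by linarith
    qed
    then show "\<exists>M. \<forall>i\<ge>M. \<forall>j\<ge>M. dist (x i) (x j) < d"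
      by (meson dist_triangle_half_l)
  qed
  then obtain z where z: "x \<longlonglongrightarrow> z" using Cauchy_convergent convergent_def by blast
  have zC: "z \<in> C"
    using C z x(1) by (rule_tac closed_sequentially[of C x]) (auto simp: S_def)
  have zle: "f z \<le> ereal (h (x n) - e * dist z (x n))" for n
  proof (rule lsc_limit_le[OF lsc[OF zC]])
    show "(\<lambda>k. x (n + k)) \<longlonglongrightarrow> z" using LIMSEQ_ignore_initial_segment[OF z, of n] by (simp add: add.commute)
    then show "(\<lambda>k. h (x n) - e * dist (x (n + k)) (x n)) \<longlonglongrightarrow> h (x n) - e * dist z (x n)"
      by (intro tendsto_intros)
    show "f (x (n + k)) \<le> ereal (h (x n) - e * dist (x (n + k)) (x n))" for k
      using chain[of n k] fh[of "x (n+k)"] unfolding T_def by auto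
  qed
  have zS: "z \<in> S" using zC zle[of 0] by (auto simp: S_def)
  have zT: "z \<in> T (x n)" for n
    using zS zle[of n] fh[OF zS] by (auto simp: T_def)
  have only: "y = z" if "y \<in> T z" for y
  proof -
    have "dist y (x (Suc n)) \<le> (1/2)^n / e" for n
      using far[OF T_trans[OF zT that], of n] e by (simp add: field_simps)
    then have "(\<lambda>n. dist y (x (Suc n))) \<longlonglongrightarrow> 0"
      by (intro tendsto_sandwich[OF _ _ tendsto_const null]) auto
    moreover have "(\<lambda>n. dist y (x (Suc n))) \<longlonglongrightarrow> dist y z"
      by (intro tendsto_intros LIMSEQ_Suc z)
    ultimately have "dist y z = 0" by (rule LIMSEQ_unique[symmetric])
    then show ?thesis by simp
  qed
  show ?thesis
  proof
    show "z \<in> C" by fact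
    show "f z + ereal (e * dist z x0) \<le> f x0"
      using zT[of 0] x(2) fh[OF zS] fh[OF x0S] by (simp add: T_def)
    fix y assume y: "y \<in> C"
    show "f z \<le> f y + ereal (e * dist y z)"
    proof (rule ccontr)
      assume n: "\<not> ?thesis"
      then have "f y < \<infinity>" by (cases "f y") auto
      then have yS: "y \<in> S" using y by (simp add: S_def)
      then have "y \<in> T z" using n fh[OF zS] fh[OF yS] zS by (auto simp: T_def)
      then have "y = z" by (rule only)
      then show False using n fh[OF zS] by simp
    qed
  qed
qed


section \<open>Radial subderivatives near points with a large Clarke subderivative\<close>

lemma lsc_proper_eventually_less:
  assumes "lsc_proper f" "r < f x"
  shows "eventually (\<lambda>y. r < f y) (nhds x)"
proof (rule less_LiminfD)
  have "f x \<le> Liminf (nhds x) f" using assms(1) by (simp add: lsc_proper_def)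
  with assms(2) show "r < Liminf (nhds x) f" by (rule less_le_trans)
qed

lemma lsc_proper_finite:
  assumes "lsc_proper f" "x \<in> effdom f"
  obtains r where "f x = ereal r"
  using assms by (cases "f x") (auto simp: lsc_proper_def effdom_def)

lemma difference_quotient_gt:
  fixes a :: ereal
  assumes "t > 0" "ereal l < (a - ereal r) / ereal t"
  shows "ereal (r + l * t) < a"
  using assms by (cases a) (auto simp: field_simps)

lemma difference_quotient_ge:
  fixes a :: ereal
  assumes "t > 0" "ereal (r + l * t) \<le> a"
  shows "ereal l \<le> (a - ereal r) / ereal t"
  using assms by (cases a) (auto simp: field_simps)

text \<open>
  The number \<open>\<tau>\<close> is the last parameter at which \<open>f\<close> does not lie above the line of slope \<open>l\<close> through its
  value at \<open>x\<close>; from there on \<open>f\<close> grows at least as fast as the line.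
\<close>

theorem radial_subderiv_mean_value:
  fixes f :: "'a::real_normed_vector \<Rightarrow> ereal"
  assumes f: "lsc_proper f" and x: "f x = ereal r" and s: "s > 0"
    and gt: "ereal (r + l * s) < f (x + s *\<^sub>R w)"
  obtains \<tau> where "0 \<le> \<tau>" "\<tau> < s"
    "\<And>k. k > 0 \<Longrightarrow> ereal (k * l) \<le> radial_subderiv f (x + \<tau> *\<^sub>R w) (k *\<^sub>R w)"
proof -
  define A where "A = {\<tau>\<in>{0..s}. f (x + \<tau> *\<^sub>R w) \<le> ereal (r + l * \<tau>)}"
  have "closed A"
    unfolding closed_sequential_limits
  proof (intro allI impI, elim conjE)
    fix t \<tau> assume t: "\<forall>n. t n \<in> A" "t \<longlonglongrightarrow> \<tau>"
    have "\<tau> \<in> {0..s}"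
      using t by (rule_tac closed_sequentially[of "{0..s}" t]) (auto simp: A_def)
    moreover have "f (x + \<tau> *\<^sub>R w) \<le> ereal (r + l * \<tau>)"
    proof (rule lsc_limit_le[where x = "\<lambda>n. x + t n *\<^sub>R w" and c = "\<lambda>n. r + l * t n"])
      show "f (x + \<tau> *\<^sub>R w) \<le> Liminf (nhds (x + \<tau> *\<^sub>R w)) f"
        using f by (simp add: lsc_proper_def)
      show "(\<lambda>n. x + t n *\<^sub>R w) \<longlonglongrightarrow> x + \<tau> *\<^sub>R w" "(\<lambda>n. r + l * t n) \<longlonglongrightarrow> r + l * \<tau>"
        by (intro tendsto_intros t(2))+
      show "f (x + t n *\<^sub>R w) \<le> ereal (r + l * t n)" for n using t(1) by (simp add: A_def)
    qed
    ultimately show "\<tau> \<in> A" by (simp add: A_def)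
  qed
  moreover have "0 \<in> A" using x s by (simp add: A_def)
  moreover have bdd: "bdd_above A" by (rule bdd_aboveI[of _ s]) (simp add: A_def)
  ultimately have "Sup A \<in> A" by (intro closed_contains_Sup) auto
  moreover define \<tau> where "\<tau> = Sup A"
  ultimately have \<tau>: "0 \<le> \<tau>" "\<tau> \<le> s" "f (x + \<tau> *\<^sub>R w) \<le> ereal (r + l * \<tau>)" by (auto simp: A_def)
  have "\<tau> \<noteq> s" using \<tau>(3) gt by auto
  with \<tau>(2) have less: "\<tau> < s" by simp
  let ?c = "x + \<tau> *\<^sub>R w"
  have dom: "?c \<in> effdom f" using \<tau>(3) by (auto simp: effdom_def)
  then obtain q where q: "f ?c = ereal q" using lsc_proper_finite[OF f] by blast
  have q_le: "q \<le> r + l * \<tau>" using \<tau>(3) q by simp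
  have above: "ereal (q + l * \<sigma>) \<le> f (?c + \<sigma> *\<^sub>R w)" if "0 < \<sigma>" "\<sigma> \<le> s - \<tau>" for \<sigma>
  proof -
    have "\<tau> + \<sigma> \<notin> A"
      using cSup_upper[OF _ bdd, of "\<tau> + \<sigma>"] that by (auto simp: \<tau>_def)
    then have "ereal (r + l * (\<tau> + \<sigma>)) < f (x + (\<tau> + \<sigma>) *\<^sub>R w)"
      using that \<tau> by (auto simp: A_def)
    moreover have "ereal (q + l * \<sigma>) \<le> ereal (r + l * (\<tau> + \<sigma>))"
      using q_le by (simp add: algebra_simps)
    ultimately have "ereal (q + l * \<sigma>) < f (x + (\<tau> + \<sigma>) *\<^sub>R w)" by (metis le_less_trans)
    then show ?thesis by (simp add: scaleR_add_left add.assoc)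
  qed
  have "ereal (k * l) \<le> radial_subderiv f ?c (k *\<^sub>R w)" if k: "k > 0" for k
  proof -
    have "eventually (\<lambda>t. ereal (k * l) \<le> (f (?c + t *\<^sub>R k *\<^sub>R w) - f ?c) / ereal t) (at_right 0)"
      unfolding eventually_at_right_field
    proof (intro exI conjI allI impI)
      show "(s - \<tau>) / k > 0" using less k by simp
      fix t assume t: "0 < t" "t < (s - \<tau>) / k"
      have "ereal (q + l * (t * k)) \<le> f (?c + (t * k) *\<^sub>R w)"
        by (rule above) (use t k in \<open>auto simp: field_simps\<close>)
      then show "ereal (k * l) \<le> (f (?c + t *\<^sub>R k *\<^sub>R w) - f ?c) / ereal t"
        unfolding q using t by (intro difference_quotient_ge) (auto simp: mult_ac)
    qed
    then show ?thesis
      using dom by (simp add: radial_subderiv_def Liminf_bounded)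
  qed
  then show ?thesis using that \<tau>(1) less by blast
qed

text \<open>
  By definition of the Clarke subderivative there are \<open>y\<close> near \<open>x\<close> and a small \<open>t\<close> such that \<open>f\<close> grows with
  slope \<open>l\<close> from \<open>y\<close> to \<open>y + t *\<^sub>R w'\<close> for every \<open>w'\<close> close to \<open>u + \<alpha> *\<^sub>R (xb - x)\<close>.  The choice
  \<open>w' = u + \<alpha> *\<^sub>R (xb - y)\<close> makes \<open>u + \<alpha> *\<^sub>R (xb - c)\<close> at a point \<open>c = y + \<tau> *\<^sub>R w'\<close> of the segment equal
  to \<open>(1 - \<alpha> * \<tau>) *\<^sub>R w'\<close>, so the mean value inequality gives a radial subderivative of at least
  \<open>(1 - \<alpha> * \<tau>) * l\<close> there.
\<close>

theorem radial_subderiv_near_clarke_subderiv: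
  fixes f :: "'a::real_normed_vector \<Rightarrow> ereal"
  assumes f: "lsc_proper f" and \<alpha>: "\<alpha> \<ge> 0"
    and gt: "ereal l < clarke_subderiv f x (u + \<alpha> *\<^sub>R (xb - x))"
    and m: "m < l" and \<rho>: "\<rho> > 0"
  shows "\<exists>c. dist c x < \<rho> \<and> ereal m \<le> radial_subderiv f c (u + \<alpha> *\<^sub>R (xb - c))"
proof -
  define w where "w = u + \<alpha> *\<^sub>R (xb - x)"
  define G where "G = at_right (0::real) \<times>\<^sub>F filtercomap (\<lambda>x. (x, f x)) (nhds (x, f x))"
  have dom: "x \<in> effdom f"
    using gt by (auto simp: clarke_subderiv_def split: if_splits)
  with gt obtain \<delta> where \<delta>: "\<delta> > 0"
    and gt': "ereal l < Limsup G (\<lambda>(t, x). INF u'\<in>ball w \<delta>. (f (x + t *\<^sub>R u') - f x) / ereal t)"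
    by (auto simp: clarke_subderiv_def w_def G_def less_SUP_iff)
  \<comment> \<open>The three bounds on \<open>t\<close> give \<open>\<alpha> * \<tau> < 1\<close>, \<open>m \<le> (1 - \<alpha> * \<tau>) * l\<close>, and closeness of \<open>y + \<tau> *\<^sub>R w'\<close> to
      \<open>y\<close>; the bound \<open>\<rho>'\<close> on the distance from \<open>x\<close> to \<open>y\<close> makes \<open>w'\<close> an admissible direction.\<close>
  define \<sigma> where "\<sigma> = min (min (1 / (\<alpha> + 1)) ((l - m) / (\<alpha> * \<bar>l\<bar> + 1))) (\<rho> / (2 * (norm w + \<delta>)))"
  define \<rho>' where "\<rho>' = min (\<rho> / 2) (\<delta> / (\<alpha> + 1))"
  have pos: "norm w + \<delta> > 0" "\<alpha> * \<bar>l\<bar> + 1 > 0" using \<delta> \<alpha> by (auto intro: add_nonneg_pos)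
  have \<sigma>: "\<sigma> > 0" using \<alpha> m \<rho> pos by (simp add: \<sigma>_def)
  have \<rho>': "\<rho>' > 0" using \<rho> \<delta> \<alpha> by (simp add: \<rho>'_def)
  have ev: "eventually (\<lambda>p. (0 < fst p \<and> fst p < \<sigma>) \<and> (dist (snd p) x < \<rho>' \<and> f (snd p) < \<infinity>)) G"
    unfolding G_def
  proof (rule eventually_prodI)
    show "eventually (\<lambda>t. 0 < t \<and> t < \<sigma>) (at_right (0::real))"
      unfolding eventually_at_right_field using \<sigma> by auto
    have "eventually (\<lambda>y. dist y x < \<rho>') (nhds x)"
      using \<rho>' by (auto simp: eventually_nhds_metric)
    moreover have "eventually (\<lambda>b. b < \<infinity>) (nhds (f x))"
      using dom by (intro order_tendstoD[OF filterlim_ident]) (auto simp: effdom_def)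
    ultimately have "eventually (\<lambda>p. dist (fst p) x < \<rho>' \<and> snd p < \<infinity>) (nhds (x, f x))"
      unfolding nhds_prod by (rule eventually_prodI)
    then show "eventually (\<lambda>y. dist y x < \<rho>' \<and> f y < \<infinity>) (filtercomap (\<lambda>x. (x, f x)) (nhds (x, f x)))"
      unfolding eventually_filtercomap by (intro exI conjI) (assumption, auto)
  qed
  have "frequently (\<lambda>(t, x). ereal l < (INF u'\<in>ball w \<delta>. (f (x + t *\<^sub>R u') - f x) / ereal t)) G"
  proof (rule ccontr)
    assume "\<not> ?thesis"
    then have "Limsup G (\<lambda>(t, x). INF u'\<in>ball w \<delta>. (f (x + t *\<^sub>R u') - f x) / ereal t) \<le> ereal l"
      by (intro Limsup_bounded) (auto simp: not_frequently case_prod_beta not_less)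
    then show False using gt' by simp
  qed
  then have "frequently (\<lambda>(t, y). (0 < t \<and> t < \<sigma> \<and> dist y x < \<rho>' \<and> f y < \<infinity>) \<and>
      ereal l < (INF u'\<in>ball w \<delta>. (f (y + t *\<^sub>R u') - f y) / ereal t)) G"
    by (rule frequently_rev_mp) (rule eventually_mono[OF ev], simp add: case_prod_beta)
  then obtain t y where ty: "0 < t" "t < \<sigma>" "dist y x < \<rho>'" "f y < \<infinity>"
      "ereal l < (INF u'\<in>ball w \<delta>. (f (y + t *\<^sub>R u') - f y) / ereal t)"
    by (auto dest!: frequently_ex)
  then obtain r where r: "f y = ereal r" using lsc_proper_finite[OF f, of y] by (auto simp: effdom_def)
  define w' where "w' = u + \<alpha> *\<^sub>R (xb - y)"
  have near: "dist w w' < \<delta>"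
  proof -
    have "w - w' = \<alpha> *\<^sub>R (y - x)" by (simp add: w_def w'_def algebra_simps)
    then have "dist w w' = \<alpha> * dist y x" using \<alpha> by (simp add: dist_norm)
    also have "\<dots> \<le> (\<alpha> + 1) * dist y x" by (simp add: algebra_simps)
    also have "\<dots> < (\<alpha> + 1) * (\<delta> / (\<alpha> + 1))"
      using ty(3) \<alpha> by (intro mult_strict_left_mono) (auto simp: \<rho>'_def)
    finally show ?thesis using \<alpha> by simp
  qed
  have "ereal l < (f (y + t *\<^sub>R w') - ereal r) / ereal t"
    using ty(5) unfolding r by (rule less_le_trans) (rule INF_lower, use near in simp)
  then have "ereal (r + l * t) < f (y + t *\<^sub>R w')"
    using ty(1) by (intro difference_quotient_gt)
  then obtain \<tau> where \<tau>: "0 \<le> \<tau>" "\<tau> < t"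
      "\<And>k. k > 0 \<Longrightarrow> ereal (k * l) \<le> radial_subderiv f (y + \<tau> *\<^sub>R w') (k *\<^sub>R w')"
    using radial_subderiv_mean_value[OF f r ty(1)] by blast
  let ?c = "y + \<tau> *\<^sub>R w'"
  define k where "k = 1 - \<alpha> * \<tau>"
  have small: "\<tau> < 1 / (\<alpha> + 1)" "\<tau> \<le> (l - m) / (\<alpha> * \<bar>l\<bar> + 1)" "\<tau> \<le> \<rho> / (2 * (norm w + \<delta>))"
    using \<tau>(2) ty(2) by (auto simp: \<sigma>_def)
  have "k > 0"
  proof -
    have "\<tau> * (\<alpha> + 1) < 1" using small(1) \<alpha> by (simp add: field_simps)
    then show ?thesis using \<tau>(1) by (simp add: k_def algebra_simps)
  qed
  have dir: "u + \<alpha> *\<^sub>R (xb - ?c) = k *\<^sub>R w'"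
    by (simp add: k_def w'_def algebra_simps)
  have "m \<le> k * l"
  proof -
    have "\<tau> * (\<alpha> * \<bar>l\<bar> + 1) \<le> l - m" using small(2) pos by (simp add: field_simps)
    moreover have "\<tau> * \<alpha> * l \<le> \<tau> * \<alpha> * \<bar>l\<bar>" using \<tau>(1) \<alpha> by (intro mult_left_mono) auto
    ultimately show ?thesis using \<tau>(1) by (simp add: k_def algebra_simps)
  qed
  have "ereal m \<le> ereal (k * l)" using \<open>m \<le> k * l\<close> by simp
  also have "\<dots> \<le> radial_subderiv f ?c (u + \<alpha> *\<^sub>R (xb - ?c))"
    unfolding dir by (rule \<tau>(3)) fact
  finally have "ereal m \<le> radial_subderiv f ?c (u + \<alpha> *\<^sub>R (xb - ?c))" .
  moreover have "dist ?c x < \<rho>"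
  proof -
    have "norm w' \<le> norm w + \<delta>"
      using near norm_triangle_sub[of w' w] by (simp add: dist_norm norm_minus_commute)
    then have "norm (\<tau> *\<^sub>R w') \<le> \<tau> * (norm w + \<delta>)"
      using \<tau>(1) by (simp add: mult_left_mono)
    also have "\<dots> \<le> \<rho> / 2" using small(3) pos by (simp add: field_simps)
    finally have "norm (\<tau> *\<^sub>R w') \<le> \<rho> / 2" .
    moreover have "dist ?c x \<le> dist y x + norm (\<tau> *\<^sub>R w')"
      using norm_triangle_ineq[of "y - x" "\<tau> *\<^sub>R w'"] by (simp add: dist_norm algebra_simps)
    ultimately show ?thesis using ty(3) by (simp add: \<rho>'_def)
  qed
  ultimately show ?thesis by blast
qed


section \<open>Subgradients near points with a large radial subderivative\<close>

text \<open>
  If \<open>n * norm w \<ge> \<bar>l\<bar>\<close>, this function has the value \<open>- l * \<tau>\<close> at each point \<open>x + \<tau> *\<^sub>R w\<close> of the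
  segment from \<open>x\<close> to \<open>x + s *\<^sub>R w\<close>, and it penalises the distance to the segment.  As the partial
  minimum of a jointly convex function of \<open>y\<close> and \<open>\<tau>\<close> it is convex in \<open>y\<close>.  It combines the two classical ingredients, a linear functional with
  value \<open>- l\<close> at \<open>w\<close> and a multiple of the distance to the segment, without an appeal to the
  Hahn--Banach theorem.
\<close>

definition segment_penalty :: "real \<Rightarrow> real \<Rightarrow> real \<Rightarrow> 'a::real_normed_vector \<Rightarrow> 'a \<Rightarrow> 'a \<Rightarrow> real" where
  "segment_penalty l n s x w y = (INF \<tau>\<in>{0..s}. n * norm (y - x - \<tau> *\<^sub>R w) - l * \<tau>)"

context
  fixes l n s :: real and x w :: "'a::real_normed_vector"
  assumes s: "s > 0" and n: "n > 0"
begin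

lemma segment_penalty_attained:
  obtains \<tau> where "0 \<le> \<tau>" "\<tau> \<le> s"
    "segment_penalty l n s x w y = n * norm (y - x - \<tau> *\<^sub>R w) - l * \<tau>"
proof -
  let ?F = "\<lambda>\<tau>. n * norm (y - x - \<tau> *\<^sub>R w) - l * \<tau>"
  have "\<exists>\<tau>\<in>{0..s}. \<forall>\<sigma>\<in>{0..s}. ?F \<tau> \<le> ?F \<sigma>"
    using s by (intro continuous_attains_inf continuous_intros) auto
  then obtain \<tau> where \<tau>: "\<tau> \<in> {0..s}" "\<And>\<sigma>. \<sigma> \<in> {0..s} \<Longrightarrow> ?F \<tau> \<le> ?F \<sigma>" by blast
  have "segment_penalty l n s x w y = ?F \<tau>"
    unfolding segment_penalty_def using \<tau> by (intro cInf_eq_minimum) auto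
  then show ?thesis using that[of \<tau>] \<tau>(1) by auto
qed

lemma segment_penalty_le:
  assumes "0 \<le> \<tau>" "\<tau> \<le> s"
  shows "segment_penalty l n s x w y \<le> n * norm (y - x - \<tau> *\<^sub>R w) - l * \<tau>"
  unfolding segment_penalty_def
proof (rule cINF_lower)
  have "- \<bar>l\<bar> * s \<le> n * norm (y - x - \<sigma> *\<^sub>R w) - l * \<sigma>" if "\<sigma> \<in> {0..s}" for \<sigma>
  proof -
    have "l * \<sigma> \<le> \<bar>l\<bar> * s" using that by (intro mult_mono) auto
    moreover have "0 \<le> n * norm (y - x - \<sigma> *\<^sub>R w)" using n by simp
    ultimately show ?thesis by linarith
  qed
  then show "bdd_below ((\<lambda>\<sigma>. n * norm (y - x - \<sigma> *\<^sub>R w) - l * \<sigma>) ` {0..s})"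
    by (rule bdd_belowI2)
qed (use assms in auto)

lemma segment_penalty_lipschitz:
  "n-lipschitz_on UNIV (segment_penalty l n s x w)"
proof -
  have le: "segment_penalty l n s x w y \<le> segment_penalty l n s x w z + n * dist y z" for y z
  proof -
    obtain \<tau> where \<tau>: "0 \<le> \<tau>" "\<tau> \<le> s"
        "segment_penalty l n s x w z = n * norm (z - x - \<tau> *\<^sub>R w) - l * \<tau>"
      using segment_penalty_attained .
    have "norm (y - x - \<tau> *\<^sub>R w) \<le> norm (z - x - \<tau> *\<^sub>R w) + dist y z"
      using norm_triangle_ineq[of "z - x - \<tau> *\<^sub>R w" "y - z"] by (simp add: dist_norm algebra_simps)
    then have "n * norm (y - x - \<tau> *\<^sub>R w) \<le> n * (norm (z - x - \<tau> *\<^sub>R w) + dist y z)"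
      using n by (intro mult_left_mono) auto
    then show ?thesis
      using segment_penalty_le[OF \<tau>(1,2), of y] \<tau>(3) by (simp add: algebra_simps)
  qed
  show ?thesis
  proof (rule lipschitz_onI)
    fix y z
    show "dist (segment_penalty l n s x w y) (segment_penalty l n s x w z) \<le> n * dist y z"
      using le[of y z] le[of z y] by (auto simp: dist_real_def dist_commute abs_le_iff)
  qed (use n in simp)
qed

lemma segment_penalty_convex: "convex_on UNIV (segment_penalty l n s x w)"
proof (rule convex_onI)
  fix t :: real and y z :: 'a
  assume t: "0 < t" "t < 1"
  obtain \<tau> where \<tau>: "0 \<le> \<tau>" "\<tau> \<le> s"
      "segment_penalty l n s x w y = n * norm (y - x - \<tau> *\<^sub>R w) - l * \<tau>"
    using segment_penalty_attained .
  obtain \<sigma> where \<sigma>: "0 \<le> \<sigma>" "\<sigma> \<le> s"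
      "segment_penalty l n s x w z = n * norm (z - x - \<sigma> *\<^sub>R w) - l * \<sigma>"
    using segment_penalty_attained .
  define \<rho> where "\<rho> = (1 - t) * \<tau> + t * \<sigma>"
  have "0 \<le> \<rho>" using t \<tau> \<sigma> by (simp add: \<rho>_def)
  moreover have "\<rho> \<le> s"
    unfolding \<rho>_def using t \<tau> \<sigma> convex_bound_le[of \<tau> s \<sigma> "1 - t" t] by simp
  ultimately have le: "segment_penalty l n s x w ((1 - t) *\<^sub>R y + t *\<^sub>R z)
      \<le> n * norm ((1 - t) *\<^sub>R y + t *\<^sub>R z - x - \<rho> *\<^sub>R w) - l * \<rho>"
    by (rule segment_penalty_le)
  have "(1 - t) *\<^sub>R y + t *\<^sub>R z - x - \<rho> *\<^sub>R w =
      (1 - t) *\<^sub>R (y - x - \<tau> *\<^sub>R w) + t *\<^sub>R (z - x - \<sigma> *\<^sub>R w)"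
    by (simp add: \<rho>_def algebra_simps)
  then have "norm ((1 - t) *\<^sub>R y + t *\<^sub>R z - x - \<rho> *\<^sub>R w)
      \<le> (1 - t) * norm (y - x - \<tau> *\<^sub>R w) + t * norm (z - x - \<sigma> *\<^sub>R w)"
    using norm_triangle_ineq[of "(1 - t) *\<^sub>R (y - x - \<tau> *\<^sub>R w)" "t *\<^sub>R (z - x - \<sigma> *\<^sub>R w)"] t by simp
  then have "n * norm ((1 - t) *\<^sub>R y + t *\<^sub>R z - x - \<rho> *\<^sub>R w)
      \<le> n * ((1 - t) * norm (y - x - \<tau> *\<^sub>R w) + t * norm (z - x - \<sigma> *\<^sub>R w))"
    using n by (intro mult_left_mono) auto
  then show "segment_penalty l n s x w ((1 - t) *\<^sub>R y + t *\<^sub>R z)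
      \<le> (1 - t) * segment_penalty l n s x w y + t * segment_penalty l n s x w z"
    using le unfolding \<tau>(3) \<sigma>(3) by (simp add: \<rho>_def algebra_simps)
qed simp

end

text \<open>
  The difference quotients of a convex function increase with the step size, and for the fixed step
  \<open>h\<close> they are continuous in the base point.
\<close>

lemma clarke_subderiv_convex_le:
  fixes \<phi> :: "'a::real_normed_vector \<Rightarrow> real"
  assumes conv: "convex_on UNIV \<phi>" and cont: "continuous_on UNIV \<phi>" and h: "h > 0"
  shows "clarke_subderiv (\<lambda>x. ereal (\<phi> x)) z v \<le> ereal ((\<phi> (z + h *\<^sub>R v) - \<phi> z) / h)"
proof -
  define \<psi> where "\<psi> x = (\<phi> (x + h *\<^sub>R v) - \<phi> x) / h" for x
  define G where "G = at_right (0::real) \<times>\<^sub>F filtercomap (\<lambda>x. (x, ereal (\<phi> x))) (nhds (z, ereal (\<phi> z)))"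
  have q: "(\<phi> (y + t *\<^sub>R v) - \<phi> y) / t \<le> \<psi> y" if t: "0 < t" "t < h" for t y
  proof -
    have "y + t *\<^sub>R v = (1 - t / h) *\<^sub>R y + (t / h) *\<^sub>R (y + h *\<^sub>R v)"
      using h by (simp add: algebra_simps)
    then have "\<phi> (y + t *\<^sub>R v) \<le> (1 - t / h) * \<phi> y + (t / h) * \<phi> (y + h *\<^sub>R v)"
      using convex_onD[OF conv, of "t / h" y "y + h *\<^sub>R v"] t h by simp
    then show ?thesis using t h by (simp add: \<psi>_def field_simps)
  qed
  have cont\<psi>: "(\<psi> \<longlongrightarrow> \<psi> z) (nhds z)"
  proof -
    have "continuous_on UNIV \<psi>"
      unfolding \<psi>_def using h
      by (intro continuous_intros continuous_on_compose2[OF cont] cont) auto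
    then show ?thesis by (simp add: continuous_on_eq_continuous_at isCont_def tendsto_nhds_iff)
  qed
  have le: "(INF u'\<in>ball v \<delta>. (ereal (\<phi> (y + t *\<^sub>R u')) - ereal (\<phi> y)) / ereal t) \<le> ereal (\<psi> y)"
    if "0 < t" "t < h" "\<delta> > 0" for t y \<delta>
    using that q[of t y] by (intro INF_lower2[of v]) auto
  have ev: "eventually (\<lambda>p. (0 < fst p \<and> fst p < h) \<and> \<psi> (snd p) < \<psi> z + e) G" if "e > 0" for e
    unfolding G_def
  proof (rule eventually_prodI)
    show "eventually (\<lambda>t. 0 < t \<and> t < h) (at_right (0::real))"
      unfolding eventually_at_right_field using h by auto
    have "eventually (\<lambda>y. \<psi> y < \<psi> z + e) (nhds z)"
      using order_tendstoD(2)[OF cont\<psi>] that by simp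
    moreover have "eventually (\<lambda>b::ereal. True) (nhds (ereal (\<phi> z)))" by simp
    ultimately have "eventually (\<lambda>p. \<psi> (fst p) < \<psi> z + e \<and> True) (nhds (z, ereal (\<phi> z)))"
      unfolding nhds_prod by (rule eventually_prodI)
    then show "eventually (\<lambda>y. \<psi> y < \<psi> z + e) (filtercomap (\<lambda>x. (x, ereal (\<phi> x))) (nhds (z, ereal (\<phi> z))))"
      unfolding eventually_filtercomap by (intro exI conjI) (assumption, auto)
  qed
  have bound: "Limsup G (\<lambda>(t, x). INF u'\<in>ball v \<delta>. (ereal (\<phi> (x + t *\<^sub>R u')) - ereal (\<phi> x)) / ereal t)
      \<le> ereal (\<psi> z) + ereal e" if e: "e > 0" and \<delta>: "\<delta> > 0" for e \<delta>
  proof (rule Limsup_bounded, rule eventually_mono[OF ev[OF e]])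
    fix p :: "real \<times> 'a"
    assume p: "(0 < fst p \<and> fst p < h) \<and> \<psi> (snd p) < \<psi> z + e"
    obtain t x where tx: "p = (t, x)" by (cases p)
    have "ereal (\<psi> x) \<le> ereal (\<psi> z) + ereal e" using p tx by simp
    then show "(case p of (t, x) \<Rightarrow> INF u'\<in>ball v \<delta>. (ereal (\<phi> (x + t *\<^sub>R u')) - ereal (\<phi> x)) / ereal t)
        \<le> ereal (\<psi> z) + ereal e"
      using order_trans[OF le[of t \<delta> x]] p \<delta> unfolding tx prod.case fst_conv by blast
  qed
  have lim: "Limsup G (\<lambda>(t, x). INF u'\<in>ball v \<delta>. (ereal (\<phi> (x + t *\<^sub>R u')) - ereal (\<phi> x)) / ereal t)
      \<le> ereal (\<psi> z)" if "\<delta> > 0" for \<delta>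
    by (rule ereal_le_epsilon2) (rule bound[OF _ that])
  have "clarke_subderiv (\<lambda>x. ereal (\<phi> x)) z v = (SUP \<delta>\<in>{0<..}.
      Limsup G (\<lambda>(t, x). INF u'\<in>ball v \<delta>. (ereal (\<phi> (x + t *\<^sub>R u')) - ereal (\<phi> x)) / ereal t))"
    unfolding clarke_subderiv_def G_def by (simp add: effdom_def)
  also have "\<dots> \<le> ereal (\<psi> z)"
    by (rule SUP_least) (rule lim, simp)
  finally show ?thesis by (simp only: \<psi>_def)
qed


lemma lsc_add_continuous:
  fixes f :: "'a::t2_space \<Rightarrow> ereal" and q :: "'a \<Rightarrow> real"
  assumes f: "lsc_proper f" and q: "continuous_on UNIV q"
  shows "f z + ereal (q z) \<le> Liminf (nhds z) (\<lambda>y. f y + ereal (q y))"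
  unfolding le_Liminf_iff
proof (intro allI impI)
  fix c assume c: "c < f z + ereal (q z)"
  show "eventually (\<lambda>y. c < f y + ereal (q y)) (nhds z)"
  proof (cases c)
    case (real c')
    have "ereal (c' - q z) < f z" using c real by (cases "f z") auto
    then obtain d where d: "c' - q z < d" "ereal d < f z"
      using ereal_dense2[of "ereal (c' - q z)" "f z"] by auto
    have "eventually (\<lambda>y. ereal d < f y) (nhds z)" by (rule lsc_proper_eventually_less) fact+
    moreover have "(q \<longlongrightarrow> q z) (nhds z)"
      using q by (simp add: continuous_on_eq_continuous_at isCont_def tendsto_nhds_iff)
    then have "eventually (\<lambda>y. c' - d < q y) (nhds z)"
      using d(1) by (intro order_tendstoD) auto
    ultimately show ?thesis
    proof eventually_elim
      case (elim y)
      then show ?case using real by (cases "f y") auto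
    qed
  next
    case MInf
    have "f y \<noteq> -\<infinity>" for y using f by (auto simp: lsc_proper_def)
    then have "c < f y + ereal (q y)" for y using MInf by (cases "f y") auto
    then show ?thesis by simp
  qed (use c in auto)
qed

text \<open>
  On a short segment from \<open>x\<close> in direction \<open>w\<close> the function \<open>f\<close> rises with slope more than \<open>l\<close>.
  Ekeland's principle, applied to \<open>f\<close> plus the segment penalty on a small ball, yields a point \<open>z\<close> which
  minimises this sum up to a small multiple of the distance.  The separation principle provides a
  limiting subgradient \<open>xs\<close> at \<open>z\<close> that is opposite to a subgradient of the convex part \<open>\<phi>\<close>.

  Let \<open>\<tau>\<close> be a parameter where the minimum in the penalty at \<open>z\<close> is attained.  Moving \<open>z\<close> along
  \<open>v = w + \<beta> *\<^sub>R (x - z)\<close> while \<open>\<tau>\<close> moves with speed \<open>1 - \<beta> * \<tau>\<close> multiplies the vector from the segment to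
  the moving point by a factor of at most \<open>1\<close>; so the penalty decreases with slope at least
  \<open>l * (1 - \<beta> * \<tau>)\<close>, which is close to \<open>l\<close>, and \<open>xs v\<close> is not much smaller than \<open>l\<close>.  This requires \<open>\<tau> < s\<close>, which
  holds because \<open>f\<close> is too large near the far end of the segment.  In the passage from \<open>xs\<close> to actual
  subgradients at nearby points \<open>y\<close>, the upper limit condition in \<open>subdiff_closure\<close> permits to replace
  \<open>x - z\<close> by \<open>x - y\<close>.
\<close>

theorem subdiff_near_radial_subderiv:
  fixes f :: "'a::banach \<Rightarrow> ereal"
  assumes D: "is_subdifferential D" and f: "lsc_proper f" and \<beta>: "\<beta> \<ge> 0"
    and gt: "ereal l < radial_subderiv f x w" and m: "m < l" and \<rho>: "\<rho> > 0"
  shows "\<exists>y ys. dist y x < \<rho> \<and> ys \<in> D f y \<and> m < blinfun_apply ys (w + \<beta> *\<^sub>R (x - y))"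
proof -
  have dom: "x \<in> effdom f" using gt by (auto simp: radial_subderiv_def split: if_splits)
  then obtain r where r: "f x = ereal r" using lsc_proper_finite[OF f] by blast
  \<comment> \<open>A loss of \<open>\<kappa>\<close> occurs in each of three places: through Ekeland's perturbation, through the factor
      \<open>1 - \<beta> * \<tau>\<close>, and in the passage from \<open>z\<close> to \<open>y\<close>.\<close>
  define \<kappa> where "\<kappa> = (l - m) / 4"
  have \<kappa>: "\<kappa> > 0" using m by (simp add: \<kappa>_def)
  have "eventually (\<lambda>y. ereal (r - 1) < f y) (nhds x)"
    using r by (intro lsc_proper_eventually_less[OF f]) auto
  then obtain R0 where R0: "R0 > 0" "\<And>y. dist y x < R0 \<Longrightarrow> ereal (r - 1) < f y"
    by (auto simp: eventually_nhds_metric)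
  define R where "R = min R0 \<rho> / 2"
  have R: "R > 0" "R < R0" "R < \<rho>" using R0 \<rho> by (auto simp: R_def)
  define \<epsilon> where "\<epsilon> = \<kappa> / (norm w + \<beta> * R + 1)"
  have den: "norm w + \<beta> * R + 1 > 0" using \<beta> R by (simp add: add_nonneg_pos)
  have \<epsilon>: "\<epsilon> > 0" "\<epsilon> * (norm w + \<beta> * R) \<le> \<kappa>"
    using den \<kappa> by (auto simp: \<epsilon>_def field_simps)
  define s0 where "s0 = min (R / (2 * (norm w + 1))) (\<kappa> / (\<beta> * \<bar>l\<bar> + 1))"
  have den2: "\<beta> * \<bar>l\<bar> + 1 > 0" using \<beta> by (simp add: add_nonneg_pos)
  have den3: "norm w + 1 > 0" by (simp add: add_nonneg_pos)
  have "s0 > 0" using R \<kappa> den2 den3 by (simp add: s0_def)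
  moreover have "eventually (\<lambda>t. ereal l < (f (x + t *\<^sub>R w) - f x) / ereal t) (at_right 0)"
    using gt dom by (intro less_LiminfD) (simp add: radial_subderiv_def)
  ultimately have "eventually (\<lambda>t. (0 < t \<and> t < s0) \<and> ereal l < (f (x + t *\<^sub>R w) - f x) / ereal t) (at_right 0)"
    by (intro eventually_conj) (auto simp: eventually_at_right_field)
  then obtain s where s: "0 < s" "s < s0" "ereal l < (f (x + s *\<^sub>R w) - ereal r) / ereal s"
    using r eventually_happens'[of "at_right (0::real)"] by auto
  have end_gt: "ereal (r + l * s) < f (x + s *\<^sub>R w)"
    using s by (intro difference_quotient_gt)
  have s_w: "s * norm w \<le> R / 2"
  proof -
    have "s * (norm w + 1) \<le> R / 2" using s(2) den3 by (simp add: s0_def field_simps)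
    then show ?thesis using s(1) by (simp add: algebra_simps)
  qed
  have s_l: "s * (\<beta> * \<bar>l\<bar>) \<le> \<kappa>"
  proof -
    have "s * (\<beta> * \<bar>l\<bar> + 1) \<le> \<kappa>" using s(2) den2 by (simp add: s0_def field_simps)
    then show ?thesis using s(1) by (simp add: algebra_simps)
  qed
  obtain \<rho>b where \<rho>b: "\<rho>b > 0" "\<And>y. dist y (x + s *\<^sub>R w) < \<rho>b \<Longrightarrow> ereal (r + l * s) < f y"
    using lsc_proper_eventually_less[OF f end_gt] by (auto simp: eventually_nhds_metric)
  \<comment> \<open>This \<open>n\<close> forces the minimiser \<open>z\<close> to be closer than \<open>\<rho>b\<close> and \<open>R / 2\<close> to a point of the segment.\<close>
  define n where "n = (2 + \<bar>l\<bar> * s) / min \<rho>b (R / 2)"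
  have n: "n > 0" using s R \<rho>b by (auto simp: n_def intro!: divide_pos_pos add_pos_nonneg)
  define q where "q = segment_penalty l n s x w"
  note q_attained = segment_penalty_attained[where l = l and n = n and s = s and x = x and w = w, OF s(1) n, folded q_def]
  note q_le = segment_penalty_le[where l = l and n = n and s = s and x = x and w = w, OF s(1) n, folded q_def]
  have q_lip: "n-lipschitz_on UNIV q" unfolding q_def by (rule segment_penalty_lipschitz) fact+
  have q_conv: "convex_on UNIV q" unfolding q_def by (rule segment_penalty_convex) fact+
  have q_cont: "continuous_on UNIV q" using q_lip by (rule lipschitz_on_continuous_on)
  have q_ge: "- (\<bar>l\<bar> * s) \<le> q y" for y
  proof -
    obtain \<tau> where \<tau>: "0 \<le> \<tau>" "\<tau> \<le> s" "q y = n * norm (y - x - \<tau> *\<^sub>R w) - l * \<tau>"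
      using q_attained .
    have "l * \<tau> \<le> \<bar>l\<bar> * s" using \<tau> by (intro mult_mono) auto
    moreover have "0 \<le> n * norm (y - x - \<tau> *\<^sub>R w)" using n by simp
    ultimately show ?thesis unfolding \<tau>(3) by linarith
  qed
  have q_x: "q x \<le> 0" using q_le[of 0 x] s by simp
  define C where "C = cball x R"
  obtain z where z: "z \<in> C" "(f z + ereal (q z)) + ereal (\<epsilon> * dist z x) \<le> f x + ereal (q x)"
      "\<And>y. y \<in> C \<Longrightarrow> f z + ereal (q z) \<le> (f y + ereal (q y)) + ereal (\<epsilon> * dist y z)"
  proof (rule ekeland[of C "\<lambda>y. f y + ereal (q y)" "r - 1 - \<bar>l\<bar> * s" x \<epsilon>])
    show "closed C" "x \<in> C" using R by (auto simp: C_def)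
    show "f y + ereal (q y) \<le> Liminf (nhds y) (\<lambda>y. f y + ereal (q y))" for y
      using f q_cont by (rule lsc_add_continuous)
    show "ereal (r - 1 - \<bar>l\<bar> * s) \<le> f y + ereal (q y)" if "y \<in> C" for y
      using R0(2)[of y] q_ge[of y] that R by (cases "f y") (auto simp: C_def dist_commute)
  qed (use r \<epsilon> in auto)
  have "f z < \<infinity>" using z(2) r by (cases "f z") auto
  then have z_dom: "z \<in> effdom f" by (simp add: effdom_def)
  then obtain fz where fz: "f z = ereal fz" using lsc_proper_finite[OF f] by blast
  have fz_q: "fz + q z + \<epsilon> * dist z x \<le> r"
    using z(2) q_x unfolding r fz by simp
  have fz_ge: "r - 1 \<le> fz"
    using R0(2)[of z] z(1) R fz by (auto simp: C_def dist_commute)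
  obtain \<tau> where \<tau>: "0 \<le> \<tau>" "\<tau> \<le> s" "q z = n * norm (z - x - \<tau> *\<^sub>R w) - l * \<tau>"
    using q_attained .
  define e where "e = norm (z - x - \<tau> *\<^sub>R w)"
  have q_z: "q z = n * e - l * \<tau>" using \<tau>(3) by (simp add: e_def)
  have e_lt: "e < min \<rho>b (R / 2)"
  proof -
    have "l * \<tau> \<le> \<bar>l\<bar> * s" using \<tau> by (intro mult_mono) auto
    moreover have "0 \<le> \<epsilon> * dist z x" using \<epsilon> by simp
    ultimately have "n * e \<le> 1 + \<bar>l\<bar> * s" using fz_q fz_ge q_z by linarith
    also have "\<dots> < n * min \<rho>b (R / 2)" using R \<rho>b by (simp add: n_def)
    finally show ?thesis using n by simp
  qed
  have z_near: "dist z x < R"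
  proof -
    have "dist z x \<le> e + \<tau> * norm w"
      using norm_triangle_ineq[of "z - x - \<tau> *\<^sub>R w" "\<tau> *\<^sub>R w"] \<tau>(1) by (simp add: dist_norm e_def)
    also have "\<tau> * norm w \<le> s * norm w" using \<tau>(2) by (intro mult_right_mono) auto
    finally show ?thesis using e_lt s_w by simp
  qed
  have \<tau>_less: "\<tau> < s"
  proof (rule ccontr)
    assume "\<not> \<tau> < s"
    then have "\<tau> = s" using \<tau>(2) by simp
    then have "dist z (x + s *\<^sub>R w) < \<rho>b" using e_lt by (simp add: e_def dist_norm algebra_simps)
    then have "r + l * s < fz" using \<rho>b(2)[of z] fz by simp
    moreover have "0 \<le> n * e" using n by (simp add: e_def)
    moreover have "0 \<le> \<epsilon> * dist z x" using \<epsilon> by simp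
    moreover have "q z = n * e - l * s" using q_z \<open>\<tau> = s\<close> by simp
    ultimately show False using fz_q by linarith
  qed
  define \<phi> where "\<phi> y = q y + \<epsilon> * dist y z" for y
  have \<phi>_cont: "continuous_on UNIV \<phi>"
    unfolding \<phi>_def by (intro continuous_intros q_cont)
  have \<phi>_conv: "convex_on UNIV \<phi>"
    unfolding \<phi>_def
  proof (intro convex_on_add q_conv convex_on_cmul)
    show "convex_on UNIV (\<lambda>y. dist y z)"
      using convex_on_dist[of UNIV z] by (simp add: dist_commute)
  qed (use \<epsilon> in simp)
  have dom_\<phi>: "effdom (\<lambda>y. ereal (\<phi> y)) = UNIV" by (simp add: effdom_def)
  have "lsc_proper (\<lambda>y. ereal (\<phi> y))"
  proof -
    have "((\<lambda>y. ereal (\<phi> y)) \<longlongrightarrow> ereal (\<phi> y)) (nhds y)" for y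
      using \<phi>_cont by (simp add: continuous_on_eq_continuous_at isCont_def tendsto_nhds_iff)
    then have "Liminf (nhds y) (\<lambda>y. ereal (\<phi> y)) = ereal (\<phi> y)" for y
      by (intro lim_imp_Liminf) auto
    then show ?thesis by (simp add: lsc_proper_def dom_\<phi>)
  qed
  moreover have "convex_ext (\<lambda>y. ereal (\<phi> y))" using \<phi>_conv by (simp add: convex_ext_def dom_\<phi>)
  moreover have "lipschitz_near (\<lambda>y. ereal (\<phi> y)) z"
  proof -
    have "\<epsilon>-lipschitz_on UNIV (\<lambda>y. \<epsilon> * dist y z)"
    proof (rule lipschitz_onI)
      fix y y'
      have "\<bar>dist y z - dist y' z\<bar> \<le> dist y y'" by metric
      then have "\<epsilon> * \<bar>dist y z - dist y' z\<bar> \<le> \<epsilon> * dist y y'" using \<epsilon> by simp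
      then show "dist (\<epsilon> * dist y z) (\<epsilon> * dist y' z) \<le> \<epsilon> * dist y y'"
        using \<epsilon> by (simp add: dist_real_def abs_mult flip: right_diff_distrib)
    qed (use \<epsilon> in simp)
    then have "(n + \<epsilon>)-lipschitz_on UNIV \<phi>"
      unfolding \<phi>_def by (rule lipschitz_on_add[OF q_lip])
    then have "(n + \<epsilon>)-lipschitz_on (ball z 1) \<phi>" by (rule lipschitz_on_subset) simp
    then show ?thesis
      unfolding lipschitz_near_def dom_\<phi> by (intro exI[of _ 1]) auto
  qed
  moreover have "eventually (\<lambda>y. f z + ereal (\<phi> z) \<le> f y + ereal (\<phi> y)) (nhds z)"
  proof -
    have "eventually (\<lambda>y. y \<in> ball x R) (nhds z)"
      using z_near by (intro eventually_nhds_in_open) (auto simp: dist_commute)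
    then show ?thesis
    proof eventually_elim
      case (elim y)
      then have "f z + ereal (q z) \<le> (f y + ereal (q y)) + ereal (\<epsilon> * dist y z)"
        by (intro z(3)) (auto simp: C_def)
      then show ?case by (cases "f y") (auto simp: \<phi>_def fz)
    qed
  qed
  ultimately obtain xs ys where xs: "xs \<in> subdiff_closure D f z"
      and ys: "ys \<in> D (\<lambda>y. ereal (\<phi> y)) z" and sum: "xs + ys = 0"
    using D f z_dom unfolding is_subdifferential_def separation_principle_def by blast
  have ys_clarke: "ys \<in> clarke_subdiff (\<lambda>y. ereal (\<phi> y)) z"
    using D ys \<open>lsc_proper (\<lambda>y. ereal (\<phi> y))\<close> unfolding is_subdifferential_def by blast
  define v where "v = w + \<beta> *\<^sub>R (x - z)"
  have norm_v: "\<epsilon> * norm v \<le> \<kappa>"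
  proof -
    have "norm v \<le> norm w + \<beta> * dist z x"
      using norm_triangle_ineq[of w "\<beta> *\<^sub>R (x - z)"] \<beta> by (simp add: v_def dist_norm norm_minus_commute)
    also have "\<dots> \<le> norm w + \<beta> * R"
      using z_near \<beta> by (intro add_left_mono mult_left_mono) auto
    finally have "\<epsilon> * norm v \<le> \<epsilon> * (norm w + \<beta> * R)" using \<epsilon> by simp
    then show ?thesis using \<epsilon>(2) by linarith
  qed
  have "blinfun_apply ys v \<le> - l * (1 - \<beta> * \<tau>) + \<epsilon> * norm v"
  proof -
    define h where "h = min (s - \<tau>) (1 / (\<beta> + 1))"
    have h: "h > 0" "h \<le> s - \<tau>" using \<tau>_less \<beta> by (auto simp: h_def)
    have "h * (\<beta> + 1) \<le> 1" using \<beta> by (simp add: h_def min_def field_simps)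
    then have h1: "h * \<beta> \<le> 1" using h(1) by (simp add: algebra_simps)
    define \<sigma> where "\<sigma> = \<tau> + h * (1 - \<beta> * \<tau>)"
    have "0 \<le> h * (\<beta> * \<tau>)" "0 \<le> \<tau> * (1 - h * \<beta>)" using h h1 \<beta> \<tau> by auto
    then have \<sigma>: "0 \<le> \<sigma>" "\<sigma> \<le> s" using h by (auto simp: \<sigma>_def algebra_simps)
    have "z + h *\<^sub>R v - x - \<sigma> *\<^sub>R w = (1 - h * \<beta>) *\<^sub>R (z - x - \<tau> *\<^sub>R w)"
      by (simp add: \<sigma>_def v_def algebra_simps)
    then have "norm (z + h *\<^sub>R v - x - \<sigma> *\<^sub>R w) = (1 - h * \<beta>) * e"
      using h1 by (simp add: e_def)
    also have "\<dots> \<le> e" using h(1) \<beta> by (simp add: e_def algebra_simps)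
    finally have "n * norm (z + h *\<^sub>R v - x - \<sigma> *\<^sub>R w) \<le> n * e" using n by simp
    then have "q (z + h *\<^sub>R v) \<le> q z - h * (l * (1 - \<beta> * \<tau>))"
      using q_le[OF \<sigma>, of "z + h *\<^sub>R v"] by (simp add: q_z \<sigma>_def algebra_simps)
    then have "\<phi> (z + h *\<^sub>R v) - \<phi> z \<le> h * (- l * (1 - \<beta> * \<tau>) + \<epsilon> * norm v)"
      using h(1) by (simp add: \<phi>_def dist_norm algebra_simps)
    then have "(\<phi> (z + h *\<^sub>R v) - \<phi> z) / h \<le> - l * (1 - \<beta> * \<tau>) + \<epsilon> * norm v"
      using h(1) by (simp add: divide_le_eq mult.commute)
    moreover have "ereal (blinfun_apply ys v) \<le> ereal ((\<phi> (z + h *\<^sub>R v) - \<phi> z) / h)"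
      using ys_clarke clarke_subderiv_convex_le[OF \<phi>_conv \<phi>_cont h(1)]
      unfolding clarke_subdiff_def by (blast intro: order_trans)
    ultimately show ?thesis by simp
  qed
  moreover have "blinfun_apply xs v = - blinfun_apply ys v"
    using sum by (metis add_eq_0_iff2 blinfun.minus_left)
  moreover have "l * \<beta> * \<tau> \<le> \<kappa>"
  proof -
    have "l * \<beta> * \<tau> \<le> \<bar>l\<bar> * \<beta> * s" using \<tau> \<beta> by (intro mult_mono) auto
    then show ?thesis using s_l by (simp add: mult_ac)
  qed
  moreover have "- l * (1 - \<beta> * \<tau>) = l * \<beta> * \<tau> - l" by (simp add: algebra_simps)
  moreover have "l = m + 4 * \<kappa>" by (simp add: \<kappa>_def field_simps)
  ultimately have xs_v: "blinfun_apply xs v > m + \<kappa>"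
    using norm_v \<kappa> by linarith
  from xs obtain F where F: "F \<noteq> bot" "eventually (\<lambda>(y, ys). ys \<in> D f y) F"
      "((\<lambda>(y, ys). (y, f y)) \<longlongrightarrow> (z, f z)) F"
      "\<And>v. ((\<lambda>(y, ys). blinfun_apply ys v) \<longlongrightarrow> blinfun_apply xs v) F"
      "Limsup F (\<lambda>(y, ys). ereal (blinfun_apply ys (y - z))) \<le> 0"
    unfolding subdiff_closure_def by blast
  have "eventually (\<lambda>(y, ys). dist y x < \<rho>) F"
  proof -
    have "((\<lambda>p. fst (case p of (y, ys) \<Rightarrow> (y, f y))) \<longlongrightarrow> fst (z, f z)) F"
      by (rule tendsto_fst[OF F(3)])
    then have "((\<lambda>p. dist (fst p) x) \<longlongrightarrow> dist z x) F"
      by (auto simp: case_prod_beta intro!: tendsto_dist)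
    then have "eventually (\<lambda>p. dist (fst p) x < \<rho>) F"
      by (rule order_tendstoD) (use z_near R in simp)
    then show ?thesis by (rule eventually_mono) auto
  qed
  moreover have "eventually (\<lambda>(y, ys). m + \<kappa> < blinfun_apply ys v) F"
    by (rule eventually_mono[OF order_tendstoD(1)[OF F(4)[of v] xs_v]]) auto
  moreover have "eventually (\<lambda>(y, ys). blinfun_apply ys (y - z) < \<kappa> / (\<beta> + 1)) F"
  proof -
    have "0 < ereal (\<kappa> / (\<beta> + 1))" using \<kappa> \<beta> by simp
    then have "eventually (\<lambda>p. (case p of (y, ys) \<Rightarrow> ereal (blinfun_apply ys (y - z))) < ereal (\<kappa> / (\<beta> + 1))) F"
      using F(5) by (intro Limsup_lessD) (rule le_less_trans)
    then show ?thesis by (rule eventually_mono) auto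
  qed
  ultimately have "eventually (\<lambda>(y, ys). dist y x < \<rho> \<and> ys \<in> D f y \<and> m < blinfun_apply ys (w + \<beta> *\<^sub>R (x - y))) F"
    using F(2)
  proof eventually_elim
    case (elim p)
    obtain y ys where p: "p = (y, ys)" by (cases p)
    have "\<beta> * blinfun_apply ys (y - z) \<le> \<beta> * (\<kappa> / (\<beta> + 1))"
      using elim(3) \<beta> p by (intro mult_left_mono) auto
    also have "\<dots> \<le> \<kappa>" using \<beta> \<kappa> by (simp add: field_simps)
    finally have "\<beta> * blinfun_apply ys (y - z) \<le> \<kappa>" .
    moreover have "w + \<beta> *\<^sub>R (x - y) = v - \<beta> *\<^sub>R (y - z)" by (simp add: v_def algebra_simps)
    then have "blinfun_apply ys (w + \<beta> *\<^sub>R (x - y)) = blinfun_apply ys v - \<beta> * blinfun_apply ys (y - z)"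
      by (simp add: blinfun.diff_right blinfun.scaleR_right)
    ultimately show ?case using elim p by auto
  qed
  then show ?thesis using eventually_happens'[OF F(1)] by fastforce
qed

text \<open>
  A perturbation of \<open>xb + t *\<^sub>R v'\<close> by less than \<open>t * (e / 2)\<close> amounts to a perturbation of the direction
  \<open>v'\<close> by less than \<open>e / 2\<close>.
\<close>

lemma Limsup_at_dir_mono_nearby:
  fixes F G :: "'a::real_normed_vector \<Rightarrow> ereal"
  assumes near: "\<And>x l m \<rho>. ereal l < F x \<Longrightarrow> m < l \<Longrightarrow> \<rho> > 0 \<Longrightarrow> \<exists>y. dist y x < \<rho> \<and> ereal m \<le> G y"
  shows "Limsup (at_dir xb u) F \<le> Limsup (at_dir xb u) G"
proof (rule ccontr)
  assume "\<not> ?thesis"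
  then have "Limsup (at_dir xb u) G < Limsup (at_dir xb u) F" by simp
  then obtain m where m: "Limsup (at_dir xb u) G < ereal m" "ereal m < Limsup (at_dir xb u) F"
    using ereal_dense2 by blast
  then obtain l where l: "ereal m < ereal l" "ereal l < Limsup (at_dir xb u) F"
    using ereal_dense2 by blast
  obtain e where e: "e > 0" "\<And>t v'. 0 < t \<Longrightarrow> t < e \<Longrightarrow> norm (v' - u) < e \<Longrightarrow> G (xb + t *\<^sub>R v') < ereal m"
    using Limsup_lessD[OF m(1)] unfolding eventually_at_dir by auto
  have "F (xb + t *\<^sub>R v') \<le> ereal l" if t: "0 < t" "t < e / 2" "norm (v' - u) < e / 2" for t v'
  proof (rule ccontr)
    assume "\<not> ?thesis"
    then obtain y where y: "dist y (xb + t *\<^sub>R v') < t * (e / 2)" "ereal m \<le> G y"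
      using near[of l "xb + t *\<^sub>R v'" m "t * (e / 2)"] l(1) t(1) e(1) by (auto simp: not_le)
    define v where "v = (1 / t) *\<^sub>R (y - xb)"
    have yv: "y = xb + t *\<^sub>R v" using t by (simp add: v_def)
    have "t * norm (v - v') < t * (e / 2)"
      using y(1) t unfolding yv by (simp add: dist_norm flip: scaleR_diff_right)
    then have "norm (v - v') < e / 2" using t by simp
    then have "norm (v - u) < e"
      using norm_triangle_ineq[of "v - v'" "v' - u"] t(3) by simp
    then have "G y < ereal m" unfolding yv using t e(1) by (intro e(2)) auto
    then show False using y(2) by simp
  qed
  then have "eventually (\<lambda>x. F x \<le> ereal l) (at_dir xb u)"
    unfolding eventually_at_dir using e(1) by (intro exI[of _ "e / 2"]) auto
  then have "Limsup (at_dir xb u) F \<le> ereal l" by (rule Limsup_bounded)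
  then show False using l(2) by simp
qed

text \<open>
  Nearby points with almost the same values exist in both directions.  The identity
  \<open>w + \<alpha> *\<^sub>R (x - y) = u + \<alpha> *\<^sub>R (xb - y)\<close> for \<open>w = u + \<alpha> *\<^sub>R (xb - x)\<close> makes the subgradients found near \<open>x\<close>
  large in the direction of the field at their own base point.
\<close>

theorem Limsup_subdiff_subderiv_eq_radial_subderiv:
  fixes f :: "'a::banach \<Rightarrow> ereal"
  assumes D: "is_subdifferential D" and f: "lsc_proper f" and \<alpha>: "\<alpha> \<ge> 0"
  shows "Limsup (at_dir xb u) (\<lambda>x. subdiff_subderiv D f x (u + \<alpha> *\<^sub>R (xb - x))) =
    Limsup (at_dir xb u) (\<lambda>x. radial_subderiv f x (u + \<alpha> *\<^sub>R (xb - x)))"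
proof (rule antisym; rule Limsup_at_dir_mono_nearby)
  fix x l m and \<rho> :: real
  assume "ereal l < subdiff_subderiv D f x (u + \<alpha> *\<^sub>R (xb - x))" "m < l" "\<rho> > 0"
  moreover from this(1) obtain xs where "xs \<in> D f x" "l < blinfun_apply xs (u + \<alpha> *\<^sub>R (xb - x))"
    by (auto simp: subdiff_subderiv_def less_SUP_iff)
  moreover from this(1) have "ereal (blinfun_apply xs v) \<le> clarke_subderiv f x v" for v
    using D f unfolding is_subdifferential_def clarke_subdiff_def by blast
  ultimately show "\<exists>y. dist y x < \<rho> \<and> ereal m \<le> radial_subderiv f y (u + \<alpha> *\<^sub>R (xb - y))"
    by (intro radial_subderiv_near_clarke_subderiv[OF f \<alpha>, of l])
      (auto intro: less_le_trans[of "ereal l" "ereal (blinfun_apply xs (u + \<alpha> *\<^sub>R (xb - x)))"])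
next
  fix x l m and \<rho> :: real
  assume gt: "ereal l < radial_subderiv f x (u + \<alpha> *\<^sub>R (xb - x))" and m: "m < l" and \<rho>: "\<rho> > 0"
  obtain y ys where y: "dist y x < \<rho>" "ys \<in> D f y"
      "m < blinfun_apply ys (u + \<alpha> *\<^sub>R (xb - x) + \<alpha> *\<^sub>R (x - y))"
    using subdiff_near_radial_subderiv[OF D f \<alpha> gt m \<rho>] by blast
  have "u + \<alpha> *\<^sub>R (xb - x) + \<alpha> *\<^sub>R (x - y) = u + \<alpha> *\<^sub>R (xb - y)" by (simp add: algebra_simps)
  then have "ereal m \<le> ereal (blinfun_apply ys (u + \<alpha> *\<^sub>R (xb - y)))"
    using y(3) by (simp only: ereal_less_eq)
  also have "\<dots> \<le> subdiff_subderiv D f y (u + \<alpha> *\<^sub>R (xb - y))"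
    unfolding subdiff_subderiv_def using y(2) by (rule SUP_upper)
  finally show "\<exists>y. dist y x < \<rho> \<and> ereal m \<le> subdiff_subderiv D f y (u + \<alpha> *\<^sub>R (xb - y))"
    using y(1) by blast
qed

section \<open>The integration formula\<close>

lemma radial_subderiv_along_segment:
  fixes g :: "'a::real_normed_vector \<Rightarrow> ereal" and xb u :: 'a
  defines "F \<equiv> \<lambda>t. real_of_ereal (g (xb + t *\<^sub>R u))"
  assumes g: "lsc_proper g" and seg: "closed_segment xb (xb + u) \<subseteq> effdom g"
    and t: "0 < t" "t < 1" and F: "(F has_real_derivative L) (at t)"
  shows "radial_subderiv g (xb + t *\<^sub>R u) u = ereal L"
proof -
  have dom: "xb + r *\<^sub>R u \<in> effdom g" if "0 \<le> r" "r \<le> 1" for r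
  proof -
    have "xb + r *\<^sub>R u = (1 - r) *\<^sub>R xb + r *\<^sub>R (xb + u)" by (simp add: algebra_simps)
    then have "xb + r *\<^sub>R u \<in> closed_segment xb (xb + u)" unfolding in_segment using that by blast
    then show ?thesis using seg by blast
  qed
  have gF: "g (xb + r *\<^sub>R u) = ereal (F r)" if r: "0 \<le> r" "r \<le> 1" for r
  proof -
    obtain v where "g (xb + r *\<^sub>R u) = ereal v" using lsc_proper_finite[OF g dom[OF r]] .
    then show ?thesis by (simp add: F_def)
  qed
  have "((\<lambda>h. (F (t + h) - F t) / h) \<longlongrightarrow> L) (at_right 0)"
    using F unfolding DERIV_def by (rule tendsto_mono[rotated]) (simp add: at_le)
  then have lim: "((\<lambda>h. ereal ((F (t + h) - F t) / h)) \<longlongrightarrow> ereal L) (at_right 0)"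
    by simp
  have "eventually (\<lambda>h. (g (xb + t *\<^sub>R u + h *\<^sub>R u) - g (xb + t *\<^sub>R u)) / ereal h
      = ereal ((F (t + h) - F t) / h)) (at_right 0)"
    unfolding eventually_at_right_field
  proof (intro exI conjI allI impI)
    show "1 - t > 0" using t by simp
    fix h assume h: "0 < h" "h < 1 - t"
    have "g (xb + t *\<^sub>R u + h *\<^sub>R u) = g (xb + (t + h) *\<^sub>R u)" by (simp add: algebra_simps)
    then show "(g (xb + t *\<^sub>R u + h *\<^sub>R u) - g (xb + t *\<^sub>R u)) / ereal h = ereal ((F (t + h) - F t) / h)"
      using gF[of t] gF[of "t + h"] t h by simp
  qed
  then have "radial_subderiv g (xb + t *\<^sub>R u) u = Liminf (at_right 0) (\<lambda>h. ereal ((F (t + h) - F t) / h))"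
    using dom[of t] t unfolding radial_subderiv_def by (simp add: Liminf_eq)
  also have "\<dots> = ereal L" using lim by (intro lim_imp_Liminf) auto
  finally show ?thesis .
qed

theorem theorem4p3:
  fixes D :: "'a::banach subdiff_operator" and g :: "'a \<Rightarrow> ereal"
  assumes "is_subdifferential D"
    and "g \<in> LACG_star_natural"
  shows "\<forall>xb u. closed_segment xb (xb + u) \<subseteq> effdom g \<longrightarrow>
    has_HK_integral (\<lambda>t. natural_subderiv g (xb + t *\<^sub>R u) u)
      (real_of_ereal (g (xb + u)) - real_of_ereal (g xb)) {0..1} \<and>
    (\<forall>t\<in>{0..1}. natural_subderiv g (xb + t *\<^sub>R u) u =
      (INF \<alpha>\<in>{0..}. Limsup (at_dir (xb + t *\<^sub>R u) u)
         (\<lambda>x. subdiff_subderiv D g x (u + \<alpha> *\<^sub>R (xb + t *\<^sub>R u - x)))))"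
proof (intro allI impI conjI ballI)
  fix xb u :: 'a and t :: real
  show "natural_subderiv g (xb + t *\<^sub>R u) u =
      (INF \<alpha>\<in>{0..}. Limsup (at_dir (xb + t *\<^sub>R u) u)
         (\<lambda>x. subdiff_subderiv D g x (u + \<alpha> *\<^sub>R (xb + t *\<^sub>R u - x))))"
    unfolding natural_subderiv_def
    using assms by (intro INF_cong refl Limsup_subdiff_subderiv_eq_radial_subderiv[symmetric])
      (auto simp: LACG_star_natural_def LACG_star_def)
next
  fix xb u :: 'a
  assume seg: "closed_segment xb (xb + u) \<subseteq> effdom g"
  define F where "F = (\<lambda>t. real_of_ereal (g (xb + t *\<^sub>R u)))"
  define \<psi> where "\<psi> t = (if F differentiable at t then deriv F t else 0)" for t
  \<comment> \<open>At the end points a derivative of \<open>F\<close> would involve values of \<open>g\<close> outside the segment.\<close>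
  define N where "N = {t\<in>{0..1}. \<not> F differentiable at t} \<union> {0, 1}"
  have g: "lsc_proper g" "g \<in> LACG_star" using assms(2) by (auto simp: LACG_star_natural_def LACG_star_def)
  have "ACG_star (\<lambda>t. real_of_ereal (g (xb + t *\<^sub>R (xb + u - xb)))) {0..1}"
    using g(2) seg unfolding LACG_star_def by blast
  then have F: "ACG_star F {0..1}" by (simp add: F_def)
  have "(\<psi> has_integral (F 1 - F 0)) {0..1}"
    unfolding \<psi>_def using F by (intro ACG_star_has_integral_deriv) auto
  then have int: "(\<psi> has_integral (real_of_ereal (g (xb + u)) - real_of_ereal (g xb))) {0..1}"
    by (simp add: F_def)
  have "negligible N" unfolding N_def by (intro negligible_Un ACG_star_differentiable_AE F) simp
  then have "AE t in lebesgue. t \<notin> N"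
    by (intro AE_not_in) (simp add: negligible_iff_null_sets)
  moreover have "AE t\<in>{0..1} in lebesgue.
      natural_subderiv g (xb + t *\<^sub>R u) u = radial_subderiv g (xb + t *\<^sub>R u) u"
    using assms(2) seg unfolding LACG_star_natural_def by blast
  ultimately have "AE t\<in>{0..1} in lebesgue. natural_subderiv g (xb + t *\<^sub>R u) u = ereal (\<psi> t)"
  proof eventually_elim
    case (elim t)
    show ?case
    proof
      assume t: "t \<in> {0..1}"
      then have "0 < t" "t < 1" and d: "F differentiable at t"
        using elim(1) by (auto simp: N_def less_le)
      moreover have "(F has_real_derivative \<psi> t) (at t)"
        using d by (auto simp: \<psi>_def real_differentiable_def DERIV_imp_deriv)
      ultimately have "radial_subderiv g (xb + t *\<^sub>R u) u = ereal (\<psi> t)"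
        using g(1) seg unfolding F_def by (intro radial_subderiv_along_segment) auto
      then show "natural_subderiv g (xb + t *\<^sub>R u) u = ereal (\<psi> t)" using elim(2) t by simp
    qed
  qed
  with int show "has_HK_integral (\<lambda>t. natural_subderiv g (xb + t *\<^sub>R u) u)
      (real_of_ereal (g (xb + u)) - real_of_ereal (g xb)) {0..1}"
    unfolding has_HK_integral_def by (intro exI[of _ \<psi>] conjI)
qed

end
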